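(* Assume (C1): the covariance matrices $\Sigma_x$ and $\Sigma_y$ of $X$ and $Y$ are finite and have full rank $d$. Let $l^*(\theta)=l(h_N^{-C}(\theta))$ be the two-sample extended empirical log-likelihood ratio defined by the composite similarity mapping $h_N^C$ with expansion factor $\gamma(N,l(\theta))=1+l(\theta)/(2N)$. Then, with $\theta_0=\mu_y-\mu_x$, $$l^*(\theta_0)\stackrel{D}{\longrightarrow}\chi^2_d\qquad\text{as } n\to+\infty .$$
   Context: Let $X,Y$ be random vectors in $\mathbb{R}^d$ with means $\mu_x,\mu_y$ and covariance matrices $\Sigma_x,\Sigma_y$. Let $X_1,\dots,X_m$ be independent copies of $X$ and $Y_1,\dots,Y_n$ independent copies of $Y$, all $m+n$ vectors mutually independent. Put $N=m+n$. Throughout, $m\ge n>d$ and $m/n=O(1)$ as $n\to\infty$. For probability vectors $p=(p_1,\dots,p_m)$ and $q=(q_1,\dots,q_n)$ (nonnegative entries summing to $1$) let $\theta(p,q)=\sum_{j=1}^n q_jY_j-\sum_{i=1}^m p_iX_i$. Let $D_\theta\subset\mathbb{R}^d$ be the set of all values $\theta(p,q)$. The original two-sample empirical log-likelihood ratio (OEL) is $$l(\theta)=-2\max_{(p,q):\,\theta(p,q)=\theta}\Big(\sum_{i=1}^m\log(mp_i)+\sum_{j=1}^n\log(nq_j)\Big),\qquad \theta\in D_\theta,$$ with $\log 0=-\infty$. Its domain is $\Theta_n=\{\theta\in D_\theta: l(\theta)<+\infty\}$, i.e. the set of $\theta(p,q)$ with all entries of $p$ and $q$ strictly positive. $\Theta_n$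 is treated as an open subset of $\mathbb{R}^d$; on the event (of probability tending to $0$) that the samples are so degenerate that $\Theta_n$ is not open, the quantities below may be defined arbitrarily. Let $\hat\theta=\bar Y-\bar X$ with $\bar X=m^{-1}\sum_i X_i$, $\bar Y=n^{-1}\sum_j Y_j$. The composite similarity mapping $h_N^C:\Theta_n\to\mathbb{R}^d$ is $$h_N^C(\theta)=\hat\theta+\gamma(N,l(\theta))(\theta-\hat\theta),\qquad \gamma(N,l(\theta))=1+\frac{l(\theta)}{2N}.$$ It is a bijection; $h_N^{-C}:\mathbb{R}^d\to\Theta_n$ denotes its inverse. The extended empirical log-likelihood ratio (EEL) is $l^*(\theta)=l(h_N^{-C}(\theta))$, $\theta\in\mathbb{R}^d$. *)

theory Defs
  imports "HOL-Probability.Probability" "HOL-Library.Landau_Symbols"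
begin

section \<open>Mean and covariance of a random vector\<close>

definition mean_vec :: "'a measure \<Rightarrow> ('a \<Rightarrow> real ^ 'd) \<Rightarrow> real ^ 'd" where
  "mean_vec P X = integral\<^sup>L P X"

definition cov_matrix :: "'a measure \<Rightarrow> ('a \<Rightarrow> real ^ 'd) \<Rightarrow> real ^ 'd ^ 'd" where
  "cov_matrix P X =
     (\<chi> i j. integral\<^sup>L P (\<lambda>w. (X w $ i - mean_vec P X $ i) * (X w $ j - mean_vec P X $ j)))"

text \<open>Integrals of non-integrable functions are \<open>0\<close> in the library, so finiteness of the mean
  and of the entries of the covariance matrix has to be stated as integrability.\<close>

definition finite_cov :: "'a measure \<Rightarrow> ('a \<Rightarrow> real ^ 'd) \<Rightarrow> bool" where
  "finite_cov P X \<longleftrightarrow> integrable P X \<and>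
     (\<forall>i j. integrable P (\<lambda>w. (X w $ i - mean_vec P X $ i) * (X w $ j - mean_vec P X $ j)))"


section \<open>The chi-square distribution\<close>

text \<open>The law of the sum of squares of \<open>k\<close> independent standard normal variables.\<close>

definition chi_square :: "nat \<Rightarrow> real measure" where
  "chi_square k =
     distr (\<Pi>\<^sub>M i\<in>{..<k}. density lborel std_normal_density) borel (\<lambda>z. \<Sum>i<k. (z i)\<^sup>2)"


section \<open>Two-sample empirical likelihood of a fixed pair of samples\<close>

text \<open>The samples are \<open>x 0, \<dots>, x (m - 1)\<close> and \<open>y 0, \<dots>, y (n - 1)\<close>; values of \<open>x\<close>, \<open>y\<close> and of
  weight functions at larger indices are never used.\<close>

definition prob_vector :: "nat \<Rightarrow> (nat \<Rightarrow> real) \<Rightarrow> bool" where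
  "prob_vector k p \<longleftrightarrow> (\<forall>i<k. 0 \<le> p i) \<and> (\<Sum>i<k. p i) = 1"

definition theta ::
  "nat \<Rightarrow> nat \<Rightarrow> (nat \<Rightarrow> real ^ 'd) \<Rightarrow> (nat \<Rightarrow> real ^ 'd) \<Rightarrow> (nat \<Rightarrow> real) \<Rightarrow> (nat \<Rightarrow> real) \<Rightarrow> real ^ 'd"
where
  "theta m n x y p q = (\<Sum>j<n. q j *\<^sub>R y j) - (\<Sum>i<m. p i *\<^sub>R x i)"

definition D_theta ::
  "nat \<Rightarrow> nat \<Rightarrow> (nat \<Rightarrow> real ^ 'd) \<Rightarrow> (nat \<Rightarrow> real ^ 'd) \<Rightarrow> (real ^ 'd) set" where
  "D_theta m n x y = {theta m n x y p q | p q. prob_vector m p \<and> prob_vector n q}"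

text \<open>Logarithm with the convention \<open>log 0 = -\<infinity>\<close>; only nonnegative arguments occur.\<close>

definition eln :: "real \<Rightarrow> ereal" where
  "eln t = (if 0 < t then ereal (ln t) else - \<infinity>)"

text \<open>The maximum is written as a supremum in the extended reals. For parameters in
  \<^term>\<open>D_theta m n x y\<close> it is attained (upper semicontinuity on a compact set); outside, the
  supremum is over the empty set and the ratio is \<open>+\<infinity>\<close>.\<close>

definition oel ::
  "nat \<Rightarrow> nat \<Rightarrow> (nat \<Rightarrow> real ^ 'd) \<Rightarrow> (nat \<Rightarrow> real ^ 'd) \<Rightarrow> real ^ 'd \<Rightarrow> ereal" where
  "oel m n x y \<theta> =
     - 2 * (SUP (p, q) \<in> {(p, q). prob_vector m p \<and> prob_vector n q \<and> theta m n x y p q = \<theta>}.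
              (\<Sum>i<m. eln (real m * p i)) + (\<Sum>j<n. eln (real n * q j)))"

definition Theta ::
  "nat \<Rightarrow> nat \<Rightarrow> (nat \<Rightarrow> real ^ 'd) \<Rightarrow> (nat \<Rightarrow> real ^ 'd) \<Rightarrow> (real ^ 'd) set" where
  "Theta m n x y = {\<theta> \<in> D_theta m n x y. oel m n x y \<theta> < \<infinity>}"


section \<open>Composite similarity mapping and extended empirical likelihood\<close>

definition theta_hat ::
  "nat \<Rightarrow> nat \<Rightarrow> (nat \<Rightarrow> real ^ 'd) \<Rightarrow> (nat \<Rightarrow> real ^ 'd) \<Rightarrow> real ^ 'd" where
  "theta_hat m n x y = (1 / real n) *\<^sub>R (\<Sum>j<n. y j) - (1 / real m) *\<^sub>R (\<Sum>i<m. x i)"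

definition expansion_factor :: "nat \<Rightarrow> real \<Rightarrow> real" where
  "expansion_factor N t = 1 + t / (2 * real N)"

definition sim_map ::
  "nat \<Rightarrow> nat \<Rightarrow> (nat \<Rightarrow> real ^ 'd) \<Rightarrow> (nat \<Rightarrow> real ^ 'd) \<Rightarrow> real ^ 'd \<Rightarrow> real ^ 'd" where
  "sim_map m n x y \<theta> = theta_hat m n x y +
     expansion_factor (m + n) (real_of_ereal (oel m n x y \<theta>)) *\<^sub>R (\<theta> - theta_hat m n x y)"

definition sim_map_inv ::
  "nat \<Rightarrow> nat \<Rightarrow> (nat \<Rightarrow> real ^ 'd) \<Rightarrow> (nat \<Rightarrow> real ^ 'd) \<Rightarrow> real ^ 'd \<Rightarrow> real ^ 'd" where
  "sim_map_inv m n x y = inv_into (Theta m n x y) (sim_map m n x y)"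

text \<open>The argument \<open>r\<close> is the arbitrary value taken for degenerate samples, where
  \<^term>\<open>Theta m n x y\<close> is not open. For non-degenerate samples
  \<^term>\<open>sim_map m n x y\<close> is a bijection from \<^term>\<open>Theta m n x y\<close> onto the whole space and
  \<^term>\<open>oel m n x y\<close> is finite on \<^term>\<open>Theta m n x y\<close>.\<close>

definition eel ::
  "nat \<Rightarrow> nat \<Rightarrow> (nat \<Rightarrow> real ^ 'd) \<Rightarrow> (nat \<Rightarrow> real ^ 'd) \<Rightarrow> real \<Rightarrow> real ^ 'd \<Rightarrow> real" where
  "eel m n x y r \<theta> =
     (if open (Theta m n x y) then real_of_ereal (oel m n x y (sim_map_inv m n x y \<theta>)) else r)"

end

theory Submission
  imports Defs
begin

text \<open>
  Let \<open>S\<^sub>x\<close> and \<open>S\<^sub>y\<close> be the sample covariance matrices, taken about the sample means, and let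
  \<open>V = S\<^sub>x / m + S\<^sub>y / n\<close> be the estimated covariance matrix of \<open>\<theta>\<close>-hat. The theorem holds because
  the log-likelihood ratio \<open>l\<close> is a quadratic form up to a factor close to one: if \<open>\<delta> = V \<nu>\<close>, then
  \<open>l(\<theta>-hat + \<delta>)\<close> lies between \<open>(1 - 4\<eta>) (\<nu> \<bullet> \<delta>)\<close> and \<open>(1 + 4\<eta>) (\<nu> \<bullet> \<delta>)\<close>, where
  \<open>\<eta> \<le> 1 / 2\<close> bounds the absolute values of \<open>\<nu> \<bullet> a / m\<close> and \<open>\<nu> \<bullet> b / n\<close> for all centred
  observations \<open>a\<close>, \<open>b\<close> of the two samples. The upper bound comes from explicit weights, tilted linearly along \<open>\<nu>\<close>, which meet the constraint exactly
  (\<open>oel_upper\<close>); the lower bound is weak duality for the same tilt with the opposite sign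
  (\<open>oel_lower\<close>). Both estimates are deterministic.

  The extended ratio enters through one equation. By convexity \<open>l\<close> does not decrease along the segment from
  \<open>\<theta>\<close>-hat to \<open>\<theta>\<^sub>0\<close>, so \<open>l*(\<theta>\<^sub>0)\<close> is the number \<open>s\<close> with \<open>l(\<theta>\<^sub>s) = s\<close>, where
  \<open>\<theta>\<^sub>s = \<theta>-hat + (\<theta>\<^sub>0 - \<theta>-hat) / (1 + s / (2N))\<close> (\<open>eel_fixed_point\<close>), and \<open>l*(\<theta>\<^sub>0) \<le> s\<close> means
  \<open>l(\<theta>\<^sub>s) \<le> s\<close> (\<open>eel_le_iff\<close>). Sublevel sets of \<open>l\<close> are projections along a compact set of weights,
  hence closed jointly in the parameter and the observations; this makes the statistic measurable
  (\<open>measurable_eel\<close>). As \<open>s\<close> stays bounded in probability, the factor \<open>1 + s / (2N)\<close> tends to one.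

  Probability is needed for three facts. The sample covariance matrices are close to \<open>\<Sigma>\<^sub>x\<close> and
  \<open>\<Sigma>\<^sub>y\<close> as quadratic forms, by the weak law of large numbers, and the largest observation is of
  smaller order than the square root of the sample size, because second moments are finite
  (\<open>good_event\<close>); the latter makes \<open>\<eta>\<close> small. Hence \<open>l*(\<theta>\<^sub>0)\<close> is close to
  \<open>Z = \<Sum> i<d. (v\<^sub>i \<bullet> (\<theta>-hat - \<theta>\<^sub>0))\<^sup>2\<close> for a basis \<open>v\<close> that is orthonormal for the form
  \<open>\<Sigma>\<^sub>x / m + \<Sigma>\<^sub>y / n\<close> (\<open>eel_quadratic_comparison\<close>). Finally \<open>Z\<close> is asymptotically chi-square: the vector
  of the \<open>v\<^sub>i \<bullet> (\<theta>-hat - \<theta>\<^sub>0)\<close> has a characteristic function that tends to the Gaussian one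
  (\<open>standardised_char_limit\<close>); integrating it against an independent Gaussian vector turns it into the
  Laplace transform of \<open>Z\<close>, whose values at the integers are the moments of \<open>exp (- Z / 2)\<close>, and
  these determine the limit law by Weierstrass approximation on the unit interval
  (\<open>cts_step_chi_square_limit\<close>). Slutsky's argument (\<open>slutsky_truncated\<close>) combines the two.
\<close>

section \<open>Sublevel sets of the empirical log-likelihood ratio\<close>

text \<open>The likelihood ratio itself. It is continuous in the weights including the boundary of the
  simplices, where its logarithm is not; all suprema are therefore taken of this product.\<close>

definition el_prod :: "nat \<Rightarrow> nat \<Rightarrow> (nat \<Rightarrow> real) \<Rightarrow> (nat \<Rightarrow> real) \<Rightarrow> real" where
  "el_prod m n p q = (\<Prod>i<m. real m * p i) * (\<Prod>j<n. real n * q j)"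

text \<open>Weights vanish beyond the sample, so that this is a compact set of functions.\<close>

definition weight_simplex :: "nat \<Rightarrow> (nat \<Rightarrow> real) set" where
  "weight_simplex k = {p. prob_vector k p \<and> (\<forall>i\<ge>k. p i = 0)}"

lemma eln_mult: "0 \<le> a \<Longrightarrow> 0 \<le> b \<Longrightarrow> eln (a * b) = eln a + eln b"
  by (auto simp: eln_def ln_mult zero_less_mult_iff)

lemma sum_eln:
  assumes "finite A" "\<And>i. i \<in> A \<Longrightarrow> 0 \<le> f i"
  shows "(\<Sum>i\<in>A. eln (f i)) = eln (\<Prod>i\<in>A. f i)"
  using assms
proof (induction A rule: finite_induct)
  case empty then show ?case by (simp add: eln_def zero_ereal_def)
next
  case (insert a A)
  then show ?case by (simp add: eln_mult prod_nonneg)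
qed

lemma el_prod_nonneg: "prob_vector m p \<Longrightarrow> prob_vector n q \<Longrightarrow> 0 \<le> el_prod m n p q"
  unfolding el_prod_def prob_vector_def by (intro mult_nonneg_nonneg prod_nonneg) auto

lemma sum_eln_weights:
  assumes "prob_vector m p" "prob_vector n q"
  shows "(\<Sum>i<m. eln (real m * p i)) + (\<Sum>j<n. eln (real n * q j)) = eln (el_prod m n p q)"
proof -
  have "(\<Sum>i<k. eln (real k * r i)) = eln (\<Prod>i<k. real k * r i)" "0 \<le> (\<Prod>i<k. real k * r i)"
    if "prob_vector k r" for k r
    using that by (auto simp: prob_vector_def intro!: prod_nonneg sum_eln)
  then show ?thesis using assms by (simp add: el_prod_def eln_mult)
qed

lemma eln_mono: "a \<le> b \<Longrightarrow> eln a \<le> eln b"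
  by (auto simp: eln_def)

text \<open>A level of the logarithm, which may be \<open>-\<infinity>\<close>, becomes a positive level of its argument.\<close>

lemma eln_ge_iff: "ereal (- s / 2) \<le> eln r \<longleftrightarrow> exp (- s / 2) \<le> r"
proof (cases "0 < r")
  case True
  then have "exp (- s / 2) \<le> r \<longleftrightarrow> - s / 2 \<le> ln r" using ln_ge_iff by simp
  then show ?thesis using True by (simp add: eln_def)
next
  case False
  then show ?thesis using exp_gt_zero[of "- s / 2"] by (simp add: eln_def) (metis exp_gt_zero less_le_trans)
qed

lemma simplex_le_1:
  assumes "p \<in> weight_simplex k" "i < k" shows "p i \<le> 1"
proof -
  have "p i \<le> (\<Sum>i<k. p i)"
    using assms by (intro member_le_sum) (auto simp: weight_simplex_def prob_vector_def)
  with assms show ?thesis by (auto simp: weight_simplex_def prob_vector_def)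
qed

text \<open>Evaluation at an index; for observations and weights as functions of other variables.\<close>

lemma continuous_on_coord: "continuous_on S f \<Longrightarrow> continuous_on S (\<lambda>z. f z (i::nat) :: 'b::topological_space)"
  by (metis continuous_on_product_then_coordinatewise)

text \<open>A closed subset of a product of compact intervals, by Tychonoff's theorem.\<close>

lemma compact_simplex: "compact (weight_simplex k)"
proof -
  define B where "B = PiE UNIV (\<lambda>i. if i < k then {0..1::real} else {0})"
  have "compactin (product_topology (\<lambda>i. euclidean) UNIV) B"
    unfolding B_def compactin_PiE by (auto simp: compactin_euclidean_iff)
  then have "compact B"
    by (simp add: euclidean_product_topology compactin_euclidean_iff)
  have "continuous_on UNIV (\<lambda>p::nat \<Rightarrow> real. \<Sum>i<k. p i)"
    by (intro continuous_on_sum continuous_on_coord[OF continuous_on_id])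
  then have "closed ((\<lambda>p::nat \<Rightarrow> real. \<Sum>i<k. p i) -` {1})"
    by (intro closed_vimage) auto
  with \<open>compact B\<close> have "compact (B \<inter> ((\<lambda>p. \<Sum>i<k. p i) -` {1}))"
    by (rule compact_Int_closed)
  also have "B \<inter> ((\<lambda>p. \<Sum>i<k. p i) -` {1}) = weight_simplex k"
  proof (rule set_eqI, rule iffI)
    fix p assume "p \<in> B \<inter> ((\<lambda>p. \<Sum>i<k. p i) -` {1})"
    then have *: "\<And>i. p i \<in> (if i < k then {0..1} else {0})" "(\<Sum>i<k. p i) = 1"
      by (auto simp: B_def PiE_def Pi_def)
    have "0 \<le> p i" if "i < k" for i using *(1)[of i] that by simp
    moreover have "p i = 0" if "k \<le> i" for i using *(1)[of i] that by simp
    ultimately show "p \<in> weight_simplex k" using *(2) by (simp add: weight_simplex_def prob_vector_def)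
  next
    fix p assume p: "p \<in> weight_simplex k"
    then have "p i \<in> (if i < k then {0..1} else {0})" for i
      using simplex_le_1[OF p, of i] by (auto simp: weight_simplex_def prob_vector_def)
    then show "p \<in> B \<inter> ((\<lambda>p. \<Sum>i<k. p i) -` {1})"
      using p by (auto simp: B_def weight_simplex_def prob_vector_def)
  qed
  finally show ?thesis .
qed

lemma continuous_on_el_prod:
  assumes "continuous_on S f" "continuous_on S g"
  shows "continuous_on S (\<lambda>z. el_prod m n (f z) (g z))"
  unfolding el_prod_def
  by (intro continuous_on_mult continuous_on_prod continuous_on_const assms[THEN continuous_on_coord])

lemma continuous_on_theta:
  assumes "continuous_on S a" "continuous_on S b" "continuous_on S f" "continuous_on S g"
  shows "continuous_on S (\<lambda>z. theta m n (a z) (b z) (f z) (g z))"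
  unfolding theta_def
  by (intro continuous_on_diff continuous_on_sum continuous_on_scaleR assms[THEN continuous_on_coord])

definition level_weights :: "nat \<Rightarrow> nat \<Rightarrow> real \<Rightarrow> ((nat \<Rightarrow> real) \<times> (nat \<Rightarrow> real)) set" where
  "level_weights m n s = {z \<in> weight_simplex m \<times> weight_simplex n. exp (- s / 2) \<le> el_prod m n (fst z) (snd z)}"

lemma compact_level_weights: "compact (level_weights m n s)"
proof -
  have "closed ((\<lambda>z. el_prod m n (fst z) (snd z)) -` {exp (- s / 2)..})"
    by (intro closed_vimage continuous_on_el_prod continuous_on_const continuous_on_fst continuous_on_snd continuous_on_id) auto
  then have "compact (weight_simplex m \<times> weight_simplex n \<inter> ((\<lambda>z. el_prod m n (fst z) (snd z)) -` {exp (- s / 2)..}))"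
    by (intro compact_Int_closed compact_Times compact_simplex)
  also have "weight_simplex m \<times> weight_simplex n \<inter> ((\<lambda>z. el_prod m n (fst z) (snd z)) -` {exp (- s / 2)..}) = level_weights m n s"
    by (auto simp: level_weights_def)
  finally show ?thesis .
qed

lemma truncate_weights:
  fixes p :: "nat \<Rightarrow> real"
  assumes "prob_vector m p" "prob_vector n q"
  obtains p' q' where "p' \<in> weight_simplex m" "q' \<in> weight_simplex n"
    "el_prod m n p' q' = el_prod m n p q" "theta m n x y p' q' = theta m n x y p q"
proof (rule that)
  let ?p = "\<lambda>i. if i < m then p i else 0" and ?q = "\<lambda>i. if i < n then q i else 0"
  show "?p \<in> weight_simplex m" "?q \<in> weight_simplex n" using assms by (auto simp: weight_simplex_def prob_vector_def)
  show "el_prod m n ?p ?q = el_prod m n p q" by (simp add: el_prod_def)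
  show "theta m n x y ?p ?q = theta m n x y p q" by (simp add: theta_def)
qed

text \<open>The supremum that defines \<^const>\<open>oel\<close> is attained, because a continuous function is maximised over
  a compact set of weights. All later arguments use the ratio only through these sublevel sets.\<close>

lemma oel_le_iff:
  "oel m n x y \<theta> \<le> ereal s \<longleftrightarrow>
    (\<exists>(p, q) \<in> level_weights m n s. theta m n x y p q = \<theta>)"
proof -
  define F where "F = {(p, q). prob_vector m p \<and> prob_vector n q \<and> theta m n x y p q = \<theta>}"
  define S where "S = (SUP (p, q) \<in> F. eln (el_prod m n p q))"
  have "(SUP (p, q) \<in> F. (\<Sum>i<m. eln (real m * p i)) + (\<Sum>j<n. eln (real n * q j))) = S"
    unfolding S_def by (intro SUP_cong refl) (auto simp: F_def sum_eln_weights)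
  then have oel: "oel m n x y \<theta> = - 2 * S" by (simp add: oel_def F_def)
  have *: "oel m n x y \<theta> \<le> ereal s \<longleftrightarrow> ereal (- s / 2) \<le> S"
    unfolding oel by (cases S) (auto simp: field_simps)
  show ?thesis
  proof
    assume "oel m n x y \<theta> \<le> ereal s"
    then have S: "ereal (- s / 2) \<le> S" by (simp add: *)
    define G where "G = {z \<in> weight_simplex m \<times> weight_simplex n. theta m n x y (fst z) (snd z) = \<theta>}"
    have "closed ((\<lambda>z. theta m n x y (fst z) (snd z)) -` {\<theta>})"
      by (intro closed_vimage continuous_on_theta continuous_on_const continuous_on_fst continuous_on_snd continuous_on_id) auto
    then have "compact (weight_simplex m \<times> weight_simplex n \<inter> ((\<lambda>z. theta m n x y (fst z) (snd z)) -` {\<theta>}))"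
      by (intro compact_Int_closed compact_Times compact_simplex)
    also have "weight_simplex m \<times> weight_simplex n \<inter> ((\<lambda>z. theta m n x y (fst z) (snd z)) -` {\<theta>}) = G"
      by (auto simp: G_def)
    finally have "compact G" .
    \<comment> \<open>the supremum over an empty set is \<open>-\<infinity>\<close>\<close>
    have "F \<noteq> {}"
    proof
      assume "F = {}"
      then show False using S by (simp add: S_def bot_ereal_def)
    qed
    have FG: "\<exists>z'\<in>G. el_prod m n (fst z') (snd z') = el_prod m n (fst z) (snd z)" if "z \<in> F" for z
    proof -
      have "prob_vector m (fst z)" "prob_vector n (snd z)" "theta m n x y (fst z) (snd z) = \<theta>"
        using that by (auto simp: F_def)
      moreover from this obtain p' q' where "p' \<in> weight_simplex m" "q' \<in> weight_simplex n"
        "el_prod m n p' q' = el_prod m n (fst z) (snd z)"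
        "theta m n x y p' q' = theta m n x y (fst z) (snd z)"
        using truncate_weights[of m "fst z" n "snd z" x y] by blast
      ultimately show ?thesis by (intro bexI[of _ "(p', q')"]) (auto simp: G_def)
    qed
    from \<open>F \<noteq> {}\<close> FG have "G \<noteq> {}" by blast
    have "continuous_on G (\<lambda>z. el_prod m n (fst z) (snd z))"
      by (intro continuous_on_el_prod continuous_on_const continuous_on_fst continuous_on_snd continuous_on_id)
    from continuous_attains_sup[OF \<open>compact G\<close> \<open>G \<noteq> {}\<close> this]
    obtain z where z: "z \<in> G" "\<And>z'. z' \<in> G \<Longrightarrow> el_prod m n (fst z') (snd z') \<le> el_prod m n (fst z) (snd z)"
      by blast
    have "S \<le> eln (el_prod m n (fst z) (snd z))"
      unfolding S_def
    proof (rule SUP_least)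
      fix z' assume "z' \<in> F"
      from FG[OF this] z(2) have "el_prod m n (fst z') (snd z') \<le> el_prod m n (fst z) (snd z)"
        by metis
      then show "(case z' of (p, q) \<Rightarrow> eln (el_prod m n p q)) \<le> eln (el_prod m n (fst z) (snd z))"
        by (auto simp: case_prod_beta intro: eln_mono)
    qed
    with S have "exp (- s / 2) \<le> el_prod m n (fst z) (snd z)"
      using eln_ge_iff order_trans by blast
    with z(1) show "\<exists>(p, q) \<in> level_weights m n s. theta m n x y p q = \<theta>"
      by (intro bexI[of _ z]) (auto simp: level_weights_def G_def)
  next
    assume "\<exists>(p, q) \<in> level_weights m n s. theta m n x y p q = \<theta>"
    then obtain p q where pq: "(p, q) \<in> level_weights m n s" "theta m n x y p q = \<theta>" by blast
    then have "(p, q) \<in> F" by (auto simp: F_def level_weights_def weight_simplex_def)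
    then have "eln (el_prod m n p q) \<le> S"
      unfolding S_def by (rule SUP_upper2) simp
    moreover have "ereal (- s / 2) \<le> eln (el_prod m n p q)"
      using pq unfolding eln_ge_iff by (simp add: level_weights_def)
    ultimately show "oel m n x y \<theta> \<le> ereal s" unfolding * by (rule order_trans[rotated])
  qed
qed

text \<open>Uniform weights maximise the likelihood: \<open>t \<le> exp (t - 1)\<close> for each factor, and the exponents
  sum to zero.\<close>

lemma el_prod_le_1:
  assumes "p \<in> weight_simplex m" "q \<in> weight_simplex n"
  shows "el_prod m n p q \<le> 1"
proof -
  have 1: "(\<Prod>i<k. real k * r i) \<le> 1" if "r \<in> weight_simplex k" for k r
  proof (cases "\<exists>i<k. r i = 0")
    case True
    then have "(\<Prod>i<k. real k * r i) = 0" by (subst prod_zero_iff) auto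
    then show ?thesis by linarith
  next
    case False
    have pos: "real k * r i > 0" if "i < k" for i
    proof -
      have "0 \<le> r i" "r i \<noteq> 0" using False \<open>r \<in> weight_simplex k\<close> that by (auto simp: weight_simplex_def prob_vector_def)
      then show ?thesis using that by simp
    qed
    have "(\<Prod>i<k. real k * r i) \<le> (\<Prod>i<k. exp (real k * r i - 1))"
      using pos exp_ge_add_one_self[of "real k * r i - 1" for i]
      by (intro prod_mono) (auto simp: less_imp_le)
    also have "\<dots> = exp (\<Sum>i<k. real k * r i - 1)" by (simp add: exp_sum)
    also have "(\<Sum>i<k. real k * r i - 1) = 0"
      using that by (simp add: sum_subtractf flip: sum_distrib_left) (simp add: weight_simplex_def prob_vector_def)
    finally show ?thesis by simp
  qed
  have "0 \<le> (\<Prod>j<n. real n * q j)"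
    using assms by (intro prod_nonneg) (auto simp: weight_simplex_def prob_vector_def)
  then show ?thesis unfolding el_prod_def using 1[OF assms(1)] 1[OF assms(2)]
    by (meson mult_le_one)
qed

lemma oel_nonneg: "0 \<le> oel m n x y \<theta>"
proof (rule ccontr)
  assume "\<not> ?thesis"
  then have "\<exists>s. oel m n x y \<theta> < ereal s \<and> ereal s < 0"
    by (intro ereal_dense2) simp
  then obtain s where s: "oel m n x y \<theta> < ereal s" "ereal s < 0"
    by blast
  then obtain p q where "(p, q) \<in> level_weights m n s"
    using oel_le_iff[of m n x y \<theta> s] by auto
  then have "exp (- s / 2) \<le> 1" 
    using el_prod_le_1[of p m q n] by (auto simp: level_weights_def simp del: exp_le_one_iff)
  with s show False by simp
qed

lemma simplex_convex:
  assumes "p \<in> weight_simplex k" "p' \<in> weight_simplex k" "0 \<le> t" "t \<le> 1"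
  shows "(\<lambda>i. (1 - t) * p i + t * p' i) \<in> weight_simplex k"
proof -
  have "(\<Sum>i<k. (1 - t) * p i + t * p' i) = (1 - t) * (\<Sum>i<k. p i) + t * (\<Sum>i<k. p' i)"
    by (simp add: sum.distrib sum_distrib_left)
  also have "\<dots> = 1" using assms by (simp add: weight_simplex_def prob_vector_def)
  finally show ?thesis using assms by (auto simp: weight_simplex_def prob_vector_def)
qed

lemma el_prod_pos_iff:
  assumes "p \<in> weight_simplex m" "q \<in> weight_simplex n"
  shows "0 < el_prod m n p q \<longleftrightarrow> (\<forall>i<m. 0 < p i) \<and> (\<forall>j<n. 0 < q j)"
proof -
  have "0 \<le> el_prod m n p q"
    using assms by (intro el_prod_nonneg) (auto simp: weight_simplex_def)
  then have "0 < el_prod m n p q \<longleftrightarrow> (\<forall>i<m. p i \<noteq> 0) \<and> (\<forall>j<n. q j \<noteq> 0)"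
    by (auto simp: el_prod_def order.strict_iff_order)
  then show ?thesis
    using assms by (auto simp: weight_simplex_def prob_vector_def order.strict_iff_order)
qed

text \<open>Concavity of the logarithm, factor by factor, in the form of levels.\<close>

lemma log_concave_el_prod:
  assumes p: "p \<in> weight_simplex m" "q \<in> weight_simplex n" "exp (- s / 2) \<le> el_prod m n p q"
    and p': "p' \<in> weight_simplex m" "q' \<in> weight_simplex n" "exp (- s' / 2) \<le> el_prod m n p' q'"
    and t: "0 \<le> t" "t \<le> 1"
  shows "exp (- ((1 - t) * s + t * s') / 2) \<le>
    el_prod m n (\<lambda>i. (1 - t) * p i + t * p' i) (\<lambda>j. (1 - t) * q j + t * q' j)"
proof -
  have "0 < el_prod m n p q" "0 < el_prod m n p' q'" 
    using p(3) p'(3) by (meson exp_gt_zero less_le_trans)+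
  then have pos: "\<And>i. i<m \<Longrightarrow> 0 < p i" "\<And>j. j<n \<Longrightarrow> 0 < q j" "\<And>i. i<m \<Longrightarrow> 0 < p' i" "\<And>j. j<n \<Longrightarrow> 0 < q' j"
    using el_prod_pos_iff p p' by blast+
  let ?p = "\<lambda>i. (1 - t) * p i + t * p' i" and ?q = "\<lambda>j. (1 - t) * q j + t * q' j"
  have cpos: "0 < (1 - t) * a + t * b" if "0 < a" "0 < b" for a b :: real
    using t that by (cases "t = 0") (auto intro: add_nonneg_pos)
  have ln_el: "ln (el_prod m n p q) = (\<Sum>i<m. ln (real m * p i)) + (\<Sum>j<n. ln (real n * q j))"
    if "\<And>i. i<m \<Longrightarrow> 0 < p i" "\<And>j. j<n \<Longrightarrow> 0 < q j" for p q
  proof -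
    have "0 < (\<Prod>i<m. real m * p i)" "0 < (\<Prod>j<n. real n * q j)"
      using that by (auto intro!: prod_pos)
    moreover have "ln (\<Prod>i<m. real m * p i) = (\<Sum>i<m. ln (real m * p i))"
      using that by (intro ln_prod) (auto simp: less_imp_neq[symmetric] dest: less_imp_neq)
    moreover have "ln (\<Prod>j<n. real n * q j) = (\<Sum>j<n. ln (real n * q j))"
      using that by (intro ln_prod) (auto simp: less_imp_neq[symmetric] dest: less_imp_neq)
    ultimately show ?thesis unfolding el_prod_def by (subst ln_mult_pos) simp_all
  qed
  have ln1: "(1 - t) * ln (c * a) + t * ln (c * b) \<le> ln (c * ((1 - t) * a + t * b))"
    if "0 < a" "0 < b" "0 < c" for a b c :: real
  proof -
    have "(1 - t) * ln (c * a) + t * ln (c * b) \<le> ln ((1 - t) *\<^sub>R (c * a) + t *\<^sub>R (c * b))"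
      using that t ln_concave by (intro concave_onD[OF ln_concave]) auto
    also have "(1 - t) *\<^sub>R (c * a) + t *\<^sub>R (c * b) = c * ((1 - t) * a + t * b)" by (simp add: algebra_simps)
    finally show ?thesis .
  qed
  have pq_pos: "0 < el_prod m n ?p ?q"
    using el_prod_pos_iff simplex_convex[OF p(1) p'(1) t] simplex_convex[OF p(2) p'(2) t] pos cpos by blast
  have "- s / 2 \<le> ln (el_prod m n p q)" "- s' / 2 \<le> ln (el_prod m n p' q')"
    using p(3) p'(3) \<open>0 < el_prod m n p q\<close> \<open>0 < el_prod m n p' q'\<close> by (simp_all add: ln_ge_iff)
  then have "(1 - t) * (- s / 2) + t * (- s' / 2) \<le> (1 - t) * ln (el_prod m n p q) + t * ln (el_prod m n p' q')"
    using t by (intro add_mono mult_left_mono) auto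
  also have "\<dots> = (\<Sum>i<m. (1 - t) * ln (real m * p i) + t * ln (real m * p' i))
      + (\<Sum>j<n. (1 - t) * ln (real n * q j) + t * ln (real n * q' j))"
    using pos by (simp add: ln_el sum.distrib sum_distrib_left distrib_left ac_simps)
  also have "\<dots> \<le> (\<Sum>i<m. ln (real m * ?p i)) + (\<Sum>j<n. ln (real n * ?q j))"
    using pos by (intro add_mono sum_mono ln1) auto
  also have "\<dots> = ln (el_prod m n ?p ?q)"
    using pos cpos by (subst ln_el) auto
  finally have "- ((1 - t) * s + t * s') / 2 \<le> ln (el_prod m n ?p ?q)"
    by (simp add: field_simps)
  then show ?thesis by (subst (asm) ln_ge_iff[OF pq_pos])
qed

lemma theta_combine:
  "theta m n x y (\<lambda>i. a * p i + b * p' i) (\<lambda>j. a * q j + b * q' j) =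
    a *\<^sub>R theta m n x y p q + b *\<^sub>R theta m n x y p' q'"
  by (simp add: theta_def scaleR_sum_right sum.distrib algebra_simps)

lemma oel_convex:
  assumes "oel m n x y \<theta> \<le> ereal s" "oel m n x y \<theta>' \<le> ereal s'" "0 \<le> t" "t \<le> 1"
  shows "oel m n x y ((1 - t) *\<^sub>R \<theta> + t *\<^sub>R \<theta>') \<le> ereal ((1 - t) * s + t * s')"
proof -
  from assms obtain p q p' q' where *: "(p, q) \<in> level_weights m n s" "theta m n x y p q = \<theta>"
    "(p', q') \<in> level_weights m n s'" "theta m n x y p' q' = \<theta>'"
    unfolding oel_le_iff by blast
  show ?thesis unfolding oel_le_iff
    apply (rule bexI[of _ "(\<lambda>i. (1 - t) * p i + t * p' i, \<lambda>j. (1 - t) * q j + t * q' j)"])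
    using * assms simplex_convex[of p m p' t] simplex_convex[of q n q' t]
      log_concave_el_prod[of p m q n s p' q' s' t]
    by (auto simp: theta_combine level_weights_def)
qed

lemma uniform_simplex: "0 < k \<Longrightarrow> (\<lambda>i. if i < k then 1 / real k else 0) \<in> weight_simplex k"
  by (auto simp: weight_simplex_def prob_vector_def)

lemma oel_theta_hat:
  assumes "0 < m" "0 < n"
  shows "oel m n x y (theta_hat m n x y) \<le> ereal 0"
proof -
  define u where "u = (\<lambda>k i. if i < k then 1 / real k else (0::real))"
  have "(u m, u n) \<in> level_weights m n 0"
    using uniform_simplex[OF assms(1)] uniform_simplex[OF assms(2)] assms
    by (simp add: level_weights_def el_prod_def u_def)
  moreover have "theta m n x y (u m) (u n) = theta_hat m n x y"
    by (simp add: theta_def theta_hat_def u_def scaleR_sum_right)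
  ultimately show ?thesis unfolding oel_le_iff by blast
qed

text \<open>Since the ratio is convex with value zero at \<^const>\<open>theta_hat\<close>, it grows at least linearly along
  rays from there.\<close>

lemma oel_shrink:
  assumes "0 < m" "0 < n" "oel m n x y (theta_hat m n x y + \<delta>) \<le> ereal s" "0 \<le> t" "t \<le> 1"
  shows "oel m n x y (theta_hat m n x y + t *\<^sub>R \<delta>) \<le> ereal (t * s)"
proof -
  let ?h = "theta_hat m n x y"
  have "(1 - t) *\<^sub>R ?h + t *\<^sub>R (?h + \<delta>) = ?h + t *\<^sub>R \<delta>"
    by (simp add: algebra_simps)
  then show ?thesis
    using oel_convex[OF oel_theta_hat[OF assms(1,2), of x y] assms(3-5)] by simp
qed

text \<open>A continuous image of a compact set of weights.\<close>

lemma closed_oel_le: "closed {\<theta>. oel m n x y \<theta> \<le> ereal s}"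
proof -
  have "{\<theta>. oel m n x y \<theta> \<le> ereal s} = (\<lambda>z. theta m n x y (fst z) (snd z)) ` level_weights m n s"
    unfolding oel_le_iff by force
  also have "compact \<dots>"
    by (intro compact_continuous_image compact_level_weights continuous_on_theta
        continuous_on_const continuous_on_fst continuous_on_snd continuous_on_id)
  finally show ?thesis by (rule compact_imp_closed)
qed

lemma oel_real:
  assumes "oel m n x y \<theta> \<le> ereal s"
  obtains t where "0 \<le> t" "oel m n x y \<theta> = ereal t"
proof -
  obtain r where r: "oel m n x y \<theta> = ereal r"
  proof (cases "oel m n x y \<theta>")
    case MInf
    with oel_nonneg[of m n x y \<theta>] show ?thesis by simp
  qed (use assms that in auto)
  with oel_nonneg[of m n x y \<theta>] that show thesis by simp
qed

lemma mem_Theta_iff: "\<theta> \<in> Theta m n x y \<longleftrightarrow> (\<exists>s. oel m n x y \<theta> \<le> ereal s)"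
proof
  assume "\<theta> \<in> Theta m n x y"
  then have "oel m n x y \<theta> \<noteq> \<infinity>" by (auto simp: Theta_def)
  then show "\<exists>s. oel m n x y \<theta> \<le> ereal s"
    by (meson ereal_top nle_le)
next
  assume "\<exists>s. oel m n x y \<theta> \<le> ereal s"
  then obtain s where s: "oel m n x y \<theta> \<le> ereal s" by blast
  then obtain p q where "(p, q) \<in> level_weights m n s" "theta m n x y p q = \<theta>"
    unfolding oel_le_iff by blast
  then have "\<theta> \<in> D_theta m n x y" by (auto simp: D_theta_def level_weights_def weight_simplex_def)
  moreover have "oel m n x y \<theta> < \<infinity>" using s by (rule order_le_less_trans) simp
  ultimately show "\<theta> \<in> Theta m n x y" by (simp add: Theta_def)
qed

lemma mem_ThetaE:
  assumes "\<theta> \<in> Theta m n x y"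
  obtains s where "0 \<le> s" "oel m n x y \<theta> = ereal s"
  using assms unfolding mem_Theta_iff by (meson oel_real)

lemma convex_Theta: "convex (Theta m n x y)"
  unfolding convex_alt
proof safe
  fix a b and u :: real
  assume "a \<in> Theta m n x y" "b \<in> Theta m n x y" and u: "0 \<le> u" "u \<le> 1"
  then obtain s s' where "oel m n x y a \<le> ereal s" "oel m n x y b \<le> ereal s'"
    unfolding mem_Theta_iff by blast
  from oel_convex[OF this u] show "(1 - u) *\<^sub>R a + u *\<^sub>R b \<in> Theta m n x y"
    unfolding mem_Theta_iff by blast
qed

section \<open>Non-degenerate samples\<close>

text \<open>The sample lies in a hyperplane orthogonal to \<open>a\<close>.\<close>

definition degenerate_along :: "nat \<Rightarrow> (nat \<Rightarrow> real ^ 'd) \<Rightarrow> real ^ 'd \<Rightarrow> bool" where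
  "degenerate_along k x a \<longleftrightarrow> (\<forall>i<k. a \<bullet> x i = a \<bullet> x 0)"

lemma Theta_iff_positive_weights:
  "\<theta> \<in> Theta m n x y \<longleftrightarrow> (\<exists>p\<in>weight_simplex m. \<exists>q\<in>weight_simplex n.
      (\<forall>i<m. 0 < p i) \<and> (\<forall>j<n. 0 < q j) \<and> theta m n x y p q = \<theta>)"
proof
  assume "\<theta> \<in> Theta m n x y"
  then obtain s p q where pq: "(p, q) \<in> level_weights m n s" "theta m n x y p q = \<theta>"
    unfolding mem_Theta_iff oel_le_iff by blast
  then have *: "p \<in> weight_simplex m" "q \<in> weight_simplex n" and "exp (- s / 2) \<le> el_prod m n p q"
    by (auto simp: level_weights_def)
  then have "0 < el_prod m n p q" using exp_gt_zero[of "- s / 2"] by linarith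
  then have "(\<forall>i<m. 0 < p i) \<and> (\<forall>j<n. 0 < q j)" using el_prod_pos_iff[OF *] by blast
  then show "\<exists>p\<in>weight_simplex m. \<exists>q\<in>weight_simplex n.
      (\<forall>i<m. 0 < p i) \<and> (\<forall>j<n. 0 < q j) \<and> theta m n x y p q = \<theta>"
    using * pq by blast
next
  assume "\<exists>p\<in>weight_simplex m. \<exists>q\<in>weight_simplex n.
      (\<forall>i<m. 0 < p i) \<and> (\<forall>j<n. 0 < q j) \<and> theta m n x y p q = \<theta>"
  then obtain p q where pq: "p \<in> weight_simplex m" "q \<in> weight_simplex n"
      "\<forall>i<m. 0 < p i" "\<forall>j<n. 0 < q j" "theta m n x y p q = \<theta>" by blast
  have "0 < el_prod m n p q"
    using el_prod_pos_iff pq by blast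
  then have "exp (- (- 2 * ln (el_prod m n p q)) / 2) \<le> el_prod m n p q" by simp
  then have "(p, q) \<in> level_weights m n (- 2 * ln (el_prod m n p q))"
    using pq by (simp add: level_weights_def)
  then show "\<theta> \<in> Theta m n x y"
    unfolding mem_Theta_iff oel_le_iff using pq by blast
qed

lemma inner_theta_degenerate:
  assumes "degenerate_along m x a" "degenerate_along n y a" "p \<in> weight_simplex m" "q \<in> weight_simplex n"
  shows "a \<bullet> theta m n x y p q = a \<bullet> y 0 - a \<bullet> x 0"
proof -
  have 1: "a \<bullet> (\<Sum>i<k. r i *\<^sub>R z i) = a \<bullet> z 0" if "degenerate_along k z a" "r \<in> weight_simplex k" for k r z
  proof -
    have "a \<bullet> (\<Sum>i<k. r i *\<^sub>R z i) = (\<Sum>i<k. r i * (a \<bullet> z 0))"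
      unfolding inner_sum_right
    proof (intro sum.cong refl)
      fix i assume "i \<in> {..<k}"
      then have "a \<bullet> z i = a \<bullet> z 0" using that(1) unfolding degenerate_along_def by blast
      then show "a \<bullet> (r i *\<^sub>R z i) = r i * (a \<bullet> z 0)" unfolding inner_scaleR_right by (rule arg_cong)
    qed
    also have "\<dots> = a \<bullet> z 0"
      using that(2) by (simp add: weight_simplex_def prob_vector_def flip: sum_distrib_right)
    finally show ?thesis .
  qed
  show ?thesis using 1[OF assms(1,3)] 1[OF assms(2,4)] by (simp add: theta_def inner_diff_right)
qed

lemma theta_hat_mem_Theta:
  "0 < m \<Longrightarrow> 0 < n \<Longrightarrow> theta_hat m n x y \<in> Theta m n x y"
  unfolding mem_Theta_iff using oel_theta_hat by blast

text \<open>Moving half of the weight of one observation to another gives a segment of the parameter domain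
  in the direction of the difference of the two observations.\<close>

lemma shifted_uniform_simplex:
  assumes "i < k" "i' < k" "i \<noteq> i'"
  shows "(\<lambda>l. if l < k then (1 + (of_bool (l = i) - of_bool (l = i')) / 2) / real k else 0) \<in> weight_simplex k"
proof -
  have "(\<Sum>l<k. (1 + (of_bool (l = i) - of_bool (l = i')) / 2) / real k) =
      (\<Sum>l<k. 1 / real k) + (\<Sum>l<k. (if l = i then 1 / (2 * real k) else 0)) - (\<Sum>l<k. (if l = i' then 1 / (2 * real k) else 0))"
    unfolding sum.distrib[symmetric] sum_subtractf[symmetric]
    by (intro sum.cong refl) (auto simp: field_simps)
  also have "\<dots> = 1" using assms by simp
  finally show ?thesis by (auto simp: weight_simplex_def prob_vector_def)
qed

text \<open>Shifting weight between two observations keeps the parameter in the domain, and a domain inside a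
  hyperplane forces the difference of the observations to be parallel to it.\<close>

lemma degenerate_of_hyperplane:
  assumes mn: "0 < m" "0 < n" and sub: "Theta m n x y \<subseteq> {z. a \<bullet> z = b}"
  shows "degenerate_along m x a \<and> degenerate_along n y a"
proof -
  define u where "u = (\<lambda>k l. if l < k then 1 / real k else (0::real))"
  define v where "v = (\<lambda>k i i' l. if l < k then (1 + (of_bool (l = i) - of_bool (l = i')) / 2) / real k else (0::real))"
  have u: "u k \<in> weight_simplex k" "\<forall>l<k. 0 < u k l" if "0 < k" for k
    using uniform_simplex[OF that] that by (auto simp: u_def)
  have v: "v k i i' \<in> weight_simplex k" "\<forall>l<k. 0 < v k i i' l" if "i < k" "i' < k" "i \<noteq> i'" for k i i'
    using shifted_uniform_simplex[OF that] that by (auto simp: v_def)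
  have vu: "(\<Sum>l<k. v k i i' l *\<^sub>R z l) - (\<Sum>l<k. u k l *\<^sub>R z l) = (1 / (2 * real k)) *\<^sub>R (z i - z i')"
    if "i < k" "i' < k" for k i i' and z :: "nat \<Rightarrow> real ^ 'd"
  proof -
    have "(\<Sum>l<k. v k i i' l *\<^sub>R z l) - (\<Sum>l<k. u k l *\<^sub>R z l) =
      (\<Sum>l<k. (if l = i then (1 / (2 * real k)) *\<^sub>R z l else 0)) - (\<Sum>l<k. (if l = i' then (1 / (2 * real k)) *\<^sub>R z l else 0))"
      unfolding sum_subtractf[symmetric] scaleR_left_diff_distrib[symmetric]
      by (intro sum.cong refl) (auto simp: u_def v_def add_divide_distrib algebra_simps)
    also have "\<dots> = (1 / (2 * real k)) *\<^sub>R (z i - z i')" using that by (simp add: scaleR_diff_right)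
    finally show ?thesis .
  qed
  have b: "a \<bullet> theta m n x y p q = b" if "p \<in> weight_simplex m" "q \<in> weight_simplex n"
      "\<forall>i<m. 0 < p i" "\<forall>j<n. 0 < q j" for p q
    using sub that Theta_iff_positive_weights by blast
  have "a \<bullet> x i = a \<bullet> x 0" if "i < m" for i
  proof (cases "i = 0")
    case False
    have "a \<bullet> (theta m n x y (v m i 0) (u n) - theta m n x y (u m) (u n)) = 0"
      using b[of "v m i 0" "u n"] b[of "u m" "u n"] u v[of i m 0] mn that False by (simp add: inner_diff_right)
    also have "theta m n x y (v m i 0) (u n) - theta m n x y (u m) (u n) = - (1 / (2 * real m)) *\<^sub>R (x i - x 0)"
      using vu[of i m 0 x] that mn by (simp add: theta_def algebra_simps)
    finally show ?thesis using mn by (simp add: inner_diff_right)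
  qed simp
  moreover have "a \<bullet> y i = a \<bullet> y 0" if "i < n" for i
  proof (cases "i = 0")
    case False
    have "a \<bullet> (theta m n x y (u m) (v n i 0) - theta m n x y (u m) (u n)) = 0"
      using b[of "u m" "v n i 0"] b[of "u m" "u n"] u v[of i n 0] mn that False by (simp add: inner_diff_right)
    also have "theta m n x y (u m) (v n i 0) - theta m n x y (u m) (u n) = (1 / (2 * real n)) *\<^sub>R (y i - y 0)"
      using vu[of i n 0 y] that mn by (simp add: theta_def algebra_simps)
    finally show ?thesis using mn by (simp add: inner_diff_right)
  qed simp
  ultimately show ?thesis unfolding degenerate_along_def by blast
qed

text \<open>Strictly positive weights can be moved a little in any direction, so every segment in the domain can
  be prolonged: the domain is relatively open.\<close>

lemma Theta_extend:
  assumes "\<theta> \<in> Theta m n x y" "z \<in> Theta m n x y"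
  obtains e where "0 < e" "\<theta> + e *\<^sub>R (\<theta> - z) \<in> Theta m n x y"
proof -
  obtain p q where pq: "p \<in> weight_simplex m" "q \<in> weight_simplex n"
    "\<forall>i<m. 0 < p i" "\<forall>j<n. 0 < q j" "theta m n x y p q = \<theta>"
    using assms(1)[unfolded Theta_iff_positive_weights] by blast
  obtain p' q' where pq': "p' \<in> weight_simplex m" "q' \<in> weight_simplex n" "theta m n x y p' q' = z"
    using assms(2)[unfolded Theta_iff_positive_weights] by blast
  \<comment> \<open>half the least weight; the weights to be subtracted are at most one\<close>
  define e where "e = Min (insert 1 (p ` {..<m} \<union> q ` {..<n})) / 2"
  have e: "0 < e" using pq by (auto simp: e_def)
  have eM: "2 * e \<le> r" if "r \<in> insert 1 (p ` {..<m} \<union> q ` {..<n})" for r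
    unfolding e_def using that by simp
  have pos: "0 < (1 + e) * r i + (- e) * r' i"
    if "r' \<in> weight_simplex k" "i < k" "2 * e \<le> r i" for r r' k i
  proof -
    have "e * r' i \<le> e * 1" using simplex_le_1[OF that(1,2)] e by (intro mult_left_mono) auto
    moreover have "0 \<le> e * r i" using e that by simp
    moreover have "(1 + e) * r i + (- e) * r' i = r i + e * r i - e * r' i" by (simp add: algebra_simps)
    ultimately show ?thesis using e that(3) by linarith
  qed
  have sim: "(\<lambda>i. (1 + e) * r i + (- e) * r' i) \<in> weight_simplex k"
    if "r \<in> weight_simplex k" "r' \<in> weight_simplex k" "\<forall>i<k. 2 * e \<le> r i" for r r' k
  proof -
    have "(\<Sum>i<k. (1 + e) * r i + (- e) * r' i) = (1 + e) * (\<Sum>i<k. r i) + (- e) * (\<Sum>i<k. r' i)"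
      unfolding sum.distrib sum_distrib_left ..
    also have "\<dots> = 1" using that by (simp add: weight_simplex_def prob_vector_def)
    finally show ?thesis using pos[OF that(2)] that
      by (auto simp: weight_simplex_def prob_vector_def less_imp_le)
  qed
  have "theta m n x y (\<lambda>i. (1 + e) * p i + (- e) * p' i) (\<lambda>i. (1 + e) * q i + (- e) * q' i) = (1 + e) *\<^sub>R \<theta> + (- e) *\<^sub>R z"
    unfolding theta_combine pq(5) pq'(3) ..
  also have "\<dots> = \<theta> + e *\<^sub>R (\<theta> - z)" by (simp add: algebra_simps)
  finally have "\<theta> + e *\<^sub>R (\<theta> - z) \<in> Theta m n x y"
    unfolding Theta_iff_positive_weights
    using sim[OF pq(1) pq'(1)] sim[OF pq(2) pq'(2)] pos[OF pq'(1)] pos[OF pq'(2)] eM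
    by (intro bexI[of _ "\<lambda>i. (1 + e) * p i + (- e) * p' i"] bexI[of _ "\<lambda>i. (1 + e) * q i + (- e) * q' i"] conjI) auto
  with e that show thesis by blast
qed

text \<open>A convex set without interior lies in a hyperplane; a relatively open one with an interior point
  is open.\<close>

lemma open_Theta_iff:
  fixes x y :: "nat \<Rightarrow> real ^ 'd"
  assumes mn: "0 < m" "0 < n"
  shows "open (Theta m n x y) \<longleftrightarrow> (\<forall>a. a \<noteq> 0 \<longrightarrow> \<not> (degenerate_along m x a \<and> degenerate_along n y a))"
proof
  assume op: "open (Theta m n x y)"
  show "\<forall>a. a \<noteq> 0 \<longrightarrow> \<not> (degenerate_along m x a \<and> degenerate_along n y a)"
  proof (intro allI impI notI)
    fix a :: "real ^ 'd" assume a: "a \<noteq> 0" and deg: "degenerate_along m x a \<and> degenerate_along n y a"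
    let ?h = "theta_hat m n x y"
    have h: "?h \<in> Theta m n x y" using mn by (rule theta_hat_mem_Theta)
    with op obtain e where e: "0 < e" "cball ?h e \<subseteq> Theta m n x y"
      using open_contains_cball by blast
    have "?h + (e / norm a) *\<^sub>R a \<in> Theta m n x y" using e a by (intro subsetD[OF e(2)]) (simp add: dist_norm)
    moreover have "a \<bullet> z = a \<bullet> y 0 - a \<bullet> x 0" if "z \<in> Theta m n x y" for z
      using that deg inner_theta_degenerate[of m x a n y] unfolding Theta_iff_positive_weights by blast
    ultimately have "a \<bullet> (?h + (e / norm a) *\<^sub>R a) = a \<bullet> ?h"
      using h by simp
    with a e show False by (simp add: inner_add_right)
  qed
next
  assume nd: "\<forall>a. a \<noteq> 0 \<longrightarrow> \<not> (degenerate_along m x a \<and> degenerate_along n y a)"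
  have "interior (Theta m n x y) \<noteq> {}"
  proof
    assume "interior (Theta m n x y) = {}"
    from empty_interior_subset_hyperplane[OF convex_Theta this]
    obtain a b where "a \<noteq> 0" "Theta m n x y \<subseteq> {z. a \<bullet> z = b}" by metis
    with degenerate_of_hyperplane[OF mn] nd show False by blast
  qed
  then obtain z where z: "z \<in> interior (Theta m n x y)" by blast
  have "\<theta> \<in> interior (Theta m n x y)" if \<theta>: "\<theta> \<in> Theta m n x y" for \<theta>
  proof -
    obtain e where e: "0 < e" "\<theta> + e *\<^sub>R (\<theta> - z) \<in> Theta m n x y"
      using Theta_extend[OF \<theta>, of z] z interior_subset by blast
    define t where "t = e / (1 + e)"
    have t: "0 < t" "t \<le> 1" using e by (auto simp: t_def)
    let ?w = "\<theta> + e *\<^sub>R (\<theta> - z)"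
    have "?w - t *\<^sub>R (?w - z) \<in> interior (Theta m n x y)"
      by (rule mem_interior_convex_shrink[OF convex_Theta z e(2) t])
    moreover have "?w - z = (1 + e) *\<^sub>R (\<theta> - z)" by (simp add: algebra_simps)
    moreover have "t * (1 + e) = e" using e by (simp add: t_def)
    ultimately have "?w - e *\<^sub>R (\<theta> - z) \<in> interior (Theta m n x y)"
      by (metis scaleR_scaleR)
    then show ?thesis by simp
  qed
  then have "Theta m n x y = interior (Theta m n x y)" using interior_subset by blast
  then show "open (Theta m n x y)" by (metis open_interior)
qed

section \<open>The extended ratio as a fixed point, and its measurability\<close>

text \<open>The point between \<^const>\<open>theta_hat\<close> and \<open>\<theta>\<close> that \<^const>\<open>sim_map\<close> sends to \<open>\<theta>\<close> if the ratio takes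
  the value \<open>s\<close> there.\<close>

definition theta_path ::
  "nat \<Rightarrow> nat \<Rightarrow> (nat \<Rightarrow> real ^ 'd) \<Rightarrow> (nat \<Rightarrow> real ^ 'd) \<Rightarrow> real ^ 'd \<Rightarrow> real \<Rightarrow> real ^ 'd" where
  "theta_path m n x y \<theta> s = theta_hat m n x y +
     (1 / expansion_factor (m + n) s) *\<^sub>R (\<theta> - theta_hat m n x y)"

lemma expansion_factor_pos: "0 \<le> s \<Longrightarrow> 1 \<le> expansion_factor N s"
  by (simp add: expansion_factor_def)

text \<open>A larger \<open>s\<close> moves the point towards the minimiser of the ratio.\<close>

lemma oel_path_mono:
  assumes mn: "0 < m" "0 < n" and "0 \<le> s" "s \<le> s'" and k: "oel m n x y (theta_path m n x y \<theta> s) \<le> ereal k"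
  shows "oel m n x y (theta_path m n x y \<theta> s') \<le> ereal k"
proof -
  let ?c = "expansion_factor (m + n)"
  have c: "1 \<le> ?c s" "?c s \<le> ?c s'"
    using assms by (auto simp: expansion_factor_def divide_right_mono)
  let ?D = "(1 / ?c s) *\<^sub>R (\<theta> - theta_hat m n x y)"
  have 1: "oel m n x y (theta_hat m n x y + (?c s / ?c s') *\<^sub>R ?D) \<le> ereal ((?c s / ?c s') * k)"
    by (rule oel_shrink[OF mn]) (use k c in \<open>auto simp: theta_path_def\<close>)
  have 2: "(?c s / ?c s') *\<^sub>R ?D = (1 / ?c s') *\<^sub>R (\<theta> - theta_hat m n x y)"
    using c by simp
  have 3: "(?c s / ?c s') * k \<le> k"
  proof -
    have "0 \<le> k" using order_trans[OF oel_nonneg k] by simp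
    moreover have "?c s / ?c s' \<le> 1" using c by simp
    ultimately show ?thesis using c by (intro mult_left_le_one_le) auto
  qed
  have "oel m n x y (theta_path m n x y \<theta> s') \<le> ereal ((?c s / ?c s') * k)"
    using 1 unfolding 2 theta_path_def .
  also have "\<dots> \<le> ereal k" using 3 by simp
  finally show ?thesis .
qed

lemma continuous_oel:
  assumes "open (Theta m n x y)"
  shows "continuous_on (Theta m n x y) (\<lambda>\<theta>. real_of_ereal (oel m n x y \<theta>))"
proof (rule convex_on_continuous[OF assms])
  show "convex_on (Theta m n x y) (\<lambda>\<theta>. real_of_ereal (oel m n x y \<theta>))"
  proof (intro convex_onI convex_Theta)
    fix u :: real and a b
    assume u: "0 < u" "u < 1" and ab: "a \<in> Theta m n x y" "b \<in> Theta m n x y"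
    obtain s where s: "oel m n x y a = ereal s" using ab(1) by (elim mem_ThetaE)
    obtain s' where s': "oel m n x y b = ereal s'" using ab(2) by (elim mem_ThetaE)
    have le: "oel m n x y ((1 - u) *\<^sub>R a + u *\<^sub>R b) \<le> ereal ((1 - u) * s + u * s')"
      by (rule oel_convex) (use s s' u in auto)
    obtain t where "oel m n x y ((1 - u) *\<^sub>R a + u *\<^sub>R b) = ereal t"
      using le by (elim oel_real)
    with le s s' show "real_of_ereal (oel m n x y ((1 - u) *\<^sub>R a + u *\<^sub>R b))
        \<le> (1 - u) * real_of_ereal (oel m n x y a) + u * real_of_ereal (oel m n x y b)" by simp
  qed
qed

text \<open>The preimage of \<open>\<theta>\<^sub>0\<close> is the point of the path at the least \<open>s\<close> where the ratio is at most \<open>s\<close>.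
  Lower semicontinuity (closed sublevel sets) gives the inequality at this \<open>s\<close>; if it were strict,
  continuity of a convex function on an open set would allow a smaller \<open>s\<close>.\<close>

lemma sim_map_surj:
  fixes x y :: "nat \<Rightarrow> real ^ 'd"
  assumes mn: "0 < m" "0 < n" and op: "open (Theta m n x y)"
  shows "\<theta>\<^sub>0 \<in> sim_map m n x y ` Theta m n x y"
proof -
  let ?h = "theta_hat m n x y" and ?N = "real (m + n)"
  let ?f = "\<lambda>\<theta>. real_of_ereal (oel m n x y \<theta>)"
  let ?path = "theta_path m n x y \<theta>\<^sub>0"
  have path_tendsto: "(?path \<longlongrightarrow> ?path s) (at s within S)" if "0 \<le> s" for s S
    unfolding theta_path_def expansion_factor_def
    using expansion_factor_pos[OF that, of "m + n"] mn
    by (intro tendsto_intros) (auto simp: expansion_factor_def)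
  define A where "A = {s. 0 \<le> s \<and> oel m n x y (?path s) \<le> ereal s}"
  have bdd: "bdd_below A" by (rule bdd_belowI[of _ 0]) (auto simp: A_def)
  have "A \<noteq> {}"
  proof -
    obtain e where e: "0 < e" "ball ?h e \<subseteq> Theta m n x y"
      using op theta_hat_mem_Theta[OF mn] open_contains_ball by blast
    define r where "r = norm (\<theta>\<^sub>0 - ?h)"
    \<comment> \<open>so large that the path has entered the ball around \<open>theta_hat\<close>\<close>
    define s1 where "s1 = 2 * ?N * r / e"
    have r: "0 \<le> r" by (simp add: r_def)
    then have s1: "0 \<le> s1" using e by (simp add: s1_def)
    have "expansion_factor (m + n) s1 = 1 + r / e" using mn by (simp add: expansion_factor_def s1_def)
    then have "1 / expansion_factor (m + n) s1 * r = r / (1 + r / e)"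
      by simp
    also have "\<dots> = e * r / (e + r)"
      using e r by (simp add: field_simps add_pos_nonneg)
    also have "\<dots> < e" using e r by (simp add: field_simps)
    finally have "?path s1 \<in> ball ?h e"
      using expansion_factor_pos[OF s1, of "m + n"] by (simp add: theta_path_def dist_norm r_def)
    with e have "?path s1 \<in> Theta m n x y" by blast
    then obtain k where "0 \<le> k" "oel m n x y (?path s1) = ereal k" by (elim mem_ThetaE)
    then have "oel m n x y (?path (max s1 k)) \<le> ereal k"
      using oel_path_mono[OF mn s1, of "max s1 k" x y \<theta>\<^sub>0 k] by simp
    also have "\<dots> \<le> ereal (max s1 k)" by simp
    finally have "max s1 k \<in> A" using s1 by (simp add: A_def)
    then show ?thesis by blast
  qed
  define s where "s = Inf A"
  have s0: "0 \<le> s" unfolding s_def using \<open>A \<noteq> {}\<close> by (intro cInf_greatest) (auto simp: A_def)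
  have above: "oel m n x y (?path t) \<le> ereal t" if "s < t" for t
  proof -
    from that obtain a where a: "a \<in> A" "a < t" using \<open>A \<noteq> {}\<close> bdd by (auto simp: s_def cInf_less_iff)
    then have "oel m n x y (?path t) \<le> ereal a"
      using oel_path_mono[OF mn, of a t x y \<theta>\<^sub>0 a] by (simp add: A_def)
    also have "ereal a \<le> ereal t" using a by simp
    finally show ?thesis .
  qed
  have "oel m n x y (?path s) \<le> ereal (s + e)" if "0 < e" for e
  proof -
    have "?path s \<in> {\<theta>. oel m n x y \<theta> \<le> ereal (s + e)}"
    proof (rule Lim_in_closed_set[OF closed_oel_le])
      show "(?path \<longlongrightarrow> ?path s) (at_right s)" using s0 by (rule path_tendsto)
      have "\<forall>\<^sub>F t in at_right s. t \<in> {s<..<s + e}"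
        using that by (intro eventually_at_right_real) simp
      then show "\<forall>\<^sub>F t in at_right s. ?path t \<in> {\<theta>. oel m n x y \<theta> \<le> ereal (s + e)}"
      proof eventually_elim
        case (elim t)
        then have "oel m n x y (?path t) \<le> ereal t" by (intro above) auto
        also have "ereal t \<le> ereal (s + e)" using elim by simp
        finally show ?case by simp
      qed
    qed simp
    then show ?thesis by simp
  qed
  note upper = this
  have mem: "?path s \<in> Theta m n x y" unfolding mem_Theta_iff using upper[of 1] by auto
  then obtain v where v: "0 \<le> v" "oel m n x y (?path s) = ereal v" by (elim mem_ThetaE)
  have "v \<le> s"
  proof (rule field_le_epsilon)
    fix e :: real assume "0 < e"
    from upper[OF this] show "v \<le> s + e" unfolding v(2) by simp
  qed
  have "v = s"
  proof (rule ccontr)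
    assume "v \<noteq> s"
    with \<open>v \<le> s\<close> v have "v < s" "0 < s" by auto
    have pl: "(?path \<longlongrightarrow> ?path s) (at_left s)" using s0 by (rule path_tendsto)
    have "isCont ?f (?path s)"
      using continuous_oel[OF op] op mem by (simp add: continuous_on_eq_continuous_at)
    then have "((\<lambda>t. ?f (?path t)) \<longlongrightarrow> ?f (?path s)) (at_left s)"
      using pl by (rule isCont_tendsto_compose)
    then have "((\<lambda>t. ?f (?path t) - t) \<longlongrightarrow> v - s) (at_left s)"
      using v by (intro tendsto_diff tendsto_ident_at) simp
    then have "\<forall>\<^sub>F t in at_left s. ?f (?path t) - t < 0"
      using \<open>v < s\<close> by (intro order_tendstoD) auto
    moreover have "\<forall>\<^sub>F t in at_left s. ?path t \<in> Theta m n x y"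
      using pl op mem by (rule topological_tendstoD)
    moreover have "\<forall>\<^sub>F t in at_left s. t \<in> {0<..<s}"
      using \<open>0 < s\<close> by (rule eventually_at_left_real)
    ultimately have "\<forall>\<^sub>F t in at_left s. t \<in> A \<and> t < s"
    proof eventually_elim
      case (elim t)
      from elim(2) obtain k where "oel m n x y (?path t) = ereal k" by (elim mem_ThetaE)
      with elim show ?case by (simp add: A_def)
    qed
    then obtain t where "t \<in> A" "t < s" using eventually_happens'[of "at_left s"] by auto
    then show False using cInf_lower[OF _ bdd, of t] by (simp add: s_def)
  qed
  have "sim_map m n x y (?path s) = \<theta>\<^sub>0"
    using v \<open>v = s\<close> expansion_factor_pos[OF s0, of "m + n"] by (simp add: sim_map_def theta_path_def)
  with mem show ?thesis by (metis imageI)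
qed

text \<open>By the definition of \<^const>\<open>sim_map\<close>, every preimage of \<open>\<theta>\<^sub>0\<close> is the point of the path whose
  parameter is the value of the ratio there.\<close>

lemma eel_fixed_point:
  fixes x y :: "nat \<Rightarrow> real ^ 'd"
  assumes mn: "0 < m" "0 < n" and op: "open (Theta m n x y)"
  shows "0 \<le> eel m n x y r \<theta>\<^sub>0"
    and "oel m n x y (theta_path m n x y \<theta>\<^sub>0 (eel m n x y r \<theta>\<^sub>0)) = ereal (eel m n x y r \<theta>\<^sub>0)"
proof -
  let ?\<theta> = "sim_map_inv m n x y \<theta>\<^sub>0" and ?h = "theta_hat m n x y"
  have surj: "\<theta>\<^sub>0 \<in> sim_map m n x y ` Theta m n x y" by (rule sim_map_surj[OF assms])
  have mem: "?\<theta> \<in> Theta m n x y" unfolding sim_map_inv_def using surj by (rule inv_into_into)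
  have eq: "sim_map m n x y ?\<theta> = \<theta>\<^sub>0" unfolding sim_map_inv_def using surj by (rule f_inv_into_f)
  obtain s where s: "0 \<le> s" "oel m n x y ?\<theta> = ereal s" using mem by (elim mem_ThetaE)
  have e: "eel m n x y r \<theta>\<^sub>0 = s" using op s by (simp add: eel_def)
  let ?c = "expansion_factor (m + n) s"
  have c: "1 \<le> ?c" using s(1) by (rule expansion_factor_pos)
  have "sim_map m n x y ?\<theta> - ?h = ?c *\<^sub>R (?\<theta> - ?h)" using s by (simp add: sim_map_def)
  then have "\<theta>\<^sub>0 - ?h = ?c *\<^sub>R (?\<theta> - ?h)" unfolding eq .
  then have "theta_path m n x y \<theta>\<^sub>0 s = ?\<theta>" using c by (simp add: theta_path_def)
  then show "0 \<le> eel m n x y r \<theta>\<^sub>0"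
    "oel m n x y (theta_path m n x y \<theta>\<^sub>0 (eel m n x y r \<theta>\<^sub>0)) = ereal (eel m n x y r \<theta>\<^sub>0)"
    using e s by simp_all
qed

text \<open>Distribution function of the statistic in terms of the original ratio: the ratio along the path does
  not increase with \<open>s\<close>, so it is at most \<open>s\<close> exactly from the fixed point on.\<close>

lemma eel_le_iff:
  fixes x y :: "nat \<Rightarrow> real ^ 'd"
  assumes mn: "0 < m" "0 < n" and op: "open (Theta m n x y)" and s: "0 \<le> s"
  shows "eel m n x y r \<theta>\<^sub>0 \<le> s \<longleftrightarrow> oel m n x y (theta_path m n x y \<theta>\<^sub>0 s) \<le> ereal s"
proof -
  let ?e = "eel m n x y r \<theta>\<^sub>0"
  note e = eel_fixed_point[OF mn op, where r = r and \<theta>\<^sub>0 = \<theta>\<^sub>0]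
  show ?thesis
  proof
    assume "?e \<le> s"
    have "oel m n x y (theta_path m n x y \<theta>\<^sub>0 s) \<le> ereal ?e"
      by (rule oel_path_mono[OF mn e(1) \<open>?e \<le> s\<close>]) (simp add: e(2))
    also have "\<dots> \<le> ereal s" using \<open>?e \<le> s\<close> by simp
    finally show "oel m n x y (theta_path m n x y \<theta>\<^sub>0 s) \<le> ereal s" .
  next
    assume *: "oel m n x y (theta_path m n x y \<theta>\<^sub>0 s) \<le> ereal s"
    show "?e \<le> s"
    proof (rule ccontr)
      assume "\<not> ?e \<le> s"
      then have "oel m n x y (theta_path m n x y \<theta>\<^sub>0 ?e) \<le> ereal s"
        using oel_path_mono[OF mn s _ *, of ?e] by simp
      then show False using e(2) \<open>\<not> ?e \<le> s\<close> by simp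
    qed
  qed
qed

lemma closed_projection_compact:
  assumes K: "compact K" and C: "closed C"
  shows "closed {z. \<exists>k\<in>K. (z, k) \<in> C}"
proof -
  have "open {z. \<forall>k\<in>K. (z, k) \<in> - C}"
  proof (rule Topological_Spaces.openI)
    fix z assume "z \<in> {z. \<forall>k\<in>K. (z, k) \<in> - C}"
    then have "{z} \<times> K \<subseteq> - C" by auto
    from Elementary_Topology.tube_lemma[OF K open_Compl[OF C] this]
    obtain U where "z \<in> U" "open U" "U \<times> K \<subseteq> - C" by blast
    then show "\<exists>T. open T \<and> z \<in> T \<and> T \<subseteq> {z. \<forall>k\<in>K. (z, k) \<in> - C}"
      by (intro exI[of _ U]) auto
  qed
  moreover have "{z. \<forall>k\<in>K. (z, k) \<in> - C} = - {z. \<exists>k\<in>K. (z, k) \<in> C}" by auto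
  ultimately show ?thesis by (simp add: closed_def)
qed

lemma closed_oel_le_joint:
  assumes "continuous_on UNIV a" "continuous_on UNIV b" "continuous_on UNIV g"
  shows "closed {z. oel m n (a z) (b z) (g z) \<le> ereal s}"
proof -
  have c: "continuous_on UNIV (\<lambda>w. f (fst w))" if "continuous_on UNIV f" for f
    by (rule continuous_on_compose2[OF that continuous_on_fst[OF continuous_on_id]]) auto
  have "closed {w. theta m n (a (fst w)) (b (fst w)) (fst (snd w)) (snd (snd w)) = g (fst w)}"
    by (intro closed_Collect_eq continuous_on_theta assms[THEN c] continuous_on_fst continuous_on_snd continuous_on_id)
  from closed_projection_compact[OF compact_level_weights this, of m n s]
  show ?thesis unfolding oel_le_iff by (simp add: case_prod_beta)
qed

text \<open>By scaling, the direction can be taken from the compact unit sphere.\<close>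

lemma closed_degenerate:
  "closed {z. \<exists>a. a \<noteq> 0 \<and> degenerate_along m (fst z) a \<and> degenerate_along n (snd z) (a :: real ^ 'd)}"
proof -
  have "closed {w. \<forall>i<k. snd w \<bullet> f (fst w) i = snd w \<bullet> f (fst w) 0}"
    if "continuous_on UNIV f" for k and f :: "'z::topological_space \<Rightarrow> nat \<Rightarrow> real ^ 'd"
  proof -
    have "continuous_on UNIV (\<lambda>w::'z \<times> (real ^ 'd). f (fst w) i)" for i
      by (rule continuous_on_compose2[OF continuous_on_coord[OF that] continuous_on_fst[OF continuous_on_id]]) auto
    then show ?thesis
      by (intro closed_Collect_all closed_Collect_imp closed_Collect_eq continuous_on_inner continuous_on_snd continuous_on_id) auto
  qed
  note cl = this
  have c: "continuous_on UNIV (fst :: _ \<Rightarrow> nat \<Rightarrow> real ^ 'd)" "continuous_on UNIV (snd :: _ \<Rightarrow> nat \<Rightarrow> real ^ 'd)"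
    by (intro continuous_on_fst continuous_on_snd continuous_on_id)+
  have "closed ({w. degenerate_along m (fst (fst w)) (snd w)} \<inter> {w. degenerate_along n (snd (fst w)) (snd w :: real ^ 'd)})"
    unfolding degenerate_along_def by (intro closed_Int cl c)
  from closed_projection_compact[OF compact_sphere[of 0 1] this]
  have "closed {z. \<exists>a\<in>sphere 0 1. degenerate_along m (fst z) a \<and> degenerate_along n (snd z) (a :: real ^ 'd)}"
    by simp
  also have "{z. \<exists>a\<in>sphere 0 1. degenerate_along m (fst z) a \<and> degenerate_along n (snd z) (a :: real ^ 'd)} =
    {z. \<exists>a. a \<noteq> 0 \<and> degenerate_along m (fst z) a \<and> degenerate_along n (snd z) (a :: real ^ 'd)}"
  proof (intro Collect_cong iffI; elim exE bexE conjE)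
    fix z and a :: "real ^ 'd" assume a: "a \<noteq> 0" "degenerate_along m (fst z) a" "degenerate_along n (snd z) a"
    have "degenerate_along k f (inverse (norm a) *\<^sub>R a)" if "degenerate_along k f a" for k f
      using that unfolding degenerate_along_def inner_scaleR_left by (metis (no_types))
    with a show "\<exists>a\<in>sphere 0 1. degenerate_along m (fst z) a \<and> degenerate_along n (snd z) a"
      by (intro bexI[of _ "inverse (norm a) *\<^sub>R a"]) auto
  next
    fix z and a :: "real ^ 'd" assume "a \<in> sphere 0 1" "degenerate_along m (fst z) a" "degenerate_along n (snd z) a"
    then show "\<exists>a. a \<noteq> 0 \<and> degenerate_along m (fst z) a \<and> degenerate_along n (snd z) a"
      by (intro exI[of _ a]) auto
  qed
  finally show ?thesis .
qed

lemma continuous_on_theta_path: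
  assumes "continuous_on S a" "continuous_on S b"
  shows "continuous_on S (\<lambda>z. theta_path m n (a z) (b z) \<theta> s)"
  unfolding theta_path_def theta_hat_def
  by (intro continuous_on_add continuous_on_diff continuous_on_scaleR continuous_on_sum continuous_on_const
      assms[THEN continuous_on_coord])

text \<open>Only the first \<open>m\<close> and \<open>n\<close> observations matter, so the samples may be cut off where nothing is known
  about their measurability.\<close>

lemma eel_cong:
  assumes "\<And>i. i < m \<Longrightarrow> x i = x' i" "\<And>j. j < n \<Longrightarrow> y j = y' j"
  shows "eel m n x y = eel m n x' y'"
proof -
  have th: "theta m n x y = theta m n x' y'" using assms by (simp add: theta_def fun_eq_iff)
  then have oel: "oel m n x y = oel m n x' y'" by (simp add: oel_def fun_eq_iff)
  have "theta_hat m n x y = theta_hat m n x' y'" using assms by (simp add: theta_hat_def)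
  with oel have sim: "sim_map m n x y = sim_map m n x' y'" by (simp add: sim_map_def fun_eq_iff)
  have Th: "Theta m n x y = Theta m n x' y'" using th oel by (simp add: Theta_def D_theta_def)
  have "sim_map_inv m n x y = sim_map_inv m n x' y'" by (simp add: sim_map_inv_def Th sim)
  then show ?thesis by (simp add: eel_def Th oel fun_eq_iff)
qed

text \<open>Both the degenerate samples and the sublevel sets along the path are closed sets of samples, in the
  product topology on sequences of observations.\<close>

lemma measurable_eel:
  fixes X Y :: "nat \<Rightarrow> 'a \<Rightarrow> real ^ 'd"
  assumes mn: "0 < m" "0 < n"
    and X: "\<And>i. i < m \<Longrightarrow> X i \<in> borel_measurable M" and Y: "\<And>j. j < n \<Longrightarrow> Y j \<in> borel_measurable M"
    and R: "R \<in> borel_measurable M"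
  shows "(\<lambda>w. eel m n (\<lambda>i. X i w) (\<lambda>j. Y j w) (R w) \<theta>\<^sub>0) \<in> borel_measurable M"
proof -
  define Z where "Z w = (\<lambda>i. if i < m then X i w else 0, \<lambda>j. if j < n then Y j w else 0)" for w
  let ?e = "\<lambda>w. eel m n (fst (Z w)) (snd (Z w)) (R w) \<theta>\<^sub>0"
  have [measurable]: "Z \<in> borel_measurable M"
  proof -
    have "(\<lambda>w i. if i < m then X i w else 0) \<in> borel_measurable M"
    proof (rule measurable_coordinatewise_then_product)
      fix i show "(\<lambda>w. if i < m then X i w else 0) \<in> borel_measurable M"
        using X by (cases "i < m") simp_all
    qed
    moreover have "(\<lambda>w j. if j < n then Y j w else 0) \<in> borel_measurable M"
    proof (rule measurable_coordinatewise_then_product)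
      fix i show "(\<lambda>w. if i < n then Y i w else 0) \<in> borel_measurable M"
        using Y by (cases "i < n") simp_all
    qed
    ultimately show ?thesis unfolding Z_def by (rule borel_measurable_Pair)
  qed
  have cl: "Measurable.pred M (\<lambda>w. Z w \<in> C)" if "closed C" for C
  proof -
    have "Z -` C \<inter> space M \<in> sets M" using \<open>Z \<in> borel_measurable M\<close> borel_closed[OF that] by (rule measurable_sets)
    then show ?thesis by (simp add: pred_def vimage_def Int_def conj_commute)
  qed
  have c: "continuous_on UNIV (fst :: _ \<Rightarrow> nat \<Rightarrow> real ^ 'd)" "continuous_on UNIV (snd :: _ \<Rightarrow> nat \<Rightarrow> real ^ 'd)"
    by (intro continuous_on_fst continuous_on_snd continuous_on_id)+
  have [measurable]: "Measurable.pred M (\<lambda>w. open (Theta m n (fst (Z w)) (snd (Z w))))"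
  proof -
    have "Measurable.pred M (\<lambda>w. \<not> (\<exists>a. a \<noteq> 0 \<and> degenerate_along m (fst (Z w)) a \<and> degenerate_along n (snd (Z w)) a))"
      using cl[OF closed_degenerate[of m n]] by (intro pred_intros_logic) simp
    moreover have "(\<lambda>w. open (Theta m n (fst (Z w)) (snd (Z w)))) =
      (\<lambda>w. \<not> (\<exists>a. a \<noteq> 0 \<and> degenerate_along m (fst (Z w)) a \<and> degenerate_along n (snd (Z w)) a))"
      unfolding open_Theta_iff[OF mn] by (intro ext) blast
    ultimately show ?thesis by (simp only:)
  qed
  have [measurable]: "Measurable.pred M (\<lambda>w. oel m n (fst (Z w)) (snd (Z w)) (theta_path m n (fst (Z w)) (snd (Z w)) \<theta>\<^sub>0 s) \<le> ereal s)" for s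
    using cl[OF closed_oel_le_joint[OF c continuous_on_theta_path[OF c, where m = m and n = n and \<theta> = \<theta>\<^sub>0 and s = s],
          where m = m and n = n and s = s]] by simp
  note [measurable] = R
  have "?e \<in> borel_measurable M"
  proof (rule borel_measurableI_le)
    fix s
    have *: "?e w \<le> s \<longleftrightarrow> (if open (Theta m n (fst (Z w)) (snd (Z w))) then
        0 \<le> s \<and> oel m n (fst (Z w)) (snd (Z w)) (theta_path m n (fst (Z w)) (snd (Z w)) \<theta>\<^sub>0 s) \<le> ereal s else R w \<le> s)" for w
    proof (cases "open (Theta m n (fst (Z w)) (snd (Z w)))")
      case True
      show ?thesis
        using eel_fixed_point(1)[OF mn True, of "R w" \<theta>\<^sub>0] eel_le_iff[OF mn True, of s "R w" \<theta>\<^sub>0] True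
        by (cases "0 \<le> s") auto
    qed (simp add: eel_def)
    show "{w \<in> space M. ?e w \<le> s} \<in> sets M"
      unfolding * by measurable
  qed
  also have "?e = (\<lambda>w. eel m n (\<lambda>i. X i w) (\<lambda>j. Y j w) (R w) \<theta>\<^sub>0)"
  proof
    fix w
    have "eel m n (fst (Z w)) (snd (Z w)) = eel m n (\<lambda>i. X i w) (\<lambda>j. Y j w)"
      by (rule eel_cong) (simp_all add: Z_def)
    then show "?e w = eel m n (\<lambda>i. X i w) (\<lambda>j. Y j w) (R w) \<theta>\<^sub>0" by simp
  qed
  finally show ?thesis .
qed

section \<open>Quadratic bounds for the likelihood ratio\<close>

definition centred :: "nat \<Rightarrow> (nat \<Rightarrow> real ^ 'd) \<Rightarrow> nat \<Rightarrow> real ^ 'd" where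
  "centred k x i = x i - (1 / real k) *\<^sub>R (\<Sum>i<k. x i)"

text \<open>The linear map \<open>\<nu> \<mapsto> S \<nu> / k\<close> for the sample covariance matrix \<open>S\<close>, which is the estimated covariance
  of the sample mean.\<close>

definition scaled_scatter :: "nat \<Rightarrow> (nat \<Rightarrow> real ^ 'd) \<Rightarrow> real ^ 'd \<Rightarrow> real ^ 'd" where
  "scaled_scatter k x \<nu> = (1 / (real k)\<^sup>2) *\<^sub>R (\<Sum>i<k. (\<nu> \<bullet> centred k x i) *\<^sub>R centred k x i)"

lemma sum_centred: "0 < k \<Longrightarrow> (\<Sum>i<k. centred k x i) = 0"
  by (simp add: centred_def sum_subtractf sum_constant_scaleR del: sum_constant)

lemma inner_scaled_scatter:
  "\<nu> \<bullet> scaled_scatter k x \<nu> = (\<Sum>i<k. (\<nu> \<bullet> centred k x i / real k)\<^sup>2)"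
  by (simp add: scaled_scatter_def inner_sum_right sum_divide_distrib power2_eq_square)

text \<open>The error \<open>ln (1 + u) - u + u\<^sup>2 / 2\<close> has derivative \<open>u\<^sup>2 / (1 + u)\<close>, so it is of third order.\<close>

lemma ln_one_plus_lower:
  fixes u \<eta> :: real
  assumes "\<bar>u\<bar> \<le> \<eta>" "\<eta> \<le> 1 / 2"
  shows "u - (1 / 2 + 2 * \<eta>) * u\<^sup>2 \<le> ln (1 + u)"
proof -
  let ?f = "\<lambda>v::real. ln (1 + v) - v + v\<^sup>2 / 2"
  have "norm (?f u - ?f 0) \<le> (2 * u\<^sup>2) * norm (u - 0)"
  proof (rule field_differentiable_bound[where S = "cball 0 \<bar>u\<bar>" and f' = "\<lambda>v. v\<^sup>2 / (1 + v)"])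
    fix v :: real assume v: "v \<in> cball 0 \<bar>u\<bar>"
    then have v': "\<bar>v\<bar> \<le> \<bar>u\<bar>" "1 / 2 \<le> 1 + v" using assms by auto
    show "(?f has_field_derivative v\<^sup>2 / (1 + v)) (at v within cball 0 \<bar>u\<bar>)"
      using v' by (auto intro!: derivative_eq_intros simp: field_simps power2_eq_square)
    have "v\<^sup>2 / (1 + v) \<le> u\<^sup>2 / (1 / 2)"
      using v' by (intro frac_le) (auto simp: abs_le_square_iff)
    then show "norm (v\<^sup>2 / (1 + v)) \<le> 2 * u\<^sup>2" using v' by simp
  qed auto
  then have "\<bar>?f u\<bar> \<le> 2 * u\<^sup>2 * \<bar>u\<bar>" by simp
  also have "\<dots> \<le> 2 * u\<^sup>2 * \<eta>" using assms by (intro mult_left_mono) auto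
  finally have "- (2 * u\<^sup>2 * \<eta>) \<le> ?f u" by linarith
  then show ?thesis by (simp add: algebra_simps)
qed

lemma prod_one_plus_lower:
  fixes w :: "nat \<Rightarrow> real"
  assumes w: "\<And>i. i < k \<Longrightarrow> \<bar>w i\<bar> \<le> \<eta>" and \<eta>: "\<eta> \<le> 1 / 2" and sum0: "(\<Sum>i<k. w i) = 0"
  shows "exp (- ((1 / 2 + 2 * \<eta>) * (\<Sum>i<k. (w i)\<^sup>2))) \<le> (\<Prod>i<k. 1 + w i)"
proof -
  have "- ((1 / 2 + 2 * \<eta>) * (\<Sum>i<k. (w i)\<^sup>2)) = (\<Sum>i<k. w i - (1 / 2 + 2 * \<eta>) * (w i)\<^sup>2)"
    by (simp add: sum_subtractf sum0 flip: sum_distrib_left)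
  then have "exp (- ((1 / 2 + 2 * \<eta>) * (\<Sum>i<k. (w i)\<^sup>2))) = (\<Prod>i<k. exp (w i - (1 / 2 + 2 * \<eta>) * (w i)\<^sup>2))"
    by (simp add: exp_sum)
  also have "\<dots> \<le> (\<Prod>i<k. 1 + w i)"
  proof (intro prod_mono conjI)
    fix i assume "i \<in> {..<k}"
    then have i: "\<bar>w i\<bar> \<le> \<eta>" using w by simp
    then have "0 < 1 + w i" using \<eta> by linarith
    with ln_one_plus_lower[OF i \<eta>] show "exp (w i - (1 / 2 + 2 * \<eta>) * (w i)\<^sup>2) \<le> 1 + w i"
      by (simp add: ln_ge_iff)
  qed simp
  finally show ?thesis .
qed

text \<open>Weights tilted linearly along \<open>\<nu>\<close> move the weighted mean by exactly the scatter map at \<open>\<nu>\<close>, since the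
  centred observations sum to zero.\<close>

lemma tilted_weights:
  assumes k: "0 < k" and w: "\<And>i. i < k \<Longrightarrow> \<bar>\<nu> \<bullet> centred k x i / real k\<bar> \<le> \<eta>" and \<eta>: "\<eta> \<le> 1 / 2"
    and p_def: "p = (\<lambda>i. if i < k then (1 + \<nu> \<bullet> centred k x i / real k) / real k else 0)"
  shows "p \<in> weight_simplex k"
    and "(\<Sum>i<k. p i *\<^sub>R x i) = (1 / real k) *\<^sub>R (\<Sum>i<k. x i) + scaled_scatter k x \<nu>"
    and "exp (- ((1 / 2 + 2 * \<eta>) * (\<nu> \<bullet> scaled_scatter k x \<nu>))) \<le> (\<Prod>i<k. real k * p i)"
proof -
  let ?w = "\<lambda>i. \<nu> \<bullet> centred k x i / real k"
  let ?m = "(1 / real k) *\<^sub>R (\<Sum>i<k. x i)"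
  have sum0: "(\<Sum>i<k. ?w i) = 0"
    using sum_centred[OF k, of x] by (simp flip: sum_divide_distrib inner_sum_right)
  have "(\<Sum>i<k. p i) = (\<Sum>i<k. 1 / real k + ?w i / real k)"
    unfolding p_def by (intro sum.cong) (auto simp: add_divide_distrib)
  also have "\<dots> = 1" using k sum0 by (simp add: sum.distrib flip: sum_divide_distrib)
  finally have p1: "(\<Sum>i<k. p i) = 1" .
  moreover have "0 \<le> p i" if "i < k" for i
  proof -
    have "0 \<le> 1 + ?w i" using w[OF that] \<eta> by linarith
    then show ?thesis using that by (simp add: p_def)
  qed
  ultimately show "p \<in> weight_simplex k" by (simp add: weight_simplex_def prob_vector_def p_def)
  have "(\<Sum>i<k. p i *\<^sub>R x i) = (\<Sum>i<k. p i *\<^sub>R ?m + p i *\<^sub>R centred k x i)"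
    by (intro sum.cong refl) (simp add: centred_def algebra_simps)
  also have "\<dots> = ?m + (\<Sum>i<k. p i *\<^sub>R centred k x i)"
    unfolding sum.distrib scaleR_sum_left[symmetric] p1 by simp
  also have "(\<Sum>i<k. p i *\<^sub>R centred k x i) = (\<Sum>i<k. (1 / real k) *\<^sub>R centred k x i + (?w i / real k) *\<^sub>R centred k x i)"
    unfolding p_def by (intro sum.cong) (auto simp: add_divide_distrib algebra_simps)
  also have "\<dots> = scaled_scatter k x \<nu>"
    using sum_centred[OF k, of x]
    by (simp add: sum.distrib scaled_scatter_def power2_eq_square scaleR_sum_right flip: scaleR_sum_right[of "1 / real k"])
  finally show "(\<Sum>i<k. p i *\<^sub>R x i) = ?m + scaled_scatter k x \<nu>" .
  have "(\<Prod>i<k. real k * p i) = (\<Prod>i<k. 1 + ?w i)"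
    using k by (intro prod.cong) (auto simp: p_def)
  with prod_one_plus_lower[of k ?w, OF w \<eta> sum0]
  show "exp (- ((1 / 2 + 2 * \<eta>) * (\<nu> \<bullet> scaled_scatter k x \<nu>))) \<le> (\<Prod>i<k. real k * p i)"
    by (simp add: inner_scaled_scatter)
qed

lemma scaled_scatter_minus: "scaled_scatter k x (- \<nu>) = - scaled_scatter k x \<nu>"
  by (simp add: scaled_scatter_def sum_negf)

text \<open>The two samples are tilted in opposite directions, because \<^const>\<open>theta\<close> is a difference of means; the
  tilted weights then realise the shift \<open>\<delta>\<close> and their likelihood is a bound.\<close>

lemma oel_upper:
  assumes mn: "0 < m" "0 < n" and \<eta>: "\<eta> \<le> 1 / 2"
    and x: "\<And>i. i < m \<Longrightarrow> \<bar>\<nu> \<bullet> centred m x i / real m\<bar> \<le> \<eta>"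
    and y: "\<And>j. j < n \<Longrightarrow> \<bar>\<nu> \<bullet> centred n y j / real n\<bar> \<le> \<eta>"
  defines "\<delta> \<equiv> scaled_scatter m x \<nu> + scaled_scatter n y \<nu>"
  shows "oel m n x y (theta_hat m n x y + \<delta>) \<le> ereal ((1 + 4 * \<eta>) * (\<nu> \<bullet> \<delta>))"
proof -
  have x': "\<bar>- \<nu> \<bullet> centred m x i / real m\<bar> \<le> \<eta>" if "i < m" for i using x[OF that] by simp
  define p where "p = (\<lambda>i. if i < m then (1 + - \<nu> \<bullet> centred m x i / real m) / real m else 0)"
  define q where "q = (\<lambda>i. if i < n then (1 + \<nu> \<bullet> centred n y i / real n) / real n else 0)"
  note P = tilted_weights[OF mn(1) x' \<eta> p_def] and Q = tilted_weights[OF mn(2) y \<eta> q_def]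
  have "exp (- ((1 + 4 * \<eta>) * (\<nu> \<bullet> \<delta>)) / 2) =
    exp (- ((1 / 2 + 2 * \<eta>) * (- \<nu> \<bullet> scaled_scatter m x (- \<nu>)))) * exp (- ((1 / 2 + 2 * \<eta>) * (\<nu> \<bullet> scaled_scatter n y \<nu>)))"
    unfolding exp_add[symmetric] \<delta>_def scaled_scatter_minus by (simp add: inner_add_right field_simps)
  also have "\<dots> \<le> el_prod m n p q" unfolding el_prod_def
    by (rule mult_mono[OF P(3) Q(3) order_trans[OF exp_ge_zero P(3)] exp_ge_zero])
  finally have "(p, q) \<in> level_weights m n ((1 + 4 * \<eta>) * (\<nu> \<bullet> \<delta>))"
    using P(1) Q(1) by (simp add: level_weights_def)
  moreover have "theta m n x y p q = theta_hat m n x y + \<delta>"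
    using P(2) Q(2) by (simp add: theta_def scaled_scatter_minus theta_hat_def \<delta>_def del: scaleR_sum_right)
  ultimately show ?thesis unfolding oel_le_iff by blast
qed

text \<open>Weak duality for one sample. For every positive \<open>c\<close> we have \<open>k p c \<le> exp (k p c - 1)\<close>; with
  \<open>c = 1 + \<nu> \<bullet> a / k\<close> the exponents sum to \<open>\<nu> \<bullet> z\<close> for all weights \<open>p\<close> with the prescribed mean, and
  the product of the \<open>c\<close> is known up to third order.\<close>

lemma prod_weights_le:
  assumes k: "0 < k" and p: "p \<in> weight_simplex k" and sum: "(\<Sum>i<k. p i *\<^sub>R x i) = (1 / real k) *\<^sub>R (\<Sum>i<k. x i) + z"
    and w: "\<And>i. i < k \<Longrightarrow> \<bar>\<nu> \<bullet> centred k x i / real k\<bar> \<le> \<eta>" and \<eta>: "\<eta> \<le> 1 / 2"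
  shows "(\<Prod>i<k. real k * p i) \<le> exp (\<nu> \<bullet> z + (1 / 2 + 2 * \<eta>) * (\<nu> \<bullet> scaled_scatter k x \<nu>))"
proof -
  let ?w = "\<lambda>i. \<nu> \<bullet> centred k x i / real k"
  have p1: "(\<Sum>i<k. p i) = 1" and p0: "\<And>i. i < k \<Longrightarrow> 0 \<le> p i"
    using p by (auto simp: weight_simplex_def prob_vector_def)
  have w0: "0 \<le> 1 + ?w i" if "i < k" for i using w[OF that] \<eta> by linarith
  have sum0: "(\<Sum>i<k. ?w i) = 0"
    using sum_centred[OF k, of x] by (simp flip: sum_divide_distrib inner_sum_right)
  have "(\<Prod>i<k. real k * p i) * (\<Prod>i<k. 1 + ?w i) = (\<Prod>i<k. real k * p i * (1 + ?w i))"
    by (simp add: prod.distrib)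
  also have "\<dots> \<le> (\<Prod>i<k. exp (real k * p i * (1 + ?w i) - 1))"
  proof (intro prod_mono conjI)
    fix i assume "i \<in> {..<k}"
    then show "0 \<le> real k * p i * (1 + ?w i)" using p0 w0 by simp
    show "real k * p i * (1 + ?w i) \<le> exp (real k * p i * (1 + ?w i) - 1)"
      using exp_ge_add_one_self[of "real k * p i * (1 + ?w i) - 1"] by simp
  qed
  also have "\<dots> = exp (\<Sum>i<k. real k * p i * (1 + ?w i) - 1)" by (simp add: exp_sum)
  also have "(\<Sum>i<k. real k * p i * (1 + ?w i) - 1) = \<nu> \<bullet> z"
  proof -
    have "(\<Sum>i<k. real k * p i * (1 + ?w i) - 1) = (\<Sum>i<k. real k * p i + p i * (\<nu> \<bullet> centred k x i) - 1)"
      using k by (intro sum.cong refl) (simp add: field_simps)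
    also have "\<dots> = (\<Sum>i<k. p i * (\<nu> \<bullet> centred k x i))"
      using p1 by (simp add: sum.distrib sum_subtractf flip: sum_distrib_left)
    also have "\<dots> = \<nu> \<bullet> ((\<Sum>i<k. p i *\<^sub>R x i) - (\<Sum>i<k. p i) *\<^sub>R ((1 / real k) *\<^sub>R (\<Sum>i<k. x i)))"
      unfolding scaleR_sum_left sum_subtractf[symmetric] inner_sum_right
      by (intro sum.cong refl) (simp add: centred_def inner_diff_right algebra_simps)
    also have "\<dots> = \<nu> \<bullet> z" unfolding sum p1 by simp
    finally show ?thesis .
  qed
  finally have A: "(\<Prod>i<k. real k * p i) * (\<Prod>i<k. 1 + ?w i) \<le> exp (\<nu> \<bullet> z)" .
  let ?E = "(1 / 2 + 2 * \<eta>) * (\<nu> \<bullet> scaled_scatter k x \<nu>)"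
  have B: "exp (- ?E) \<le> (\<Prod>i<k. 1 + ?w i)"
    using prod_one_plus_lower[of k ?w, OF w \<eta> sum0] by (simp add: inner_scaled_scatter)
  have "0 \<le> (\<Prod>i<k. real k * p i)" using p0 by (intro prod_nonneg) auto
  then have "(\<Prod>i<k. real k * p i) * exp (- ?E) \<le> (\<Prod>i<k. real k * p i) * (\<Prod>i<k. 1 + ?w i)"
    using B by (rule mult_left_mono[rotated])
  with A have "(\<Prod>i<k. real k * p i) * exp (- ?E) \<le> exp (\<nu> \<bullet> z)" by simp
  then have "(\<Prod>i<k. real k * p i) * exp (- ?E) * exp ?E \<le> exp (\<nu> \<bullet> z) * exp ?E" by (rule mult_right_mono) simp
  moreover have "exp (- ?E) * exp ?E = 1" by (simp add: exp_minus)
  ultimately show ?thesis by (simp only: mult.assoc mult_1_right exp_add)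
qed

text \<open>Any weights that realise the shift \<open>\<delta>\<close> split it into a shift \<open>u\<close> of one sample and \<open>v\<close> of the other with
  \<open>v - u = \<delta>\<close>; in the sum of the two dual bounds only this difference remains.\<close>

lemma oel_lower:
  assumes mn: "0 < m" "0 < n" and \<eta>: "\<eta> \<le> 1 / 2"
    and x: "\<And>i. i < m \<Longrightarrow> \<bar>\<nu> \<bullet> centred m x i / real m\<bar> \<le> \<eta>"
    and y: "\<And>j. j < n \<Longrightarrow> \<bar>\<nu> \<bullet> centred n y j / real n\<bar> \<le> \<eta>"
  defines "\<delta> \<equiv> scaled_scatter m x \<nu> + scaled_scatter n y \<nu>"
  assumes le: "oel m n x y (theta_hat m n x y + \<delta>) \<le> ereal s"
  shows "(1 - 4 * \<eta>) * (\<nu> \<bullet> \<delta>) \<le> s"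
proof -
  obtain p q where pq: "p \<in> weight_simplex m" "q \<in> weight_simplex n" "exp (- s / 2) \<le> el_prod m n p q"
    "theta m n x y p q = theta_hat m n x y + \<delta>"
    using le unfolding oel_le_iff by (auto simp: level_weights_def)
  have y': "\<bar>- \<nu> \<bullet> centred n y i / real n\<bar> \<le> \<eta>" if "i < n" for i using y[OF that] by simp
  define u where "u = (\<Sum>i<m. p i *\<^sub>R x i) - (1 / real m) *\<^sub>R (\<Sum>i<m. x i)"
  define v where "v = (\<Sum>j<n. q j *\<^sub>R y j) - (1 / real n) *\<^sub>R (\<Sum>j<n. y j)"
  have vu: "v - u = \<delta>" using pq(4) by (simp add: theta_def theta_hat_def u_def v_def algebra_simps)
  have P: "(\<Prod>i<m. real m * p i) \<le> exp (\<nu> \<bullet> u + (1 / 2 + 2 * \<eta>) * (\<nu> \<bullet> scaled_scatter m x \<nu>))"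
    by (rule prod_weights_le[OF mn(1) pq(1) _ x \<eta>]) (simp_all add: u_def)
  have Q: "(\<Prod>j<n. real n * q j) \<le> exp (- \<nu> \<bullet> v + (1 / 2 + 2 * \<eta>) * (- \<nu> \<bullet> scaled_scatter n y (- \<nu>)))"
    by (rule prod_weights_le[OF mn(2) pq(2) _ y' \<eta>]) (simp_all add: v_def)
  have "exp (- s / 2) \<le> el_prod m n p q" by fact
  also have "\<dots> \<le> exp (\<nu> \<bullet> u + (1 / 2 + 2 * \<eta>) * (\<nu> \<bullet> scaled_scatter m x \<nu>)) * exp (- \<nu> \<bullet> v + (1 / 2 + 2 * \<eta>) * (- \<nu> \<bullet> scaled_scatter n y (- \<nu>)))"
    unfolding el_prod_def using pq(1,2)
    by (intro mult_mono P Q prod_nonneg) (auto simp: weight_simplex_def prob_vector_def)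
  also have "\<dots> = exp (- (\<nu> \<bullet> (v - u)) + (1 / 2 + 2 * \<eta>) * (\<nu> \<bullet> \<delta>))"
    unfolding exp_add[symmetric] scaled_scatter_minus \<delta>_def by (simp add: inner_add_right inner_diff_right algebra_simps)
  also have "\<dots> = exp (- ((1 - 4 * \<eta>) * (\<nu> \<bullet> \<delta>)) / 2)" unfolding vu by (simp add: field_simps)
  finally show ?thesis by simp
qed

section \<open>Quadratic forms and covariance matrices\<close>

text \<open>Gram--Schmidt for an arbitrary positive definite form, one vector at a time.\<close>

lemma form_orthonormal_system:
  fixes B :: "'v::euclidean_space \<Rightarrow> 'v \<Rightarrow> real"
  assumes bil: "bilinear B" and sym: "\<And>u w. B u w = B w u" and pos: "\<And>u. u \<noteq> 0 \<Longrightarrow> 0 < B u u"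
    and k: "k \<le> DIM('v)"
  shows "\<exists>v::nat \<Rightarrow> 'v. (\<forall>i<k. \<forall>j<k. B (v i) (v j) = of_bool (i = j)) \<and> dim (v ` {..<k}) = k"
  using k
proof (induction k)
  case (Suc k)
  then obtain v where v: "\<And>i j. i < k \<Longrightarrow> j < k \<Longrightarrow> B (v i) (v j) = of_bool (i = j)" and d: "dim (v ` {..<k}) = k"
    by auto
  have lin: "linear (\<lambda>x. B x w)" for w using bil by (simp add: bilinear_def)
  have "span (v ` {..<k}) \<noteq> UNIV"
  proof
    assume "span (v ` {..<k}) = UNIV"
    then have "dim (v ` {..<k}) = DIM('v)" by (metis dim_UNIV dim_span)
    with d Suc.prems show False by simp
  qed
  then obtain u where u: "u \<notin> span (v ` {..<k})" by blast
  define w where "w = u - (\<Sum>i<k. B u (v i) *\<^sub>R v i)"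
  have "(\<Sum>i<k. B u (v i) *\<^sub>R v i) \<in> span (v ` {..<k})"
    by (intro span_sum span_scale span_base) auto
  then have w: "w \<notin> span (v ` {..<k})"
    unfolding w_def using u span_add_eq2 by (metis diff_add_cancel span_add)
  then have "w \<noteq> 0" using span_zero by metis
  then have Bw: "0 < B w w" by (rule pos)
  have orth: "B w (v j) = 0" if "j < k" for j
  proof -
    have "B w (v j) = B u (v j) - (\<Sum>i<k. B u (v i) * B (v i) (v j))"
      unfolding w_def by (simp add: linear_diff[OF lin[of "v j"]] linear_sum[OF lin[of "v j"]] linear_scale[OF lin[of "v j"]])
    also have "(\<Sum>i<k. B u (v i) * B (v i) (v j)) = (\<Sum>i<k. if i = j then B u (v i) else 0)"
      using that by (intro sum.cong refl) (auto simp: v)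
    also have "\<dots> = B u (v j)" using that by simp
    finally show ?thesis by simp
  qed
  define e where "e = (1 / sqrt (B w w)) *\<^sub>R w"
  have e1: "B e e = 1" "B e (v j) = B w (v j) / sqrt (B w w)" for j
    using Bw by (simp_all add: e_def bilinear_lmul[OF bil] bilinear_rmul[OF bil] real_sqrt_mult[symmetric])
  have e: "e \<notin> span (v ` {..<k})"
  proof
    assume "e \<in> span (v ` {..<k})"
    then have "sqrt (B w w) *\<^sub>R e \<in> span (v ` {..<k})" by (rule span_scale)
    with w Bw show False by (simp add: e_def)
  qed
  let ?v = "v(k := e)"
  have im: "?v ` {..<Suc k} = insert e (v ` {..<k})" by (auto simp: lessThan_Suc)
  have "dim (?v ` {..<Suc k}) = Suc k" unfolding im using e d by (simp add: dim_insert)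
  moreover have "B (?v i) (?v j) = of_bool (i = j)" if "i < Suc k" "j < Suc k" for i j
    using that v[of i j] e1 orth sym[of "v i" e] by (auto simp: less_Suc_eq)
  ultimately show ?case by blast
qed simp

lemma form_orthonormal_basis:
  fixes B :: "'v::euclidean_space \<Rightarrow> 'v \<Rightarrow> real"
  assumes "bilinear B" "\<And>u w. B u w = B w u" "\<And>u. u \<noteq> 0 \<Longrightarrow> 0 < B u u"
  obtains v :: "nat \<Rightarrow> 'v" where
    "\<And>i j. i < DIM('v) \<Longrightarrow> j < DIM('v) \<Longrightarrow> B (v i) (v j) = of_bool (i = j)"
    "span (v ` {..<DIM('v)}) = UNIV"
proof -
  obtain v where v: "\<forall>i<DIM('v). \<forall>j<DIM('v). B (v i) (v j) = of_bool (i = j)" "dim (v ` {..<DIM('v)}) = DIM('v)"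
    using form_orthonormal_system[OF assms order_refl] by blast
  then have "span (v ` {..<DIM('v)}) = UNIV" by (simp add: dim_eq_full)
  with v that show thesis by blast
qed

lemma form_combination:
  fixes B :: "'v::euclidean_space \<Rightarrow> 'v \<Rightarrow> real" and v :: "nat \<Rightarrow> 'v"
  assumes bil: "bilinear B" and v: "\<And>i j. i < k \<Longrightarrow> j < k \<Longrightarrow> B (v i) (v j) = of_bool (i = j)"
  shows "B (\<Sum>i<k. c i *\<^sub>R v i) (\<Sum>i<k. c i *\<^sub>R v i) = (\<Sum>i<k. (c i)\<^sup>2)"
proof -
  have "B (\<Sum>i<k. c i *\<^sub>R v i) (\<Sum>i<k. c i *\<^sub>R v i) = (\<Sum>i<k. \<Sum>j<k. c i * (c j * B (v i) (v j)))"
    by (subst bilinear_sum[OF bil]) (simp_all add: sum.cartesian_product bilinear_lmul[OF bil] bilinear_rmul[OF bil] case_prod_beta mult.left_commute)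
  also have "\<dots> = (\<Sum>i<k. \<Sum>j<k. if j = i then (c i)\<^sup>2 else 0)"
    by (intro sum.cong refl) (auto simp: v power2_eq_square)
  also have "\<dots> = (\<Sum>i<k. (c i)\<^sup>2)" by (intro sum.cong refl) (simp add: sum.delta)
  finally show ?thesis .
qed

text \<open>If the form of \<open>S\<close> is within a factor \<open>1 \<plusminus> \<eta>\<close> of \<open>B\<close>, then so are the inverse forms, evaluated at
  \<open>\<delta> = S \<nu>\<close>: the inverse of \<open>S\<close> gives \<open>\<nu> \<bullet> \<delta>\<close>, that of \<open>B\<close> the sum of squares of the coordinates of
  \<open>\<delta>\<close>. With \<open>\<omega>\<close> the vector that represents \<open>\<delta>\<close> in the form \<open>B\<close>, both inequalities express that a form is
  nonnegative at a combination of \<open>\<nu>\<close> and \<open>\<omega>\<close>.\<close>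

lemma inverse_form_close:
  fixes B :: "'v::euclidean_space \<Rightarrow> 'v \<Rightarrow> real" and S :: "'v \<Rightarrow> 'v" and v :: "nat \<Rightarrow> 'v"
  assumes bil: "bilinear B" and sym: "\<And>u w. B u w = B w u" 
    and v: "\<And>i j. i < k \<Longrightarrow> j < k \<Longrightarrow> B (v i) (v j) = of_bool (i = j)" and sp: "span (v ` {..<k}) = UNIV"
    and S: "linear S" and Ssym: "\<And>u w. u \<bullet> S w = w \<bullet> S u" and Bpos: "\<And>u. 0 \<le> B u u"
    and close: "\<And>u. \<bar>u \<bullet> S u - B u u\<bar> \<le> \<eta> * B u u" and \<eta>: "0 \<le> \<eta>" "\<eta> < 1"
  shows "(1 - \<eta>) * (\<nu> \<bullet> S \<nu>) \<le> (\<Sum>i<k. (v i \<bullet> S \<nu>)\<^sup>2)"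
    and "(\<Sum>i<k. (v i \<bullet> S \<nu>)\<^sup>2) \<le> (1 + \<eta>) * (\<nu> \<bullet> S \<nu>)"
proof -
  define z where "z i = v i \<bullet> S \<nu>" for i
  define \<omega> where "\<omega> = (\<Sum>i<k. z i *\<^sub>R v i)"
  define Z where "Z = (\<Sum>i<k. (z i)\<^sup>2)"
  define Q where "Q = \<nu> \<bullet> S \<nu>"
  have BZ: "B \<omega> \<omega> = Z" unfolding \<omega>_def Z_def by (rule form_combination[OF bil v])
  have Z\<omega>: "\<omega> \<bullet> S \<nu> = Z" by (simp add: \<omega>_def Z_def z_def inner_sum_left power2_eq_square)
  have lin: "linear (B \<omega>)" using bil by (simp add: bilinear_def)
  have B\<omega>: "B \<omega> u = u \<bullet> S \<nu>" for u
  proof (rule linear_eq_on_span[OF lin])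
    show "linear (\<lambda>u. u \<bullet> S \<nu>)" by (intro linearI) (auto simp: inner_add_left)
    show "u \<in> span (v ` {..<k})" by (simp add: sp)
    fix a assume "a \<in> v ` {..<k}"
    then obtain j where j: "j < k" "a = v j" by auto
    have "B \<omega> (v j) = (\<Sum>i<k. z i * B (v i) (v j))"
    proof -
      have "linear (\<lambda>x. B x (v j))" using bil by (simp add: bilinear_def)
      then show ?thesis unfolding \<omega>_def by (subst linear_sum[of "\<lambda>x. B x (v j)"]) (simp_all add: bilinear_lmul[OF bil])
    qed
    also have "\<dots> = (\<Sum>i<k. if i = j then z i else 0)" using j by (intro sum.cong refl) (auto simp: v)
    also have "\<dots> = z j" using j by simp
    finally show "B \<omega> a = a \<bullet> S \<nu>" using j by (simp add: z_def)
  qed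
  have expand: "B (a *\<^sub>R \<nu> - \<omega>) (a *\<^sub>R \<nu> - \<omega>) = a * (a * B \<nu> \<nu>) - 2 * a * B \<omega> \<nu> + B \<omega> \<omega>" for a
    by (simp add: bilinear_lsub[OF bil] bilinear_rsub[OF bil] bilinear_lmul[OF bil] bilinear_rmul[OF bil]
        sym[of \<nu> \<omega>] algebra_simps)
  have "0 \<le> B ((1 - \<eta>) *\<^sub>R \<nu> - \<omega>) ((1 - \<eta>) *\<^sub>R \<nu> - \<omega>)" by (rule Bpos)
  also have "\<dots> = (1 - \<eta>) * ((1 - \<eta>) * B \<nu> \<nu>) - 2 * (1 - \<eta>) * Q + Z"
    unfolding expand BZ B\<omega>[of \<nu>] Q_def ..
  also have "(1 - \<eta>) * ((1 - \<eta>) * B \<nu> \<nu>) \<le> (1 - \<eta>) * Q"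
    using close[of \<nu>] \<eta> unfolding Q_def by (intro mult_left_mono) (auto simp: abs_le_iff algebra_simps)
  finally show "(1 - \<eta>) * (\<nu> \<bullet> S \<nu>) \<le> (\<Sum>i<k. (v i \<bullet> S \<nu>)\<^sup>2)"
    unfolding Q_def Z_def z_def by (simp add: algebra_simps)
  have S0: "0 \<le> u \<bullet> S u" for u
  proof -
    have "\<eta> * B u u \<le> 1 * B u u" using \<eta> Bpos by (intro mult_right_mono) auto
    then show ?thesis using close[of u] by (simp add: abs_le_iff)
  qed
  have expandS: "(a *\<^sub>R \<nu> - \<omega>) \<bullet> S (a *\<^sub>R \<nu> - \<omega>) = a * (a * (\<nu> \<bullet> S \<nu>)) - 2 * a * (\<omega> \<bullet> S \<nu>) + \<omega> \<bullet> S \<omega>" for a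
    using Ssym[of \<nu> \<omega>]
    by (simp add: linear_diff[OF S] linear_scale[OF S] inner_diff_left inner_diff_right algebra_simps)
  have "0 \<le> ((1 + \<eta>) *\<^sub>R \<nu> - \<omega>) \<bullet> S ((1 + \<eta>) *\<^sub>R \<nu> - \<omega>)" by (rule S0)
  also have "\<dots> = (1 + \<eta>) * ((1 + \<eta>) * Q) - 2 * (1 + \<eta>) * Z + \<omega> \<bullet> S \<omega>"
    unfolding expandS Z\<omega> Q_def ..
  also have "\<omega> \<bullet> S \<omega> \<le> (1 + \<eta>) * Z" using close[of \<omega>] by (simp add: abs_le_iff BZ algebra_simps)
  finally have "(1 + \<eta>) * Z \<le> (1 + \<eta>) * ((1 + \<eta>) * Q)" by (simp add: algebra_simps)
  then have "Z \<le> (1 + \<eta>) * Q" using \<eta> by simp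
  then show "(\<Sum>i<k. (v i \<bullet> S \<nu>)\<^sup>2) \<le> (1 + \<eta>) * (\<nu> \<bullet> S \<nu>)" by (simp add: Q_def Z_def z_def)
qed

lemma linear_scaled_scatter: "linear (scaled_scatter k x)"
  by (rule linearI) (simp_all add: scaled_scatter_def inner_add_left algebra_simps sum.distrib scaleR_sum_right)

lemma inner_scaled_scatter_sym: "u \<bullet> scaled_scatter k x w = w \<bullet> scaled_scatter k x u"
  by (simp add: scaled_scatter_def inner_sum_right mult.commute)

locale finite_cov_vector = prob_space P for P :: "'b measure" +
  fixes X :: "'b \<Rightarrow> real ^ 'd"
  assumes X_measurable [measurable]: "X \<in> borel_measurable P"
    and fin: "finite_cov P X"
begin

abbreviation \<mu> where "\<mu> \<equiv> mean_vec P X"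
abbreviation \<Sigma> where "\<Sigma> \<equiv> cov_matrix P X"

lemma integrable_X: "integrable P X"
  using fin by (simp add: finite_cov_def)

lemma integrable_entries: "integrable P (\<lambda>w. (X w - \<mu>) $ i * (X w - \<mu>) $ j)"
  using fin by (simp add: finite_cov_def)

lemma integrable_inner_prod: "integrable P (\<lambda>w. (u \<bullet> (X w - \<mu>)) * (v \<bullet> (X w - \<mu>)))"
proof -
  have eq: "(\<lambda>w. (u \<bullet> (X w - \<mu>)) * (v \<bullet> (X w - \<mu>))) =
      (\<lambda>w. \<Sum>i\<in>UNIV. \<Sum>j\<in>UNIV. (u $ i * v $ j) * ((X w - \<mu>) $ i * (X w - \<mu>) $ j))"
    by (simp add: inner_vec_def sum_product mult_ac del: vector_minus_component)
  show ?thesis unfolding eq by (intro Bochner_Integration.integrable_sum integrable_mult_right integrable_entries)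
qed

lemma inner_cov_matrix: "u \<bullet> (\<Sigma> *v v) = expectation (\<lambda>w. (u \<bullet> (X w - \<mu>)) * (v \<bullet> (X w - \<mu>)))"
proof -
  have "expectation (\<lambda>w. (u \<bullet> (X w - \<mu>)) * (v \<bullet> (X w - \<mu>))) =
      expectation (\<lambda>w. \<Sum>i\<in>UNIV. \<Sum>j\<in>UNIV. (u $ i * v $ j) * ((X w - \<mu>) $ i * (X w - \<mu>) $ j))"
    by (simp add: inner_vec_def sum_product mult_ac del: vector_minus_component)
  also have "\<dots> = (\<Sum>i\<in>UNIV. \<Sum>j\<in>UNIV. (u $ i * v $ j) * expectation (\<lambda>w. (X w - \<mu>) $ i * (X w - \<mu>) $ j))"
    by (subst Bochner_Integration.integral_sum, intro Bochner_Integration.integrable_sum integrable_mult_right integrable_entries)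
       (subst Bochner_Integration.integral_sum, auto intro!: integrable_mult_right integrable_entries sum.cong simp del: vector_minus_component)
  also have "\<dots> = u \<bullet> (\<Sigma> *v v)"
    by (simp add: inner_vec_def matrix_vector_mult_def cov_matrix_def sum_distrib_left mult_ac)
  finally show ?thesis ..
qed

lemma cov_matrix_sym: "u \<bullet> (\<Sigma> *v v) = v \<bullet> (\<Sigma> *v u)"
  unfolding inner_cov_matrix by (simp add: mult.commute)

lemma cov_matrix_nonneg: "0 \<le> u \<bullet> (\<Sigma> *v u)"
  unfolding inner_cov_matrix by simp

lemma integrable_norm2: "integrable P (\<lambda>w. (norm (X w - \<mu>))\<^sup>2)"
proof -
  have eq: "(\<lambda>w. (norm (X w - \<mu>))\<^sup>2) = (\<lambda>w. \<Sum>i\<in>UNIV. (X w - \<mu>) $ i * (X w - \<mu>) $ i)"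
    by (simp add: power2_norm_eq_inner inner_vec_def)
  show ?thesis unfolding eq by (intro Bochner_Integration.integrable_sum integrable_entries)
qed

lemma expectation_inner_centred: "expectation (\<lambda>w. u \<bullet> (X w - \<mu>)) = 0"
  using integrable_X by (simp add: mean_vec_def prob_space)

lemma cov_matrix_le: "u \<bullet> (\<Sigma> *v u) \<le> (norm u)\<^sup>2 * expectation (\<lambda>w. (norm (X w - \<mu>))\<^sup>2)"
proof -
  have "u \<bullet> (\<Sigma> *v u) \<le> expectation (\<lambda>w. (norm u)\<^sup>2 * (norm (X w - \<mu>))\<^sup>2)"
    unfolding inner_cov_matrix
  proof (intro integral_mono integrable_inner_prod integrable_mult_right integrable_norm2)
    fix w
    have "\<bar>u \<bullet> (X w - \<mu>)\<bar> \<le> norm u * norm (X w - \<mu>)" by (rule Cauchy_Schwarz_ineq2)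
    then have "\<bar>u \<bullet> (X w - \<mu>)\<bar>\<^sup>2 \<le> (norm u * norm (X w - \<mu>))\<^sup>2" by (rule power_mono) simp
    then show "(u \<bullet> (X w - \<mu>)) * (u \<bullet> (X w - \<mu>)) \<le> (norm u)\<^sup>2 * (norm (X w - \<mu>))\<^sup>2"
      by (simp only: power2_abs power_mult_distrib) (simp only: power2_eq_square)
  qed
  then show ?thesis by simp
qed

end

locale full_rank_vector = finite_cov_vector P X
  for P :: "'b measure" and X :: "'b \<Rightarrow> real ^ 'd" +
  assumes full_rank: "rank (cov_matrix P X) = CARD('d)"
begin

text \<open>If the form vanishes at \<open>u\<close>, then \<open>u \<bullet> (X - \<mu>) = 0\<close> almost surely, which puts \<open>u\<close> into the kernel.\<close>

lemma cov_matrix_pos: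
  assumes "u \<noteq> 0" shows "0 < u \<bullet> (\<Sigma> *v u)"
proof (rule ccontr)
  assume "\<not> ?thesis"
  with cov_matrix_nonneg[of u] have 0: "u \<bullet> (\<Sigma> *v u) = 0" by simp
  then have "AE w in P. (u \<bullet> (X w - \<mu>)) * (u \<bullet> (X w - \<mu>)) = 0"
    unfolding inner_cov_matrix by (subst (asm) integral_nonneg_eq_0_iff_AE) (auto intro: integrable_inner_prod)
  then have AE: "AE w in P. u \<bullet> (X w - \<mu>) = 0" by eventually_elim simp
  have "v \<bullet> (\<Sigma> *v u) = 0" for v
  proof -
    have "expectation (\<lambda>w. (v \<bullet> (X w - \<mu>)) * (u \<bullet> (X w - \<mu>))) = expectation (\<lambda>w. 0)"
      using AE by (intro integral_cong_AE) auto
    then show ?thesis by (simp add: inner_cov_matrix)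
  qed
  then have "\<Sigma> *v u = 0" by (metis inner_eq_zero_iff)
  moreover have "inj ((*v) \<Sigma>)" using full_rank by (simp add: full_rank_injective)
  ultimately have "u = 0" by (metis injD matrix_vector_mult_0_right)
  with assms show False by simp
qed

text \<open>The minimum over the compact unit sphere is positive.\<close>

lemma cov_matrix_coercive: "\<exists>c>0. \<forall>u. c * (norm u)\<^sup>2 \<le> u \<bullet> (\<Sigma> *v u)"
proof -
  have ne: "sphere (0 :: real ^ 'd) 1 \<noteq> {}" by simp
  have "continuous_on (sphere 0 1) (\<lambda>u. u \<bullet> (\<Sigma> *v u))"
    by (intro continuous_intros matrix_vector_mult_linear_continuous_on)
  from continuous_attains_inf[OF compact_sphere ne this]
  obtain a where a: "a \<in> sphere 0 1" "\<And>u. u \<in> sphere 0 1 \<Longrightarrow> a \<bullet> (\<Sigma> *v a) \<le> u \<bullet> (\<Sigma> *v u)" by blast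
  let ?c = "a \<bullet> (\<Sigma> *v a)"
  have "0 < ?c" using a by (intro cov_matrix_pos) auto
  moreover have "?c * (norm u)\<^sup>2 \<le> u \<bullet> (\<Sigma> *v u)" for u
  proof (cases "u = 0")
    case False
    have "?c \<le> (inverse (norm u) *\<^sub>R u) \<bullet> (\<Sigma> *v (inverse (norm u) *\<^sub>R u))" using False by (intro a) simp
    also have "\<dots> = u \<bullet> (\<Sigma> *v u) / (norm u)\<^sup>2"
      by (simp add: matrix_vector_mult_scaleR field_simps power2_eq_square)
    finally show ?thesis using False by (simp add: field_simps)
  qed simp
  ultimately show ?thesis by blast
qed

end

section \<open>Characteristic functions of normalised sums\<close>

lemma exp_minus_quadratic: "0 \<le> z \<Longrightarrow> \<bar>exp (- z) - (1 - z)\<bar> \<le> (z::real)\<^sup>2"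
proof -
  assume z: "0 \<le> z"
  have 1: "1 - z \<le> exp (- z)" using exp_ge_add_one_self[of "- z"] by simp
  have "exp (- z) \<le> 1 / (1 + z)"
    using z exp_ge_add_one_self[of z] by (simp add: exp_minus field_simps)
  also have "\<dots> \<le> 1 - z + z\<^sup>2" using z by (simp add: field_simps power2_eq_square)
  finally show ?thesis using 1 by simp
qed

context finite_cov_vector
begin

text \<open>Bounds six times \<open>k\<close> times the second-order Taylor remainder of \<open>iexp (u \<bullet> (X - \<mu>))\<close>, for vectors
  \<open>u\<close> of norm at most \<open>L / sqrt k\<close>. The cubic term makes it small, the quadratic term integrable.\<close>

definition error_bound :: "real \<Rightarrow> nat \<Rightarrow> 'b \<Rightarrow> real" where
  "error_bound L k w = min (6 * L\<^sup>2 * (norm (X w - \<mu>))\<^sup>2) (L ^ 3 * norm (X w - \<mu>) ^ 3 / sqrt (real k))"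

text \<open>The characteristic function of the centred random vector.\<close>

definition cchar :: "real ^ 'd \<Rightarrow> complex" where
  "cchar u = (CLINT w|P. iexp (u \<bullet> (X w - \<mu>)))"

lemma cchar_eq: "cchar u = char (distr P borel (\<lambda>w. u \<bullet> (X w - \<mu>))) 1"
  by (simp add: cchar_def char_def integral_distr)

lemma norm_cchar_le_1: "norm (cchar u) \<le> 1"
  unfolding cchar_eq by (intro real_distribution.cmod_char_le_1 real_distribution_distr) measurable

lemma cchar_approx:
  "cmod (cchar u - (1 - u \<bullet> (\<Sigma> *v u) / 2)) \<le>
    expectation (\<lambda>w. min (6 * (u \<bullet> (X w - \<mu>))\<^sup>2) (\<bar>u \<bullet> (X w - \<mu>)\<bar> ^ 3)) / 6"
proof -
  let ?Y = "\<lambda>w. u \<bullet> (X w - \<mu>)"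
  have "integrable P ?Y" using integrable_X by simp
  moreover have "integrable P (\<lambda>w. (?Y w)\<^sup>2)" using integrable_inner_prod[of u u] by (simp add: power2_eq_square)
  moreover have "variance ?Y = u \<bullet> (\<Sigma> *v u)"
    by (simp add: expectation_inner_centred inner_cov_matrix power2_eq_square)
  ultimately have "cmod (char (distr P borel ?Y) 1 - (1 - 1\<^sup>2 * (u \<bullet> (\<Sigma> *v u)) / 2)) \<le>
     (1\<^sup>2 / 6) * expectation (\<lambda>w. min (6 * (?Y w)\<^sup>2) (\<bar>1\<bar> * \<bar>?Y w\<bar> ^ 3))"
    by (intro char_approx3') (auto simp: expectation_inner_centred)
  then show ?thesis by (simp add: cchar_eq)
qed

lemma cchar_error_vanishes:
  fixes L :: real
  assumes K: "filterlim K at_top sequentially" and L: "0 \<le> L"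
  shows "(\<lambda>n. expectation (error_bound L (K n))) \<longlonglongrightarrow> 0"
proof -
  have "(\<lambda>n. expectation (error_bound L (K n))) \<longlonglongrightarrow> expectation (\<lambda>w. 0)"
  proof (rule integral_dominated_convergence[where w = "\<lambda>w. 6 * L\<^sup>2 * (norm (X w - \<mu>))\<^sup>2"])
    show "integrable P (\<lambda>w. 6 * L\<^sup>2 * (norm (X w - \<mu>))\<^sup>2)" by (intro integrable_mult_right integrable_norm2)
    have "filterlim (\<lambda>n. sqrt (real (K n))) at_top sequentially"
      by (intro filterlim_compose[OF sqrt_at_top] filterlim_compose[OF filterlim_real_sequentially] K)
    then have "(\<lambda>n. a / sqrt (real (K n))) \<longlonglongrightarrow> 0" for a :: real
      by (intro real_tendsto_divide_at_top[OF tendsto_const])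
    then have "(\<lambda>n. error_bound L (K n) w) \<longlonglongrightarrow> min (6 * L\<^sup>2 * (norm (X w - \<mu>))\<^sup>2) 0" for w
      unfolding error_bound_def by (intro tendsto_min tendsto_const)
    then show "AE w in P. (\<lambda>n. error_bound L (K n) w) \<longlonglongrightarrow> 0"
      by (simp add: min_absorb2)
  qed (use L in \<open>auto intro!: AE_I2 simp: error_bound_def[abs_def]\<close>)
  then show ?thesis by simp
qed

text \<open>The \<open>k\<close>-th power of the characteristic function at a vector of order \<open>1 / sqrt k\<close> approaches the
  Gaussian one. This is the classical proof of the central limit
  theorem: powers of numbers in the unit disc differ by at most \<open>k\<close> times the difference of the bases,
  and \<open>k\<close> times the Taylor error vanishes.\<close>

lemma cchar_power_limit:
  assumes K: "filterlim K at_top sequentially" and U: "\<And>n. (norm (U n))\<^sup>2 \<le> C * real (K n)" and K0: "\<And>n. 0 < K n"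
  shows "(\<lambda>n. cchar ((1 / real (K n)) *\<^sub>R U n) ^ K n -
      complex_of_real (exp (- (U n \<bullet> (\<Sigma> *v U n)) / (2 * real (K n))))) \<longlonglongrightarrow> 0"
proof -
  define V where "V = expectation (\<lambda>w. (norm (X w - \<mu>))\<^sup>2)"
  define L where "L = sqrt C"
  have "0 \<le> C * real (K 0)" using U[of 0] by (meson order_trans zero_le_power2)
  then have C: "0 \<le> C" using K0[of 0] by (simp add: zero_le_mult_iff)
  have V: "0 \<le> V" by (simp add: V_def)
  let ?g = "\<lambda>n. error_bound L (K n)"
  let ?err = "\<lambda>n. expectation (?g n) / 6 + (C * V)\<^sup>2 / real (K n)"
  show ?thesis
  proof (rule Lim_null_comparison)
    have e1: "(\<lambda>n. (C * V)\<^sup>2 / real (K n)) \<longlonglongrightarrow> 0"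
      by (intro real_tendsto_divide_at_top[OF tendsto_const] filterlim_compose[OF filterlim_real_sequentially] K)
    have e2: "(\<lambda>n. expectation (?g n) / 6) \<longlonglongrightarrow> 0 / 6"
      using C by (intro tendsto_divide tendsto_const cchar_error_vanishes K) (auto simp: L_def)
    show "?err \<longlonglongrightarrow> 0" using tendsto_add[OF e2 e1] by simp
    show "\<forall>\<^sub>F n in sequentially. cmod (cchar ((1 / real (K n)) *\<^sub>R U n) ^ K n -
      complex_of_real (exp (- (U n \<bullet> (\<Sigma> *v U n)) / (2 * real (K n))))) \<le> ?err n"
    proof (rule always_eventually, rule allI)
      fix n
      let ?K = "real (K n)" and ?u = "(1 / real (K n)) *\<^sub>R U n"
      have K0': "0 < ?K" using K0 by simp
      define q where "q = U n \<bullet> (\<Sigma> *v U n)"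
      define z where "z = q / (2 * ?K\<^sup>2)"
      have q: "0 \<le> q" "q \<le> C * ?K * V"
      proof -
        show "0 \<le> q" unfolding q_def by (rule cov_matrix_nonneg)
        have "q \<le> (norm (U n))\<^sup>2 * V" unfolding q_def V_def by (rule cov_matrix_le)
        also have "\<dots> \<le> C * ?K * V" using U V by (rule mult_right_mono)
        finally show "q \<le> C * ?K * V" .
      qed
      have z0: "0 \<le> z" using q by (simp add: z_def)
      have uq: "?u \<bullet> (\<Sigma> *v ?u) / 2 = z"
        by (simp add: z_def q_def matrix_vector_mult_scaleR power2_eq_square)
      have ez: "exp (- q / (2 * ?K)) = exp (- z) ^ K n"
        using K0' by (simp add: z_def power2_eq_square field_simps flip: exp_of_nat_mult)
      have "cmod (cchar ?u ^ K n - complex_of_real (exp (- z)) ^ K n) \<le> ?K * cmod (cchar ?u - complex_of_real (exp (- z)))"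
        using z0 by (intro norm_power_diff norm_cchar_le_1) (simp add: norm_of_real)
      also have "\<dots> \<le> ?K * (cmod (cchar ?u - (1 - complex_of_real z)) + z\<^sup>2)"
      proof (intro mult_left_mono)
        have "cmod (cchar ?u - complex_of_real (exp (- z))) \<le> cmod (cchar ?u - (1 - complex_of_real z)) + cmod ((1 - complex_of_real z) - complex_of_real (exp (- z)))"
          using norm_triangle_ineq[of "cchar ?u - (1 - complex_of_real z)" "(1 - complex_of_real z) - complex_of_real (exp (- z))"] by simp
        also have "cmod ((1 - complex_of_real z) - complex_of_real (exp (- z))) = \<bar>exp (- z) - (1 - z)\<bar>"
          by (metis abs_minus_commute norm_of_real of_real_1 of_real_diff)
        also have "\<dots> \<le> z\<^sup>2" using z0 by (rule exp_minus_quadratic)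
        finally show "cmod (cchar ?u - complex_of_real (exp (- z))) \<le> cmod (cchar ?u - (1 - complex_of_real z)) + z\<^sup>2" by simp
      qed simp
      also have "\<dots> = ?K * cmod (cchar ?u - (1 - complex_of_real z)) + ?K * z\<^sup>2" by (simp add: distrib_left)
      also have "?K * z\<^sup>2 \<le> (C * V)\<^sup>2 / ?K"
      proof -
        have "z \<le> C * V / (2 * ?K)" using q K0' by (simp add: z_def field_simps power2_eq_square)
        also have "\<dots> \<le> C * V / ?K" using C V K0' by (intro divide_left_mono) auto
        finally have "z\<^sup>2 \<le> (C * V / ?K)\<^sup>2" using z0 by (intro power_mono)
        then have "?K * z\<^sup>2 \<le> ?K * (C * V / ?K)\<^sup>2" by (intro mult_left_mono) auto
        then show ?thesis using K0' by (simp add: power2_eq_square)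
      qed
      also have "?K * cmod (cchar ?u - (1 - complex_of_real z)) \<le> expectation (?g n) / 6"
      proof -
        have "?K * cmod (cchar ?u - (1 - complex_of_real z)) \<le> ?K * (expectation (\<lambda>w. min (6 * (?u \<bullet> (X w - \<mu>))\<^sup>2) (\<bar>?u \<bullet> (X w - \<mu>)\<bar> ^ 3)) / 6)"
          using cchar_approx[of ?u] unfolding uq by (intro mult_left_mono) auto
        also have "\<dots> = expectation (\<lambda>w. ?K * min (6 * (?u \<bullet> (X w - \<mu>))\<^sup>2) (\<bar>?u \<bullet> (X w - \<mu>)\<bar> ^ 3)) / 6"
          by simp
        also have "\<dots> \<le> expectation (?g n) / 6"
        proof (intro divide_right_mono integral_mono)
          have i: "integrable P (\<lambda>w. min (6 * (f w)\<^sup>2) (\<bar>f w\<bar> ^ 3))" if "integrable P (\<lambda>w. (f w)\<^sup>2)" "f \<in> borel_measurable P" for f :: "'b \<Rightarrow> real"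
            by (rule Bochner_Integration.integrable_bound[of _ "\<lambda>w. 6 * (f w)\<^sup>2"]) (use that in \<open>auto intro!: AE_I2\<close>)
          show "integrable P (\<lambda>w. ?K * min (6 * (?u \<bullet> (X w - \<mu>))\<^sup>2) (\<bar>?u \<bullet> (X w - \<mu>)\<bar> ^ 3))"
            using integrable_inner_prod[of ?u ?u] by (intro integrable_mult_right i) (auto simp: power2_eq_square)
          show "integrable P (?g n)"
            by (rule Bochner_Integration.integrable_bound[of _ "\<lambda>w. 6 * L\<^sup>2 * (norm (X w - \<mu>))\<^sup>2"])
              (use C in \<open>auto intro!: AE_I2 integrable_mult_right integrable_norm2 simp: L_def error_bound_def[abs_def]\<close>)
          fix w
          define r where "r = norm (X w - \<mu>)"
          define y where "y = \<bar>?u \<bullet> (X w - \<mu>)\<bar>"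
          have "norm (U n) \<le> L * sqrt ?K" unfolding L_def real_sqrt_mult[symmetric] using U by (rule real_le_rsqrt)
          then have "norm ?u \<le> L * sqrt ?K / ?K" using K0' by (simp add: divide_right_mono)
          also have "\<dots> = L / sqrt ?K" using K0' by (simp add: field_simps)
          finally have nu: "norm ?u \<le> L / sqrt ?K" .
          have "y \<le> norm ?u * r" unfolding y_def r_def by (rule Cauchy_Schwarz_ineq2)
          also have "\<dots> \<le> L / sqrt ?K * r" using nu by (intro mult_right_mono) (auto simp: r_def)
          finally have y: "0 \<le> y" "y \<le> L * r / sqrt ?K" by (simp_all add: y_def)
          have "?K * (6 * y\<^sup>2) \<le> ?K * (6 * (L * r / sqrt ?K)\<^sup>2)" using y by (intro mult_left_mono power_mono) auto
          also have "\<dots> = 6 * L\<^sup>2 * r\<^sup>2" using K0' by (simp add: power_mult_distrib power_divide)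
          finally have 1: "?K * (6 * y\<^sup>2) \<le> 6 * L\<^sup>2 * r\<^sup>2" .
          have "?K * y ^ 3 \<le> ?K * (L * r / sqrt ?K) ^ 3" using y by (intro mult_left_mono power_mono) auto
          also have "\<dots> = L ^ 3 * r ^ 3 / sqrt ?K" using K0' by (simp add: power_mult_distrib power_divide power3_eq_cube)
          finally have 2: "?K * y ^ 3 \<le> L ^ 3 * r ^ 3 / sqrt ?K" .
          have "?K * min (6 * y\<^sup>2) (y ^ 3) \<le> min (6 * L\<^sup>2 * r\<^sup>2) (L ^ 3 * r ^ 3 / sqrt ?K)"
            using 1 2 K0' by (simp add: min_mult_distrib_left min.coboundedI1 min.coboundedI2)
          then show "?K * min (6 * (?u \<bullet> (X w - \<mu>))\<^sup>2) (\<bar>?u \<bullet> (X w - \<mu>)\<bar> ^ 3) \<le> ?g n w"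
            by (simp only: y_def r_def power2_abs error_bound_def)
        qed simp
        finally show ?thesis .
      qed
      finally show "cmod (cchar ?u ^ K n - complex_of_real (exp (- (U n \<bullet> (\<Sigma> *v U n)) / (2 * ?K)))) \<le> ?err n"
        unfolding q_def[symmetric] ez by simp
    qed
  qed
qed

end

section \<open>From characteristic functions to the chi-square limit\<close>

abbreviation gauss_prod :: "nat \<Rightarrow> (nat \<Rightarrow> real) measure" where
  "gauss_prod d \<equiv> \<Pi>\<^sub>M i\<in>{..<d}. std_normal_distribution"

lemma finite_product_gauss: "finite_product_prob_space (\<lambda>_::nat. std_normal_distribution) {..<d}"
proof -
  have N: "prob_space std_normal_distribution" by (rule prob_space_normal_density) simp
  interpret product_prob_space "\<lambda>_::nat. std_normal_distribution" "{..<d}"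
    using N by (rule product_prob_spaceI)
  show ?thesis by unfold_locales simp
qed

lemma prob_space_gauss_prod: "prob_space (gauss_prod d)"
proof -
  interpret finite_product_prob_space "\<lambda>_::nat. std_normal_distribution" "{..<d}" by (rule finite_product_gauss)
  show ?thesis by unfold_locales
qed

lemma coord_measurable_gauss: "i < d \<Longrightarrow> (\<lambda>g. g i) \<in> borel_measurable (gauss_prod d)"
  using measurable_component_singleton[of i "{..<d}" "\<lambda>_. std_normal_distribution"] by simp

lemma sum_squares_measurable_gauss [measurable]:
  "(\<lambda>z. \<Sum>i<d. (z i)\<^sup>2) \<in> borel_measurable (gauss_prod d)"
  by (intro borel_measurable_sum borel_measurable_power coord_measurable_gauss) simp

lemma integral_iexp_gauss_prod:
  "(CLINT g|gauss_prod d. iexp (\<Sum>i<d. g i * t i)) = complex_of_real (exp (- (\<Sum>i<d. (t i)\<^sup>2) / 2))"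
proof -
  interpret finite_product_prob_space "\<lambda>_::nat. std_normal_distribution" "{..<d}" by (rule finite_product_gauss)
  have N: "prob_space std_normal_distribution" by (rule prob_space_normal_density) simp
  have "(CLINT g|gauss_prod d. iexp (\<Sum>i<d. g i * t i)) = (CLINT g|gauss_prod d. (\<Prod>i<d. iexp (t i * g i)))"
    by (simp add: sum_distrib_left exp_sum mult.commute)
  also have "\<dots> = (\<Prod>i<d. CLINT x|std_normal_distribution. iexp (t i * x))"
    by (rule product_integral_prod) (auto intro: prob_space.integrable_iexp[OF N])
  also have "\<dots> = (\<Prod>i<d. char std_normal_distribution (t i))" by (simp add: char_def)
  also have "\<dots> = complex_of_real (exp (- (\<Sum>i<d. (t i)\<^sup>2) / 2))"
    by (simp add: char_std_normal_distribution sum_divide_distrib exp_sum flip: sum_negf)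
  finally show ?thesis .
qed

lemma sum_product_measurable_gauss:
  assumes "\<And>i. i < d \<Longrightarrow> z i \<in> borel_measurable M"
  shows "(\<lambda>p. \<Sum>i<d. fst p i * z i (snd p)) \<in> borel_measurable (gauss_prod d \<Otimes>\<^sub>M M)"
proof (intro borel_measurable_sum borel_measurable_times)
  fix i assume i: "i \<in> {..<d}"
  then have "(\<lambda>g. g i) \<in> borel_measurable (gauss_prod d)" by (intro coord_measurable_gauss) simp
  then show "(\<lambda>p. fst p i) \<in> borel_measurable (gauss_prod d \<Otimes>\<^sub>M M)"
    by (rule measurable_compose[OF measurable_fst])
  show "(\<lambda>p. z i (snd p)) \<in> borel_measurable (gauss_prod d \<Otimes>\<^sub>M M)"
    using assms i by (intro measurable_compose[OF measurable_snd]) auto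
qed

text \<open>For fixed \<open>z\<close>, the Gaussian integral of \<open>iexp (g \<bullet> z)\<close> over \<open>g\<close> is \<open>exp (- \<bar>z\<bar>\<^sup>2 / 2)\<close>. Exchanging the
  integrals expresses the Laplace transform of a sum of squares by the characteristic function of
  the vector.\<close>

lemma gaussian_randomisation:
  assumes "prob_space M" and z: "\<And>i. i < d \<Longrightarrow> z i \<in> borel_measurable M"
  shows "complex_of_real (LINT w|M. exp (- (\<Sum>i<d. (z i w)\<^sup>2) / 2)) =
    (CLINT g|gauss_prod d. (CLINT w|M. iexp (\<Sum>i<d. g i * z i w)))"
proof -
  interpret M: prob_space M by fact
  interpret G: prob_space "gauss_prod d" by (rule prob_space_gauss_prod)
  interpret pair_prob_space "gauss_prod d" M ..
  note [measurable] = sum_product_measurable_gauss[OF z]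
  have "(\<lambda>p. iexp (\<Sum>i<d. fst p i * z i (snd p))) \<in> borel_measurable (gauss_prod d \<Otimes>\<^sub>M M)"
    by measurable
  then have int: "integrable (gauss_prod d \<Otimes>\<^sub>M M) (\<lambda>(g, w). iexp (\<Sum>i<d. g i * z i w))"
    by (intro P.integrable_const_bound[where B = 1]) (auto simp: case_prod_beta)
  have "(CLINT g|gauss_prod d. (CLINT w|M. iexp (\<Sum>i<d. g i * z i w))) =
      (CLINT w|M. (CLINT g|gauss_prod d. iexp (\<Sum>i<d. g i * z i w)))"
    using Fubini_integral[OF int] by simp
  also have "\<dots> = (CLINT w|M. complex_of_real (exp (- (\<Sum>i<d. (z i w)\<^sup>2) / 2)))"
    by (simp only: integral_iexp_gauss_prod)
  also have "\<dots> = complex_of_real (LINT w|M. exp (- (\<Sum>i<d. (z i w)\<^sup>2) / 2))" by simp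
  finally show ?thesis ..
qed

lemma laplace_limit:
  assumes M: "\<And>k. prob_space (M k)" and z: "\<And>k i. i < d \<Longrightarrow> z k i \<in> borel_measurable (M k)"
    and lim: "\<And>g. (\<lambda>k. CLINT w|M k. iexp (\<Sum>i<d. g i * z k i w)) \<longlonglongrightarrow> complex_of_real (exp (- (\<Sum>i<d. (g i)\<^sup>2) / 2))"
    and a: "0 \<le> a"
  shows "(\<lambda>k. LINT w|M k. exp (- a * (\<Sum>i<d. (z k i w)\<^sup>2) / 2)) \<longlonglongrightarrow> (LINT g|gauss_prod d. exp (- a * (\<Sum>i<d. (g i)\<^sup>2) / 2))"
proof -
  interpret G: prob_space "gauss_prod d" by (rule prob_space_gauss_prod)
  let ?s = "sqrt a"
  have eq: "- a * (\<Sum>i<d. (f i)\<^sup>2) / 2 = - (\<Sum>i<d. (?s * f i)\<^sup>2) / 2" for f :: "nat \<Rightarrow> real"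
    using a by (simp add: power_mult_distrib sum_distrib_left sum_negf)
  let ?l = "\<lambda>g. complex_of_real (exp (- (\<Sum>i<d. (?s * g i)\<^sup>2) / 2))"
  let ?h = "\<lambda>k g. CLINT w|M k. iexp (\<Sum>i<d. g i * (?s * z k i w))"
  have 1: "complex_of_real (LINT w|M k. exp (- a * (\<Sum>i<d. (z k i w)\<^sup>2) / 2)) = (CLINT g|gauss_prod d. ?h k g)" for k
    unfolding eq by (rule gaussian_randomisation[OF M]) (use z in auto)
  have "(\<lambda>k. CLINT g|gauss_prod d. ?h k g) \<longlonglongrightarrow> (CLINT g|gauss_prod d. ?l g)"
  proof (rule integral_dominated_convergence[where w = "\<lambda>_. 1"])
    show "AE g in gauss_prod d. (\<lambda>k. ?h k g) \<longlonglongrightarrow> ?l g"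
    proof (rule AE_I2)
      fix g :: "nat \<Rightarrow> real"
      show "(\<lambda>k. ?h k g) \<longlonglongrightarrow> ?l g"
        using lim[of "\<lambda>i. ?s * g i"] by (simp add: mult_ac)
    qed
    show "AE g in gauss_prod d. cmod (?h k g) \<le> 1" for k
    proof (rule AE_I2)
      fix g :: "nat \<Rightarrow> real"
      interpret Mk: prob_space "M k" by (rule M)
      have "cmod (?h k g) \<le> (LINT w|M k. cmod (iexp (\<Sum>i<d. g i * (?s * z k i w))))" by (rule integral_norm_bound)
      then show "cmod (?h k g) \<le> 1" by (simp add: Mk.prob_space)
    qed
    show "?h k \<in> borel_measurable (gauss_prod d)" for k
    proof -
      interpret Mk: prob_space "M k" by (rule M)
      have [measurable]: "(\<lambda>p. \<Sum>i<d. fst p i * (?s * z k i (snd p))) \<in> borel_measurable (gauss_prod d \<Otimes>\<^sub>M M k)"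
        using z by (intro sum_product_measurable_gauss[where z = "\<lambda>i w. ?s * z k i w"]) simp
      have "(\<lambda>(g, w). iexp (\<Sum>i<d. g i * (?s * z k i w))) \<in> borel_measurable (gauss_prod d \<Otimes>\<^sub>M M k)"
        unfolding case_prod_beta by measurable
      then show ?thesis by (rule Mk.borel_measurable_lebesgue_integral)
    qed
    have [measurable]: "(\<lambda>g. \<Sum>i<d. (?s * g i)\<^sup>2) \<in> borel_measurable (gauss_prod d)"
      by (intro borel_measurable_sum borel_measurable_power borel_measurable_times borel_measurable_const coord_measurable_gauss) simp
    show "?l \<in> borel_measurable (gauss_prod d)"
      by measurable
  qed simp
  moreover have "(CLINT g|gauss_prod d. ?l g) =
      complex_of_real (LINT g|gauss_prod d. exp (- a * (\<Sum>i<d. (g i)\<^sup>2) / 2))"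
    unfolding eq by simp
  ultimately have "(\<lambda>k. complex_of_real (LINT w|M k. exp (- a * (\<Sum>i<d. (z k i w)\<^sup>2) / 2))) \<longlonglongrightarrow>
      complex_of_real (LINT g|gauss_prod d. exp (- a * (\<Sum>i<d. (g i)\<^sup>2) / 2))"
    unfolding 1 by (simp only:)
  then show ?thesis by (simp only: tendsto_of_real_iff)
qed

text \<open>On the unit interval polynomials are uniformly dense, so convergence of moments gives convergence of
  the integrals of all continuous functions.\<close>

lemma moments_determine_limit:
  fixes E :: "nat \<Rightarrow> 'a \<Rightarrow> real" and F :: "'c \<Rightarrow> real" and f :: "real \<Rightarrow> real"
  assumes M: "\<And>k. prob_space (M k)" and N: "prob_space N"
    and E: "\<And>k. E k \<in> borel_measurable (M k)" "\<And>k w. E k w \<in> {0..1}"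
    and F: "F \<in> borel_measurable N" "\<And>w. F w \<in> {0..1}"
    and mom: "\<And>j::nat. (\<lambda>k. LINT w|M k. E k w ^ j) \<longlonglongrightarrow> (LINT w|N. F w ^ j)"
    and f: "continuous_on {0..1} f" "f \<in> borel_measurable borel"
  shows "(\<lambda>k. LINT w|M k. f (E k w)) \<longlonglongrightarrow> (LINT w|N. f (F w))"
proof -
  obtain B where B: "\<And>t. t \<in> {0..1} \<Longrightarrow> \<bar>f t\<bar> \<le> B"
  proof -
    have "compact (f ` {0..1})" using f by (intro compact_continuous_image) auto
    then have "bounded (f ` {0..1})" by (rule compact_imp_bounded)
    then obtain a where "\<forall>y\<in>f ` {0..1}. norm y \<le> a" unfolding bounded_iff by blast
    then show thesis by (intro that[of a]) auto
  qed
  have intf: "integrable L (\<lambda>w. f (h w))" if "prob_space L" "h \<in> borel_measurable L" "\<And>w. h w \<in> {0..1}" for L :: "'x measure" and h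
  proof -
    interpret L: prob_space L by fact
    show ?thesis using that f B by (intro L.integrable_const_bound[where B = B]) auto
  qed
  have intp: "integrable L (\<lambda>w. h w ^ j)" if "prob_space L" "h \<in> borel_measurable L" "\<And>w. h w \<in> {0..1::real}" for L :: "'x measure" and h j
  proof -
    interpret L: prob_space L by fact
    show ?thesis using that by (intro L.integrable_const_bound[where B = 1]) (auto simp: abs_le_iff power_le_one intro: order_trans[of _ 0])
  qed
  show ?thesis
  proof (rule LIMSEQ_I)
    fix e :: real assume e: "0 < e"
    obtain g where g: "real_polynomial_function g" "\<And>t. t \<in> {0..1} \<Longrightarrow> \<bar>f t - g t\<bar> < e / 3"
      using Stone_Weierstrass_real_polynomial_function[OF compact_Icc f(1), of "e / 3"] e by auto
    then obtain a K where ga: "g = (\<lambda>x. \<Sum>i\<le>K. a i * x ^ i)"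
      unfolding real_polynomial_function_iff_sum by (metis (no_types))
    have gint: "integrable L (\<lambda>w. g (h w))" "(LINT w|L. g (h w)) = (\<Sum>i\<le>K. a i * (LINT w|L. h w ^ i))"
      if "prob_space L" "h \<in> borel_measurable L" "\<And>w. h w \<in> {0..1}" for L :: "'x measure" and h
      unfolding ga using intp[OF that] by (auto intro!: Bochner_Integration.integrable_sum)
    have close: "\<bar>(LINT w|L. f (h w)) - (LINT w|L. g (h w))\<bar> \<le> e / 3"
      if "prob_space L" "h \<in> borel_measurable L" "\<And>w. h w \<in> {0..1}" for L :: "'x measure" and h
    proof -
      interpret L: prob_space L by fact
      have "\<bar>(LINT w|L. f (h w)) - (LINT w|L. g (h w))\<bar> = \<bar>LINT w|L. f (h w) - g (h w)\<bar>"
        using intf[OF that] gint[OF that] by simp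
      also have "\<dots> \<le> (LINT w|L. \<bar>f (h w) - g (h w)\<bar>)" by (rule integral_abs_bound)
      also have "\<dots> \<le> (LINT w|L. e / 3)"
        using intf[OF that] gint[OF that] g(2)[OF that(3)]
        by (intro integral_mono integrable_abs Bochner_Integration.integrable_diff) (auto simp: less_imp_le)
      finally show ?thesis by (simp add: L.prob_space)
    qed
    have "(\<lambda>k. LINT w|M k. g (E k w)) \<longlonglongrightarrow> (LINT w|N. g (F w))"
      unfolding gint(2)[OF M E] gint(2)[OF N F] by (intro tendsto_sum tendsto_mult tendsto_const mom)
    from LIMSEQ_D[OF this, of "e / 3"] e obtain k0 where k0: "\<And>k. k0 \<le> k \<Longrightarrow> \<bar>(LINT w|M k. g (E k w)) - (LINT w|N. g (F w))\<bar> < e / 3"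
      by auto
    show "\<exists>no. \<forall>k\<ge>no. norm ((LINT w|M k. f (E k w)) - (LINT w|N. f (F w))) < e"
    proof (intro exI[of _ k0] allI impI)
      fix k assume "k0 \<le> k"
      with k0[OF this] close[OF M E, of k] close[OF N F] show "norm ((LINT w|M k. f (E k w)) - (LINT w|N. f (F w))) < e"
        unfolding real_norm_def by linarith
    qed
  qed
qed

text \<open>\<^const>\<open>cts_step\<close> at \<open>z\<close> is a continuous function of \<open>exp (- z / 2)\<close>: it vanishes beyond \<open>y\<close>, so
  truncating the logarithm at \<open>y\<close> changes nothing and removes the singularity at zero.\<close>

lemma cts_step_exp:
  assumes "x < y"
  defines "f \<equiv> \<lambda>t. cts_step x y (- 2 * ln (max t (exp (- y / 2))))"
  shows "continuous_on UNIV f" "f (exp (- z / 2)) = cts_step x y z"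
proof -
  have c: "continuous_on UNIV (cts_step x y)"
    by (rule uniformly_continuous_imp_continuous) (rule cts_step_uniformly_continuous[OF assms(1)])
  have "max t (exp (- y / 2)) \<noteq> 0" for t using exp_gt_zero[of "- y / 2"] by linarith
  then have "continuous_on UNIV (\<lambda>t. - 2 * ln (max t (exp (- y / 2))))"
    by (intro continuous_intros) auto
  then show "continuous_on UNIV f"
    unfolding f_def by (rule continuous_on_compose2[OF c]) auto
  have "max (exp (- z / 2)) (exp (- y / 2)) = exp (- min z y / 2)" by (simp add: max_def min_def)
  then have "f (exp (- z / 2)) = cts_step x y (min z y)" by (simp add: f_def)
  also have "\<dots> = cts_step x y z" using assms(1) by (simp add: cts_step_def min_def)
  finally show "f (exp (- z / 2)) = cts_step x y z" .
qed

lemma real_distribution_chi_square: "real_distribution (chi_square d)"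
proof -
  interpret G: prob_space "gauss_prod d" by (rule prob_space_gauss_prod)
  show ?thesis unfolding chi_square_def by (rule G.real_distribution_distr) simp
qed

text \<open>Moments of \<open>exp (- Z / 2)\<close> are values of the Laplace transform of \<open>Z\<close> at the natural numbers.\<close>

lemma cts_step_chi_square_limit:
  assumes M: "\<And>k. prob_space (M k)" and z: "\<And>k i. i < d \<Longrightarrow> z k i \<in> borel_measurable (M k)"
    and lim: "\<And>g. (\<lambda>k. CLINT w|M k. iexp (\<Sum>i<d. g i * z k i w)) \<longlonglongrightarrow> complex_of_real (exp (- (\<Sum>i<d. (g i)\<^sup>2) / 2))"
    and xy: "x < y"
  shows "(\<lambda>k. LINT w|M k. cts_step x y (\<Sum>i<d. (z k i w)\<^sup>2)) \<longlonglongrightarrow> (LINT t|chi_square d. cts_step x y t)"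
proof -
  let ?f = "\<lambda>t. cts_step x y (- 2 * ln (max t (exp (- y / 2))))"
  note f = cts_step_exp[OF xy]
  have pow: "exp (- s / 2) ^ j = exp (- real j * s / 2)" for s :: real and j
    by (simp flip: exp_of_nat_mult)
  have "(\<lambda>k. LINT w|M k. ?f (exp (- (\<Sum>i<d. (z k i w)\<^sup>2) / 2))) \<longlonglongrightarrow> (LINT g|gauss_prod d. ?f (exp (- (\<Sum>i<d. (g i)\<^sup>2) / 2)))"
  proof (rule moments_determine_limit[where f = ?f and E = "\<lambda>k w. exp (- (\<Sum>i<d. (z k i w)\<^sup>2) / 2)"
        and F = "\<lambda>g. exp (- (\<Sum>i<d. (g i)\<^sup>2) / 2)", OF M prob_space_gauss_prod])
    show "(\<lambda>w. exp (- (\<Sum>i<d. (z k i w)\<^sup>2) / 2)) \<in> borel_measurable (M k)" for k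
    proof -
      have [measurable]: "(\<lambda>w. \<Sum>i<d. (z k i w)\<^sup>2) \<in> borel_measurable (M k)"
        using z by (intro borel_measurable_sum borel_measurable_power) simp
      show ?thesis by measurable
    qed
    show "(\<lambda>g. exp (- (\<Sum>i<d. (g i)\<^sup>2) / 2)) \<in> borel_measurable (gauss_prod d)" by measurable
    show "(\<lambda>k. LINT w|M k. exp (- (\<Sum>i<d. (z k i w)\<^sup>2) / 2) ^ j) \<longlonglongrightarrow> (LINT g|gauss_prod d. exp (- (\<Sum>i<d. (g i)\<^sup>2) / 2) ^ j)" for j
      unfolding pow by (rule laplace_limit[OF M z lim]) auto
    show "continuous_on {0..1} ?f" using f(1) by (rule continuous_on_subset) simp
    show "?f \<in> borel_measurable borel" using f(1) by (rule borel_measurable_continuous_onI)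
  qed (auto simp: sum_nonneg)
  then have "(\<lambda>k. LINT w|M k. cts_step x y (\<Sum>i<d. (z k i w)\<^sup>2)) \<longlonglongrightarrow> (LINT g|gauss_prod d. cts_step x y (\<Sum>i<d. (g i)\<^sup>2))"
    unfolding f(2) .
  moreover have "cts_step x y \<in> borel_measurable borel"
    by (intro borel_measurable_continuous_onI uniformly_continuous_imp_continuous cts_step_uniformly_continuous xy)
  then have "(LINT t|chi_square d. cts_step x y t) = (LINT g|gauss_prod d. cts_step x y (\<Sum>i<d. (g i)\<^sup>2))"
    unfolding chi_square_def by (subst integral_distr) auto
  ultimately show ?thesis by simp
qed

section \<open>A weak law of large numbers for integrable variables\<close>

lemma (in prob_space) indep_vars_inj_reindex:
  assumes inj: "inj_on f K" and ind: "indep_vars (\<lambda>_. N) X (f ` K)"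
  shows "indep_vars (\<lambda>_. N) (\<lambda>i. X (f i)) K"
  unfolding indep_vars_def2
proof (intro conjI ballI)
  show "random_variable N (X (f i))" if "i \<in> K" for i
    using ind that by (auto simp: indep_vars_def2)
  have is0: "indep_sets (\<lambda>i. {X i -` A \<inter> space M |A. A \<in> sets N}) (f ` K)"
    using ind by (auto simp: indep_vars_def2)
  show "indep_sets (\<lambda>i. {X (f i) -` A \<inter> space M |A. A \<in> sets N}) K"
    unfolding indep_sets_def
  proof (intro conjI ballI allI impI)
    show "{X (f i) -` A \<inter> space M |A. A \<in> sets N} \<subseteq> events" if "i \<in> K" for i
      using is0 that by (auto simp: indep_sets_def)
    fix J A assume J: "J \<subseteq> K" "J \<noteq> {}" "finite J" and A: "A \<in> (\<Pi> i\<in>J. {X (f i) -` A \<inter> space M |A. A \<in> sets N})"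
    have injJ: "inj_on f J" using inj J(1) by (rule inj_on_subset)
    let ?A = "\<lambda>i. A (the_inv_into J f i)"
    have A': "?A (f j) = A j" if "j \<in> J" for j using that injJ by (simp add: the_inv_into_f_f)
    have "prob (\<Inter>i\<in>f ` J. ?A i) = (\<Prod>i\<in>f ` J. prob (?A i))"
    proof (rule indep_setsD[OF is0])
      show "\<forall>i\<in>f ` J. ?A i \<in> {X i -` A \<inter> space M |A. A \<in> sets N}" using A A' by (auto simp: Pi_iff)
    qed (use J in auto)
    then show "prob (\<Inter>j\<in>J. A j) = (\<Prod>j\<in>J. prob (A j))"
      using A' by (simp add: prod.reindex[OF injJ])
  qed
qed

lemma same_law_integral:
  fixes h :: "'c::topological_space \<Rightarrow> 'e::{banach, second_countable_topology}"
  assumes "distr M borel X = distr P borel Y" "X \<in> borel_measurable M" "Y \<in> borel_measurable P" "h \<in> borel_measurable borel"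
  shows "(LINT w|M. h (X w)) = (LINT w|P. h (Y w))" "integrable M (\<lambda>w. h (X w)) \<longleftrightarrow> integrable P (\<lambda>w. h (Y w))"
  using integral_distr[OF assms(2,4)] integral_distr[OF assms(3,4)]
    integrable_distr_eq[OF assms(2,4)] integrable_distr_eq[OF assms(3,4)] assms(1) by simp_all

text \<open>Off-diagonal terms vanish by independence.\<close>

lemma (in prob_space) sum_independent_second_moment:
  fixes \<xi> :: "'i \<Rightarrow> 'a \<Rightarrow> real"
  assumes ind: "indep_vars (\<lambda>_. borel) \<xi> I" and I: "finite I"
    and bound: "\<And>i w. i \<in> I \<Longrightarrow> \<bar>\<xi> i w\<bar> \<le> C" and mean: "\<And>i. i \<in> I \<Longrightarrow> expectation (\<xi> i) = 0"
  shows "expectation (\<lambda>w. (\<Sum>i\<in>I. \<xi> i w)\<^sup>2) \<le> real (card I) * C\<^sup>2"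
    and "integrable M (\<lambda>w. (\<Sum>i\<in>I. \<xi> i w)\<^sup>2)"
proof -
  have [measurable]: "\<And>i. i \<in> I \<Longrightarrow> \<xi> i \<in> borel_measurable M" using ind by (auto simp: indep_vars_def2)
  have int: "integrable M (\<xi> i)" if "i \<in> I" for i
    using that bound by (intro integrable_const_bound[where B = C]) auto
  have int2: "integrable M (\<lambda>w. \<xi> i w * \<xi> j w)" if "i \<in> I" "j \<in> I" for i j
  proof (rule integrable_const_bound[where B = "C * C"])
    show "AE w in M. norm (\<xi> i w * \<xi> j w) \<le> C * C"
    proof (rule AE_I2)
      fix w
      have "\<bar>\<xi> i w\<bar> * \<bar>\<xi> j w\<bar> \<le> C * C"
        using bound[OF that(1)] bound[OF that(2)] by (intro mult_mono) (auto intro: order_trans[OF abs_ge_zero])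
      then show "norm (\<xi> i w * \<xi> j w) \<le> C * C" by (simp add: abs_mult)
    qed
  qed (use that in measurable)
  have sq: "(\<Sum>i\<in>I. \<xi> i w)\<^sup>2 = (\<Sum>i\<in>I. \<Sum>j\<in>I. \<xi> i w * \<xi> j w)" for w by (simp add: power2_eq_square sum_product)
  show "integrable M (\<lambda>w. (\<Sum>i\<in>I. \<xi> i w)\<^sup>2)" unfolding sq by (intro Bochner_Integration.integrable_sum int2)
  have off: "expectation (\<lambda>w. \<xi> i w * \<xi> j w) = 0" if "i \<in> I" "j \<in> I" "i \<noteq> j" for i j
  proof -
    have "expectation (\<lambda>w. \<Prod>l\<in>{i, j}. \<xi> l w) = (\<Prod>l\<in>{i, j}. expectation (\<xi> l))"
      using that int by (intro indep_vars_lebesgue_integral indep_vars_subset[OF ind]) auto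
    then show ?thesis using that mean by simp
  qed
  have "expectation (\<lambda>w. (\<Sum>i\<in>I. \<xi> i w)\<^sup>2) = (\<Sum>i\<in>I. \<Sum>j\<in>I. expectation (\<lambda>w. \<xi> i w * \<xi> j w))"
    unfolding sq by (simp add: Bochner_Integration.integral_sum int2 Bochner_Integration.integrable_sum)
  also have "\<dots> = (\<Sum>i\<in>I. \<Sum>j\<in>I. if j = i then expectation (\<lambda>w. \<xi> i w * \<xi> i w) else 0)"
    by (intro sum.cong refl) (auto simp: off)
  also have "\<dots> = (\<Sum>i\<in>I. expectation (\<lambda>w. \<xi> i w * \<xi> i w))" using I by simp
  also have "\<dots> \<le> (\<Sum>i\<in>I. C\<^sup>2)"
  proof (rule sum_mono)
    fix i assume i: "i \<in> I"
    have "expectation (\<lambda>w. \<xi> i w * \<xi> i w) \<le> expectation (\<lambda>w. C\<^sup>2)"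
    proof (rule integral_mono[OF int2[OF i i]])
      fix w
      have "\<bar>\<xi> i w\<bar>\<^sup>2 \<le> C\<^sup>2" using bound[OF i] by (intro power_mono) auto
      then show "\<xi> i w * \<xi> i w \<le> C\<^sup>2" by (simp add: power2_eq_square)
    qed simp
    then show "expectation (\<lambda>w. \<xi> i w * \<xi> i w) \<le> C\<^sup>2" by (simp add: prob_space)
  qed
  finally show "expectation (\<lambda>w. (\<Sum>i\<in>I. \<xi> i w)\<^sup>2) \<le> real (card I) * C\<^sup>2" by simp
qed

text \<open>Only a first moment is assumed, so each variable is split at height \<open>c\<close>: the bounded part is handled
  by second moments, the remainder by its mean absolute value. The bound holds for every \<open>c\<close>.\<close>

lemma (in prob_space) truncated_weak_law:
  fixes \<xi> :: "nat \<Rightarrow> 'a \<Rightarrow> real" and Y :: "'b \<Rightarrow> real"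
  assumes ind: "indep_vars (\<lambda>_. borel) \<xi> {..<k}" and k: "0 < k"
    and P: "prob_space P" and Y: "integrable P Y"
    and law: "\<And>i. i < k \<Longrightarrow> distr M borel (\<xi> i) = distr P borel Y"
    and c: "0 \<le> c" and e: "0 < e"
  shows "prob {w\<in>space M. e \<le> \<bar>(\<Sum>i<k. \<xi> i w) / real k - (LINT w|P. Y w)\<bar>} \<le>
    16 * c\<^sup>2 / (real k * e\<^sup>2) + 4 * (LINT w|P. (if \<bar>Y w\<bar> \<le> c then 0 else \<bar>Y w\<bar>)) / e"
proof -
  interpret P: prob_space P by fact
  have [measurable]: "Y \<in> borel_measurable P" using Y by auto
  have \<xi>m[measurable]: "\<xi> i \<in> borel_measurable M" if "i < k" for i using ind that by (auto simp: indep_vars_def2)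
  define \<tau> where "\<tau> t = (if \<bar>t\<bar> \<le> c then t else 0)" for t :: real
  define \<rho> where "\<rho> t = (if \<bar>t\<bar> \<le> c then 0 else t)" for t :: real
  have [measurable]: "\<tau> \<in> borel_measurable borel" "\<rho> \<in> borel_measurable borel" unfolding \<tau>_def[abs_def] \<rho>_def[abs_def] by measurable
  have \<tau>\<rho>: "t = \<tau> t + \<rho> t" for t by (simp add: \<tau>_def \<rho>_def)
  have \<tau>c: "\<bar>\<tau> t\<bar> \<le> c" for t using c by (simp add: \<tau>_def)
  have int\<tau>: "integrable P (\<lambda>w. \<tau> (Y w))" by (rule P.integrable_const_bound[where B = c]) (auto simp: \<tau>c)
  have int\<rho>: "integrable P (\<lambda>w. \<rho> (Y w))"
    by (rule Bochner_Integration.integrable_bound[OF Y]) (auto simp: \<rho>_def)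
  define a where "a = (LINT w|P. \<tau> (Y w))"
  define b where "b = (LINT w|P. \<rho> (Y w))"
  define r where "r = (LINT w|P. \<bar>\<rho> (Y w)\<bar>)"
  have ab: "(LINT w|P. Y w) = a + b"
    unfolding a_def b_def by (subst Bochner_Integration.integral_add[symmetric, OF int\<tau> int\<rho>]) (simp flip: \<tau>\<rho>)
  have ac: "\<bar>a\<bar> \<le> c"
  proof -
    have "\<bar>a\<bar> \<le> (LINT w|P. \<bar>\<tau> (Y w)\<bar>)" unfolding a_def by (rule integral_abs_bound)
    also have "\<dots> \<le> (LINT w|P. c)" using int\<tau> by (intro integral_mono) (auto simp: \<tau>c)
    finally show ?thesis by (simp add: P.prob_space)
  qed
  have br: "\<bar>b\<bar> \<le> r" unfolding b_def r_def by (rule integral_abs_bound)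
  have law1: "expectation (\<lambda>w. h (\<xi> i w)) = (LINT w|P. h (Y w))" "integrable M (\<lambda>w. h (\<xi> i w)) \<longleftrightarrow> integrable P (\<lambda>w. h (Y w))"
    if "i < k" "h \<in> borel_measurable borel" for i and h :: "real \<Rightarrow> real"
    using same_law_integral[OF law[OF that(1)] \<xi>m[OF that(1)] _ that(2)] by simp_all
  define A where "A w = (\<Sum>i<k. \<tau> (\<xi> i w) - a)" for w
  define B where "B w = (\<Sum>i<k. \<rho> (\<xi> i w) - b)" for w
  have Am[measurable]: "A \<in> borel_measurable M" "B \<in> borel_measurable M" unfolding A_def[abs_def] B_def[abs_def] by measurable
  have AB: "(\<Sum>i<k. \<xi> i w) / real k - (LINT w|P. Y w) = A w / real k + B w / real k" for w
  proof -
    have "(\<Sum>i<k. \<xi> i w) - real k * (a + b) = A w + B w"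
      unfolding A_def B_def sum.distrib[symmetric] by (subst \<tau>\<rho>) (simp add: sum.distrib sum_subtractf algebra_simps)
    then show ?thesis using k unfolding ab by (simp add: field_simps)
  qed
  have indA: "indep_vars (\<lambda>_. borel) (\<lambda>i w. \<tau> (\<xi> i w) - a) {..<k}"
    by (rule indep_vars_compose2[OF ind]) measurable
  have bA: "\<bar>\<tau> (\<xi> i w) - a\<bar> \<le> 2 * c" for i w using \<tau>c[of "\<xi> i w"] ac by linarith
  have mA: "expectation (\<lambda>w. \<tau> (\<xi> i w) - a) = 0" if "i \<in> {..<k}" for i
    using that law1(1)[of i \<tau>] law1(2)[of i \<tau>] int\<tau> by (simp add: a_def prob_space)
  have A2: "expectation (\<lambda>w. (A w)\<^sup>2) \<le> real k * (2 * c)\<^sup>2" "integrable M (\<lambda>w. (A w)\<^sup>2)"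
    using sum_independent_second_moment[OF indA finite_lessThan bA mA] by (simp_all add: A_def)
  have PA: "prob {w\<in>space M. (real k * e / 2)\<^sup>2 \<le> (A w)\<^sup>2} \<le> 16 * c\<^sup>2 / (real k * e\<^sup>2)"
  proof -
    have "prob {w\<in>space M. (real k * e / 2)\<^sup>2 \<le> (A w)\<^sup>2} \<le> expectation (\<lambda>w. (A w)\<^sup>2) / (real k * e / 2)\<^sup>2"
      using k e by (intro integral_Markov_inequality_measure[OF A2(2), of "{}"]) auto
    also have "\<dots> \<le> real k * (2 * c)\<^sup>2 / (real k * e / 2)\<^sup>2" by (intro divide_right_mono A2) simp
    also have "\<dots> = 16 * c\<^sup>2 / (real k * e\<^sup>2)" using k e by (simp add: field_simps power2_eq_square)
    finally show ?thesis .
  qed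
  have int\<rho>': "integrable M (\<lambda>w. \<bar>\<rho> (\<xi> i w) - b\<bar>)" if "i \<in> {..<k}" for i
    using that law1(2)[of i \<rho>] int\<rho> by (intro integrable_abs Bochner_Integration.integrable_diff) auto
  have intB: "integrable M (\<lambda>w. \<bar>B w\<bar>)"
    unfolding B_def using law1(2)[of _ \<rho>] int\<rho>
    by (intro integrable_abs Bochner_Integration.integrable_sum Bochner_Integration.integrable_diff) auto
  have "expectation (\<lambda>w. \<bar>B w\<bar>) \<le> expectation (\<lambda>w. \<Sum>i<k. \<bar>\<rho> (\<xi> i w) - b\<bar>)"
    unfolding B_def[abs_def] by (intro integral_mono[OF intB[unfolded B_def]] Bochner_Integration.integrable_sum int\<rho>' sum_abs)
  also have "\<dots> = (\<Sum>i<k. expectation (\<lambda>w. \<bar>\<rho> (\<xi> i w) - b\<bar>))"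
    by (intro Bochner_Integration.integral_sum int\<rho>')
  also have "\<dots> \<le> (\<Sum>i<k. 2 * r)"
  proof (rule sum_mono)
    fix i assume i: "i \<in> {..<k}"
    have "expectation (\<lambda>w. \<bar>\<rho> (\<xi> i w) - b\<bar>) = (LINT w|P. \<bar>\<rho> (Y w) - b\<bar>)"
      using i by (intro law1(1)[of i "\<lambda>t. \<bar>\<rho> t - b\<bar>"]) auto
    also have "\<dots> \<le> (LINT w|P. \<bar>\<rho> (Y w)\<bar> + \<bar>b\<bar>)"
      using int\<rho> by (intro integral_mono integrable_abs Bochner_Integration.integrable_diff Bochner_Integration.integrable_add) auto
    also have "\<dots> = r + \<bar>b\<bar>" using int\<rho> by (simp add: r_def P.prob_space)
    finally show "expectation (\<lambda>w. \<bar>\<rho> (\<xi> i w) - b\<bar>) \<le> 2 * r" using br by simp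
  qed
  finally have EB: "expectation (\<lambda>w. \<bar>B w\<bar>) \<le> real k * (2 * r)" by simp
  have PB: "prob {w\<in>space M. real k * e / 2 \<le> \<bar>B w\<bar>} \<le> 4 * r / e"
  proof -
    have "prob {w\<in>space M. real k * e / 2 \<le> \<bar>B w\<bar>} \<le> expectation (\<lambda>w. \<bar>B w\<bar>) / (real k * e / 2)"
      using k e by (intro integral_Markov_inequality_measure[OF intB, of "{}"]) auto
    also have "\<dots> \<le> real k * (2 * r) / (real k * e / 2)" using k e by (intro divide_right_mono EB) simp
    also have "\<dots> = 4 * r / e" using k e by (simp add: field_simps)
    finally show ?thesis .
  qed
  have "prob {w\<in>space M. e \<le> \<bar>(\<Sum>i<k. \<xi> i w) / real k - (LINT w|P. Y w)\<bar>} \<le>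
      prob ({w\<in>space M. (real k * e / 2)\<^sup>2 \<le> (A w)\<^sup>2} \<union> {w\<in>space M. real k * e / 2 \<le> \<bar>B w\<bar>})"
  proof (rule finite_measure_mono)
    show "{w\<in>space M. e \<le> \<bar>(\<Sum>i<k. \<xi> i w) / real k - (LINT w|P. Y w)\<bar>} \<subseteq>
      {w\<in>space M. (real k * e / 2)\<^sup>2 \<le> (A w)\<^sup>2} \<union> {w\<in>space M. real k * e / 2 \<le> \<bar>B w\<bar>}"
    proof (intro subsetI, rule ccontr)
      fix w assume w: "w \<in> {w\<in>space M. e \<le> \<bar>(\<Sum>i<k. \<xi> i w) / real k - (LINT w|P. Y w)\<bar>}"
        and "w \<notin> {w\<in>space M. (real k * e / 2)\<^sup>2 \<le> (A w)\<^sup>2} \<union> {w\<in>space M. real k * e / 2 \<le> \<bar>B w\<bar>}"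
      then have 1: "(A w)\<^sup>2 < (real k * e / 2)\<^sup>2" "\<bar>B w\<bar> < real k * e / 2" by auto
      have "\<bar>A w\<bar> < real k * e / 2"
      proof (rule ccontr)
        assume "\<not> \<bar>A w\<bar> < real k * e / 2"
        then have "(real k * e / 2)\<^sup>2 \<le> \<bar>A w\<bar>\<^sup>2" using k e by (intro power_mono) auto
        with 1 show False by simp
      qed
      with 1 have "\<bar>A w + B w\<bar> < real k * e" by linarith
      then have "\<bar>A w / real k + B w / real k\<bar> < e"
        using k by (simp add: add_divide_distrib[symmetric] field_simps)
      with w show False unfolding AB by simp
    qed
  qed measurable
  also have "\<dots> \<le> prob {w\<in>space M. (real k * e / 2)\<^sup>2 \<le> (A w)\<^sup>2} + prob {w\<in>space M. real k * e / 2 \<le> \<bar>B w\<bar>}"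
    by (rule measure_Un_le) measurable
  also have "\<dots> \<le> 16 * c\<^sup>2 / (real k * e\<^sup>2) + 4 * r / e" by (intro add_mono PA PB)
  also have "r = (LINT w|P. (if \<bar>Y w\<bar> \<le> c then 0 else \<bar>Y w\<bar>))"
    unfolding r_def \<rho>_def by (intro Bochner_Integration.integral_cong) auto
  finally show ?thesis .
qed

lemma tail_integral_vanishes:
  fixes Y :: "'b \<Rightarrow> real"
  assumes Y: "integrable P Y" and c: "filterlim c at_top sequentially"
  shows "(\<lambda>n. LINT w|P. (if \<bar>Y w\<bar> \<le> c n then 0 else \<bar>Y w\<bar>)) \<longlonglongrightarrow> 0"
proof -
  have [measurable]: "Y \<in> borel_measurable P" using Y by auto
  have "(\<lambda>n. LINT w|P. (if \<bar>Y w\<bar> \<le> c n then 0 else \<bar>Y w\<bar>)) \<longlonglongrightarrow> (LINT w|P. 0)"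
  proof (rule integral_dominated_convergence[where w = "\<lambda>w. \<bar>Y w\<bar>"])
    show "AE w in P. (\<lambda>n. if \<bar>Y w\<bar> \<le> c n then 0 else \<bar>Y w\<bar>) \<longlonglongrightarrow> 0"
    proof (rule AE_I2)
      fix w
      have "\<forall>\<^sub>F n in sequentially. \<bar>Y w\<bar> \<le> c n" using c by (simp add: filterlim_at_top)
      then have "\<forall>\<^sub>F n in sequentially. (if \<bar>Y w\<bar> \<le> c n then 0 else \<bar>Y w\<bar>) = 0" by eventually_elim simp
      then show "(\<lambda>n. if \<bar>Y w\<bar> \<le> c n then 0 else \<bar>Y w\<bar>) \<longlonglongrightarrow> 0" by (rule tendsto_eventually)
    qed
  qed (use Y in auto)
  then show ?thesis by simp
qed

section \<open>Arrays of independent identically distributed rows\<close>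

locale iid_rows = full_rank_vector P X
  for P :: "'b measure" and X :: "'b \<Rightarrow> real ^ 'd" +
  fixes M :: "nat \<Rightarrow> 'a measure" and Xs :: "nat \<Rightarrow> nat \<Rightarrow> 'a \<Rightarrow> real ^ 'd" and m :: "nat \<Rightarrow> nat"
  assumes prob_M: "\<And>k. prob_space (M k)"
    and indep_row: "\<And>k. prob_space.indep_vars (M k) (\<lambda>_. borel) (Xs k) {..<m k}"
    and law_row: "\<And>k i. i < m k \<Longrightarrow> distr (M k) borel (Xs k i) = distr P borel X"
    and size_pos: "\<And>k. 0 < m k" and size_lim: "filterlim m at_top sequentially"
begin

lemma Xs_measurable: "i < m k \<Longrightarrow> Xs k i \<in> borel_measurable (M k)"
proof -
  interpret Mk: prob_space "M k" by (rule prob_M)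
  show "i < m k \<Longrightarrow> Xs k i \<in> borel_measurable (M k)" using indep_row[of k] by (auto simp: Mk.indep_vars_def2)
qed

lemma row_expectation:
  fixes h :: "real ^ 'd \<Rightarrow> 'e::{banach, second_countable_topology}"
  assumes "i < m k" "h \<in> borel_measurable borel"
  shows "(LINT w|M k. h (Xs k i w)) = (LINT w|P. h (X w))"
  by (rule same_law_integral(1)[OF law_row[OF assms(1)] Xs_measurable[OF assms(1)] X_measurable assms(2)])

lemma real_size_lim: "filterlim (\<lambda>k. real (m k)) at_top sequentially"
  by (rule filterlim_compose[OF filterlim_real_sequentially size_lim])

text \<open>Truncation at a height of smaller order than the square root of the sample size; the fourth root
  makes the first term of the bound of order \<open>1 / sqrt (m k)\<close>.\<close>

lemma weak_law:
  fixes f :: "real ^ 'd \<Rightarrow> real"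
  assumes f[measurable]: "f \<in> borel_measurable borel" and int: "integrable P (\<lambda>w. f (X w))" and e: "0 < e"
  shows "(\<lambda>k. measure (M k) {w\<in>space (M k). e \<le> \<bar>(\<Sum>i<m k. f (Xs k i w)) / real (m k) - expectation (\<lambda>w. f (X w))\<bar>}) \<longlonglongrightarrow> 0"
proof -
  let ?Y = "\<lambda>w. f (X w)"
  let ?p = "\<lambda>k. measure (M k) {w\<in>space (M k). e \<le> \<bar>(\<Sum>i<m k. f (Xs k i w)) / real (m k) - expectation ?Y\<bar>}"
  let ?c = "\<lambda>k. root 4 (real (m k))"
  let ?bd = "\<lambda>k. 16 * (?c k)\<^sup>2 / (real (m k) * e\<^sup>2) + 4 * (LINT w|P. (if \<bar>?Y w\<bar> \<le> ?c k then 0 else \<bar>?Y w\<bar>)) / e"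
  have c_lim: "filterlim ?c at_top sequentially"
    by (rule filterlim_compose[OF _ real_size_lim]) real_asymp
  have "(\<lambda>k. 16 * (?c k)\<^sup>2 / (real (m k) * e\<^sup>2)) \<longlonglongrightarrow> 0"
    by (rule filterlim_compose[OF _ real_size_lim]) (use e in real_asymp)
  then have lim: "?bd \<longlonglongrightarrow> 0 + 4 * 0 / e"
    using e by (intro tendsto_add tendsto_divide tendsto_mult tendsto_const tail_integral_vanishes int c_lim) auto
  show ?thesis
  proof (rule tendsto_sandwich[OF _ _ tendsto_const])
    show "?bd \<longlonglongrightarrow> 0" using lim by simp
    show "\<forall>\<^sub>F k in sequentially. 0 \<le> ?p k"
      by simp
    show "\<forall>\<^sub>F k in sequentially. ?p k \<le> ?bd k"
    proof (rule always_eventually, rule allI)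
      fix k
      interpret Mk: prob_space "M k" by (rule prob_M)
      have ind: "Mk.indep_vars (\<lambda>_. borel) (\<lambda>i w. f (Xs k i w)) {..<m k}"
        by (rule Mk.indep_vars_compose2[OF indep_row]) simp
      have law: "distr (M k) borel (\<lambda>w. f (Xs k i w)) = distr P borel ?Y" if "i < m k" for i
      proof -
        have "distr (M k) borel (\<lambda>w. f (Xs k i w)) = distr (distr (M k) borel (Xs k i)) borel f"
          using Xs_measurable[OF that] by (subst distr_distr) (auto simp: comp_def)
        also have "\<dots> = distr P borel ?Y" unfolding law_row[OF that] by (subst distr_distr) (auto simp: comp_def)
        finally show ?thesis .
      qed
      show "?p k \<le> ?bd k"
        by (rule Mk.truncated_weak_law[OF ind size_pos prob_space_axioms int law _ e]) auto
    qed
  qed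
qed

text \<open>A union bound with Markov's inequality for the squared norm restricted to large values. The restricted
  integral vanishes because the second moment is finite.\<close>

lemma max_negligible:
  assumes e: "0 < e"
  shows "(\<lambda>k. measure (M k) {w\<in>space (M k). \<exists>i<m k. e * sqrt (real (m k)) \<le> norm (Xs k i w - \<mu>)}) \<longlonglongrightarrow> 0"
proof -
  let ?N = "\<lambda>w. (norm (X w - \<mu>))\<^sup>2"
  let ?p = "\<lambda>k. measure (M k) {w\<in>space (M k). \<exists>i<m k. e * sqrt (real (m k)) \<le> norm (Xs k i w - \<mu>)}"
  let ?c = "\<lambda>k. e\<^sup>2 * real (m k) / 2"
  let ?t = "\<lambda>k. LINT w|P. (if \<bar>?N w\<bar> \<le> ?c k then 0 else \<bar>?N w\<bar>)"
  have "filterlim ?c at_top sequentially"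
    by (rule filterlim_compose[OF _ real_size_lim]) (use e in real_asymp)
  then have "?t \<longlonglongrightarrow> 0" by (rule tail_integral_vanishes[OF integrable_norm2])
  then have lim: "(\<lambda>k. ?t k / e\<^sup>2) \<longlonglongrightarrow> 0" using tendsto_divide[OF _ tendsto_const, of ?t 0 sequentially "e\<^sup>2"] e by simp
  show ?thesis
  proof (rule tendsto_sandwich[OF _ _ tendsto_const lim])
    show "\<forall>\<^sub>F k in sequentially. 0 \<le> ?p k"
      by simp
    show "\<forall>\<^sub>F k in sequentially. ?p k \<le> ?t k / e\<^sup>2"
    proof (rule always_eventually, rule allI)
      fix k
      interpret Mk: prob_space "M k" by (rule prob_M)
      let ?E = "\<lambda>i. {w\<in>space (M k). e * sqrt (real (m k)) \<le> norm (Xs k i w - \<mu>)}"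
      let ?h = "\<lambda>x. (if \<bar>(norm (x - \<mu>))\<^sup>2\<bar> \<le> ?c k then 0 else \<bar>(norm (x - \<mu>))\<^sup>2\<bar>)"
      have [measurable]: "?h \<in> borel_measurable borel" by measurable
      have m0: "0 < real (m k)" using size_pos by simp
      have inth: "integrable P (\<lambda>w. ?h (X w))"
        by (rule Bochner_Integration.integrable_bound[OF integrable_norm2]) auto
      have each: "measure (M k) (?E i) \<le> ?t k / (e\<^sup>2 * real (m k))" if i: "i < m k" for i
      proof -
        note [measurable] = Xs_measurable[OF i]
        have intk: "integrable (M k) (\<lambda>w. ?h (Xs k i w))"
          using inth same_law_integral(2)[OF law_row[OF i] Xs_measurable[OF i] X_measurable, of ?h] by simp
        have "measure (M k) (?E i) \<le> measure (M k) {w\<in>space (M k). e\<^sup>2 * real (m k) \<le> ?h (Xs k i w)}"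
        proof (rule Mk.finite_measure_mono)
          show "?E i \<subseteq> {w\<in>space (M k). e\<^sup>2 * real (m k) \<le> ?h (Xs k i w)}"
          proof safe
            fix w assume "e * sqrt (real (m k)) \<le> norm (Xs k i w - \<mu>)"
            then have "(e * sqrt (real (m k)))\<^sup>2 \<le> (norm (Xs k i w - \<mu>))\<^sup>2" using e by (intro power_mono) auto
            then have "e\<^sup>2 * real (m k) \<le> (norm (Xs k i w - \<mu>))\<^sup>2" by (simp add: power_mult_distrib)
            moreover have "?c k < e\<^sup>2 * real (m k)" using e m0 by simp
            ultimately show "e\<^sup>2 * real (m k) \<le> ?h (Xs k i w)" by simp
          qed
        qed measurable
        also have "\<dots> \<le> (LINT w|M k. ?h (Xs k i w)) / (e\<^sup>2 * real (m k))"
          using e m0 by (intro integral_Markov_inequality_measure[OF intk, of "{}"]) auto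
        also have "(LINT w|M k. ?h (Xs k i w)) = ?t k" by (rule row_expectation[OF i]) measurable
        finally show ?thesis .
      qed
      have "?p k = measure (M k) (\<Union>i<m k. ?E i)"
        by (rule arg_cong[where f = "measure (M k)"]) auto
      also have "\<dots> \<le> (\<Sum>i<m k. measure (M k) (?E i))"
        using Xs_measurable by (intro Mk.finite_measure_subadditive_finite) auto
      also have "\<dots> \<le> (\<Sum>i<m k. ?t k / (e\<^sup>2 * real (m k)))" by (intro sum_mono each) auto
      also have "\<dots> = ?t k / e\<^sup>2" using m0 by simp
      finally show "?p k \<le> ?t k / e\<^sup>2" .
    qed
  qed
qed

end

lemma mean_centred_bound:
  fixes x :: "nat \<Rightarrow> real ^ 'd"
  assumes k: "0 < k" and b: "\<And>i. i < k \<Longrightarrow> norm (x i - \<mu>) \<le> B" and i: "i < k"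
  shows "norm (centred k x i) \<le> 2 * B"
proof -
  have "centred k x i = (x i - \<mu>) - (1 / real k) *\<^sub>R (\<Sum>i<k. x i - \<mu>)"
    using k by (simp add: centred_def sum_subtractf sum_constant_scaleR scaleR_diff_right del: sum_constant)
  also have "norm \<dots> \<le> norm (x i - \<mu>) + norm ((1 / real k) *\<^sub>R (\<Sum>i<k. x i - \<mu>))" by (rule norm_triangle_ineq4)
  also have "norm ((1 / real k) *\<^sub>R (\<Sum>i<k. x i - \<mu>)) \<le> (1 / real k) * (\<Sum>i<k. norm (x i - \<mu>))"
    by (simp add: divide_right_mono norm_sum)
  also have "\<dots> \<le> (1 / real k) * (\<Sum>i<k. B)" using b by (intro mult_left_mono sum_mono) auto
  also have "\<dots> = B" using k by simp
  finally show ?thesis using b[OF i] by simp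
qed

text \<open>Reduction of a statement about quadratic forms to finitely many averages: centring at the sample
  mean instead of \<open>\<mu>\<close> subtracts the square of the mean deviation, and a quadratic form is controlled by
  the entries of its matrix.\<close>

lemma scatter_entries_close:
  fixes x :: "nat \<Rightarrow> real ^ 'd" and A :: "real ^ 'd ^ 'd"
  assumes k: "0 < k" and t: "0 \<le> t" "t \<le> 1"
    and mean: "\<And>a. \<bar>(\<Sum>i<k. (x i - \<mu>) $ a) / real k\<bar> \<le> t"
    and second: "\<And>a b. \<bar>(\<Sum>i<k. (x i - \<mu>) $ a * (x i - \<mu>) $ b) / real k - A $ a $ b\<bar> \<le> t"
  shows "\<bar>real k * (u \<bullet> scaled_scatter k x u) - u \<bullet> (A *v u)\<bar> \<le> 2 * (real CARD('d))\<^sup>2 * t * (norm u)\<^sup>2"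
proof -
  define s where "s = (1 / real k) *\<^sub>R (\<Sum>i<k. x i - \<mu>)"
  have cen: "centred k x i = (x i - \<mu>) - s" for i
    using k by (simp add: centred_def s_def sum_subtractf sum_constant_scaleR scaleR_diff_right del: sum_constant)
  have us: "u \<bullet> s = (\<Sum>i<k. u \<bullet> (x i - \<mu>)) / real k" by (simp add: s_def inner_sum_right)
  have "real k * (u \<bullet> scaled_scatter k x u) = (\<Sum>i<k. (u \<bullet> (x i - \<mu>) - u \<bullet> s)\<^sup>2) / real k"
    unfolding inner_scaled_scatter cen inner_diff_right using k
    by (simp add: power_divide sum_divide_distrib[symmetric] power2_eq_square[of "real k"])
  also have "(\<Sum>i<k. (u \<bullet> (x i - \<mu>) - u \<bullet> s)\<^sup>2) =
      (\<Sum>i<k. (u \<bullet> (x i - \<mu>))\<^sup>2) - 2 * (u \<bullet> s) * (\<Sum>i<k. u \<bullet> (x i - \<mu>)) + real k * (u \<bullet> s)\<^sup>2"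
    by (simp add: power2_diff sum.distrib sum_subtractf sum_distrib_left mult_ac)
  also have "(\<Sum>i<k. u \<bullet> (x i - \<mu>)) = real k * (u \<bullet> s)" using k by (simp add: us)
  finally have S: "real k * (u \<bullet> scaled_scatter k x u) = (\<Sum>i<k. (u \<bullet> (x i - \<mu>))\<^sup>2) / real k - (u \<bullet> s)\<^sup>2"
    using k by (simp add: field_simps power2_eq_square)
  have "(\<Sum>i<k. (u \<bullet> (x i - \<mu>))\<^sup>2) / real k = (\<Sum>a\<in>UNIV. \<Sum>b\<in>UNIV. u $ a * u $ b * ((\<Sum>i<k. (x i - \<mu>) $ a * (x i - \<mu>) $ b) / real k))"
  proof -
    have "(\<Sum>i<k. (u \<bullet> (x i - \<mu>))\<^sup>2) = (\<Sum>i<k. \<Sum>a\<in>UNIV. \<Sum>b\<in>UNIV. u $ a * u $ b * ((x i - \<mu>) $ a * (x i - \<mu>) $ b))"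
      by (simp add: inner_vec_def power2_eq_square sum_product mult_ac del: vector_minus_component)
    also have "\<dots> = (\<Sum>a\<in>UNIV. \<Sum>b\<in>UNIV. \<Sum>i<k. u $ a * u $ b * ((x i - \<mu>) $ a * (x i - \<mu>) $ b))"
      by (subst sum.swap, intro sum.cong refl, subst sum.swap, rule refl)
    finally show ?thesis by (simp add: sum_divide_distrib sum_distrib_left del: vector_minus_component)
  qed
  moreover have "u \<bullet> (A *v u) = (\<Sum>a\<in>UNIV. \<Sum>b\<in>UNIV. u $ a * u $ b * A $ a $ b)"
    by (simp add: inner_vec_def matrix_vector_mult_def sum_distrib_left mult_ac)
  ultimately have D: "(\<Sum>i<k. (u \<bullet> (x i - \<mu>))\<^sup>2) / real k - u \<bullet> (A *v u) =
    (\<Sum>a\<in>UNIV. \<Sum>b\<in>UNIV. u $ a * u $ b * ((\<Sum>i<k. (x i - \<mu>) $ a * (x i - \<mu>) $ b) / real k - A $ a $ b))"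
    by (simp add: sum_subtractf right_diff_distrib del: vector_minus_component)
  have "\<bar>(\<Sum>i<k. (u \<bullet> (x i - \<mu>))\<^sup>2) / real k - u \<bullet> (A *v u)\<bar> \<le> (\<Sum>a\<in>(UNIV :: 'd set). \<Sum>b\<in>(UNIV :: 'd set). norm u * norm u * t)"
    unfolding D
  proof (intro order_trans[OF sum_abs] sum_mono)
    fix a b :: 'd
    have "\<bar>u $ a\<bar> * \<bar>u $ b\<bar> * \<bar>(\<Sum>i<k. (x i - \<mu>) $ a * (x i - \<mu>) $ b) / real k - A $ a $ b\<bar> \<le> norm u * norm u * t"
      using t second by (intro mult_mono component_le_norm_cart) auto
    then show "\<bar>u $ a * u $ b * ((\<Sum>i<k. (x i - \<mu>) $ a * (x i - \<mu>) $ b) / real k - A $ a $ b)\<bar> \<le> norm u * norm u * t"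
      by (simp add: abs_mult)
  qed
  then have 1: "\<bar>(\<Sum>i<k. (u \<bullet> (x i - \<mu>))\<^sup>2) / real k - u \<bullet> (A *v u)\<bar> \<le> (real CARD('d))\<^sup>2 * t * (norm u)\<^sup>2"
    by (simp add: power2_eq_square mult_ac)
  have sa: "\<bar>s $ a\<bar> \<le> t" for a using mean[of a] by (simp add: s_def del: vector_minus_component)
  have "norm s \<le> (\<Sum>a\<in>UNIV. \<bar>s $ a\<bar>)" by (rule norm_le_l1_cart)
  also have "\<dots> \<le> (\<Sum>a\<in>(UNIV :: 'd set). t)" by (intro sum_mono sa)
  finally have ns: "norm s \<le> real CARD('d) * t" by simp
  have "\<bar>u \<bullet> s\<bar> \<le> norm u * (real CARD('d) * t)"
    using Cauchy_Schwarz_ineq2[of u s] mult_left_mono[OF ns norm_ge_zero[of u]] by linarith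
  then have "\<bar>u \<bullet> s\<bar>\<^sup>2 \<le> (norm u * (real CARD('d) * t))\<^sup>2" by (rule power_mono) simp
  also have "\<dots> = (real CARD('d))\<^sup>2 * (norm u)\<^sup>2 * (t * t)" by (simp add: power2_eq_square mult_ac)
  also have "\<dots> \<le> (real CARD('d))\<^sup>2 * (norm u)\<^sup>2 * (t * 1)" using t by (intro mult_left_mono) auto
  finally have 2: "(u \<bullet> s)\<^sup>2 \<le> (real CARD('d))\<^sup>2 * t * (norm u)\<^sup>2" by (simp add: mult_ac)
  have "0 \<le> (u \<bullet> s)\<^sup>2" by simp
  with 1 2 show ?thesis unfolding S by linarith
qed

section \<open>Events of high probability and the comparison with a quadratic form\<close>

context iid_rows
begin

text \<open>Finitely many averages are close to their expectations and all observations are small, outside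
  events of vanishing probability. Coercivity turns the error relative to the norm into an error
  relative to the covariance form.\<close>

lemma good_event:
  assumes e: "0 < e"
  obtains Bad where "\<And>k. Bad k \<in> sets (M k)" "(\<lambda>k. measure (M k) (Bad k)) \<longlonglongrightarrow> 0"
    "\<And>k w i. w \<in> space (M k) - Bad k \<Longrightarrow> i < m k \<Longrightarrow> norm (centred (m k) (\<lambda>i. Xs k i w) i) \<le> e * sqrt (real (m k))"
    "\<And>k w u. w \<in> space (M k) - Bad k \<Longrightarrow>
      \<bar>real (m k) * (u \<bullet> scaled_scatter (m k) (\<lambda>i. Xs k i w) u) - u \<bullet> (\<Sigma> *v u)\<bar> \<le> e * (u \<bullet> (\<Sigma> *v u))"
proof -
  obtain c where c: "0 < c" "\<And>u. c * (norm u)\<^sup>2 \<le> u \<bullet> (\<Sigma> *v u)" using cov_matrix_coercive by blast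
  define D where "D = 2 * (real CARD('d))\<^sup>2"
  \<comment> \<open>accuracy of the averages that gives accuracy \<open>e\<close> of the form; at most one, as squares occur\<close>
  define t where "t = min 1 (e * c / D)"
  have D: "0 < D" by (simp add: D_def)
  have t: "0 < t" "t \<le> 1" "D * t \<le> e * c"
  proof -
    show "0 < t" "t \<le> 1" using e c D by (simp_all add: t_def)
    have "D * t \<le> D * (e * c / D)" using D by (intro mult_left_mono) (auto simp: t_def)
    then show "D * t \<le> e * c" using D by simp
  qed
  define E1 where "E1 k = {w\<in>space (M k). \<exists>i<m k. (e / 2) * sqrt (real (m k)) \<le> norm (Xs k i w - \<mu>)}" for k
  define E2 where "E2 a k = {w\<in>space (M k). t \<le> \<bar>(\<Sum>i<m k. (Xs k i w - \<mu>) $ a) / real (m k) - expectation (\<lambda>w. (X w - \<mu>) $ a)\<bar>}" for a k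
  define E3 where "E3 a b k = {w\<in>space (M k). t \<le> \<bar>(\<Sum>i<m k. (Xs k i w - \<mu>) $ a * (Xs k i w - \<mu>) $ b) / real (m k) - expectation (\<lambda>w. (X w - \<mu>) $ a * (X w - \<mu>) $ b)\<bar>}" for a b k
  have vm[measurable]: "(\<lambda>x::real^'d. (x - \<mu>) $ a) \<in> borel_measurable borel" for a
    by (intro borel_measurable_continuous_onI continuous_intros)
  have Xm: "(\<lambda>w. (Xs k i w - \<mu>) $ a) \<in> borel_measurable (M k)" if "i < m k" for i k a
    by (rule measurable_compose[OF Xs_measurable[OF that] vm])
  have l1: "(\<lambda>k. measure (M k) (E1 k)) \<longlonglongrightarrow> 0" unfolding E1_def using e by (intro max_negligible) simp
  have l2: "(\<lambda>k. measure (M k) (E2 a k)) \<longlonglongrightarrow> 0" for a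
  proof -
    have "integrable P (\<lambda>w. (X w - \<mu>) $ a)"
      using integrable_X by (simp add: cart_eq_inner_axis)
    then show ?thesis unfolding E2_def using t by (intro weak_law[where f = "\<lambda>x. (x - \<mu>) $ a"] vm) auto
  qed
  have l3: "(\<lambda>k. measure (M k) (E3 a b k)) \<longlonglongrightarrow> 0" for a b
    unfolding E3_def using t integrable_entries
    by (intro weak_law[where f = "\<lambda>x. (x - \<mu>) $ a * (x - \<mu>) $ b"] borel_measurable_times vm) auto
  have s1: "E1 k \<in> sets (M k)" for k
  proof -
    have "E1 k = (\<Union>i<m k. {w\<in>space (M k). (e / 2) * sqrt (real (m k)) \<le> norm (Xs k i w - \<mu>)})" by (auto simp: E1_def)
    also have "\<dots> \<in> sets (M k)"
      using Xs_measurable by (intro sets.finite_UN borel_measurable_le borel_measurable_const borel_measurable_norm borel_measurable_diff) auto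
    finally show ?thesis .
  qed
  have s2: "E2 a k \<in> sets (M k)" for a k
    unfolding E2_def by (intro borel_measurable_le borel_measurable_const borel_measurable_abs borel_measurable_diff borel_measurable_divide borel_measurable_sum Xm) auto
  have s3: "E3 a b k \<in> sets (M k)" for a b k
    unfolding E3_def by (intro borel_measurable_le borel_measurable_const borel_measurable_abs borel_measurable_diff borel_measurable_divide borel_measurable_sum borel_measurable_times Xm) auto
  define Bad where "Bad k = E1 k \<union> ((\<Union>a. E2 a k) \<union> (\<Union>a. \<Union>b. E3 a b k))" for k
  show thesis
  proof (rule that[of Bad])
    have sU2: "(\<Union>a. E2 a k) \<in> sets (M k)" for k by (intro sets.finite_UN s2) auto
    have sU3b: "(\<Union>b. E3 a b k) \<in> sets (M k)" for a k by (intro sets.finite_UN s3) auto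
    have sU3: "(\<Union>a. \<Union>b. E3 a b k) \<in> sets (M k)" for k by (intro sets.finite_UN sU3b) auto
    show "Bad k \<in> sets (M k)" for k unfolding Bad_def by (intro sets.Un s1 sU2 sU3)
    let ?bd = "\<lambda>k. measure (M k) (E1 k) + ((\<Sum>a\<in>UNIV. measure (M k) (E2 a k)) + (\<Sum>a\<in>UNIV. \<Sum>b\<in>UNIV. measure (M k) (E3 a b k)))"
    have "?bd \<longlonglongrightarrow> 0 + ((\<Sum>a\<in>(UNIV :: 'd set). 0) + (\<Sum>a\<in>(UNIV :: 'd set). \<Sum>b\<in>(UNIV :: 'd set). 0))"
      by (intro tendsto_add tendsto_sum l1 l2 l3)
    then have bd: "?bd \<longlonglongrightarrow> 0" by simp
    show "(\<lambda>k. measure (M k) (Bad k)) \<longlonglongrightarrow> 0"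
    proof (rule tendsto_sandwich[OF _ _ tendsto_const bd])
      show "\<forall>\<^sub>F k in sequentially. measure (M k) (Bad k) \<le> ?bd k"
      proof (rule always_eventually, rule allI)
        fix k
        interpret Mk: prob_space "M k" by (rule prob_M)
        have "measure (M k) (\<Union>a. E2 a k) \<le> (\<Sum>a\<in>UNIV. measure (M k) (E2 a k))"
          by (rule Mk.finite_measure_subadditive_finite) (auto intro: s2)
        moreover have "measure (M k) (\<Union>a. \<Union>b. E3 a b k) \<le> (\<Sum>a\<in>UNIV. measure (M k) (\<Union>b. E3 a b k))"
          by (rule Mk.finite_measure_subadditive_finite) (auto intro: sU3b)
        moreover have "(\<Sum>a\<in>UNIV. measure (M k) (\<Union>b. E3 a b k)) \<le> (\<Sum>a\<in>UNIV. \<Sum>b\<in>UNIV. measure (M k) (E3 a b k))"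
          by (intro sum_mono Mk.finite_measure_subadditive_finite) (auto intro: s3)
        moreover have "measure (M k) (Bad k) \<le> measure (M k) (E1 k) + measure (M k) ((\<Union>a. E2 a k) \<union> (\<Union>a. \<Union>b. E3 a b k))"
          unfolding Bad_def by (intro measure_Un_le s1 sets.Un sU2 sU3)
        moreover have "measure (M k) ((\<Union>a. E2 a k) \<union> (\<Union>a. \<Union>b. E3 a b k)) \<le> measure (M k) (\<Union>a. E2 a k) + measure (M k) (\<Union>a. \<Union>b. E3 a b k)"
          by (intro measure_Un_le sU2 sU3)
        ultimately show "measure (M k) (Bad k) \<le> ?bd k" by linarith
      qed
    qed simp
    fix k w assume w: "w \<in> space (M k) - Bad k"
    show "norm (centred (m k) (\<lambda>i. Xs k i w) i) \<le> e * sqrt (real (m k))" if "i < m k" for i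
    proof -
      have "norm (centred (m k) (\<lambda>i. Xs k i w) i) \<le> 2 * ((e / 2) * sqrt (real (m k)))"
        by (rule mean_centred_bound[OF size_pos _ that, where \<mu> = \<mu>]) (use w in \<open>auto simp: Bad_def E1_def not_le less_imp_le\<close>)
      then show ?thesis by simp
    qed
    show "\<bar>real (m k) * (u \<bullet> scaled_scatter (m k) (\<lambda>i. Xs k i w) u) - u \<bullet> (\<Sigma> *v u)\<bar> \<le> e * (u \<bullet> (\<Sigma> *v u))" for u
    proof -
      have "\<bar>real (m k) * (u \<bullet> scaled_scatter (m k) (\<lambda>i. Xs k i w) u) - u \<bullet> (\<Sigma> *v u)\<bar> \<le> 2 * (real CARD('d))\<^sup>2 * t * (norm u)\<^sup>2"
      proof (rule scatter_entries_close[OF size_pos _ t(2), where \<mu> = \<mu>])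
        show "0 \<le> t" using t by simp
        fix a b
        have "w \<notin> E2 a k" "w \<notin> E3 a b k" and ws: "w \<in> space (M k)" using w by (auto simp: Bad_def)
        moreover have "expectation (\<lambda>w. (X w - \<mu>) $ a) = 0"
          using expectation_inner_centred[of "axis a 1"] by (simp only: cart_eq_inner_axis inner_commute[of "axis a 1"])
        moreover have "expectation (\<lambda>w. (X w - \<mu>) $ a * (X w - \<mu>) $ b) = \<Sigma> $ a $ b" by (simp add: cov_matrix_def)
        ultimately show "\<bar>(\<Sum>i<m k. (Xs k i w - \<mu>) $ a) / real (m k)\<bar> \<le> t"
          "\<bar>(\<Sum>i<m k. (Xs k i w - \<mu>) $ a * (Xs k i w - \<mu>) $ b) / real (m k) - \<Sigma> $ a $ b\<bar> \<le> t"
          by (simp_all add: E2_def E3_def not_le less_imp_le del: vector_minus_component)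
      qed
      also have "\<dots> = D * t * (norm u)\<^sup>2" by (simp add: D_def)
      also have "\<dots> \<le> e * c * (norm u)\<^sup>2" using t(3) by (rule mult_right_mono) simp
      also have "\<dots> \<le> e * (u \<bullet> (\<Sigma> *v u))" using e c(2)[of u] by (simp add: mult.assoc)
      finally show ?thesis .
    qed
  qed
qed

end

text \<open>Outside the exceptional events of \<open>good_event\<close> the statistic \<open>T\<close> and the sum of squares \<open>Z\<close> differ by factors close to
  one. The sample forms determine \<open>\<nu>\<close> with \<open>S \<nu> = \<delta>\<close>, where \<open>\<delta>\<close> is the shift at the fixed point, that is
  \<open>\<theta>\<^sub>0 - \<theta>-hat\<close> divided by the expansion factor \<open>\<gamma>\<close>. The bound \<open>Z \<le> K\<close> limits the length of \<open>\<nu>\<close>,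
  therefore the size \<open>\<eta>\<close> of the tilt, and then \<open>\<gamma>\<close> itself.\<close>

lemma eel_quadratic_comparison:
  fixes x y :: "nat \<Rightarrow> real ^ 'd" and A B :: "real ^ 'd ^ 'd" and v :: "nat \<Rightarrow> real ^ 'd"
  assumes mn: "0 < m" "0 < n"
    and A: "\<And>u. c * (norm u)\<^sup>2 \<le> u \<bullet> (A *v u)" "\<And>u w. u \<bullet> (A *v w) = w \<bullet> (A *v u)"
    and B: "\<And>u. c * (norm u)\<^sup>2 \<le> u \<bullet> (B *v u)" "\<And>u w. u \<bullet> (B *v w) = w \<bullet> (B *v u)"
    and c: "0 < c"
    and x: "\<And>i. i < m \<Longrightarrow> norm (centred m x i) \<le> e * sqrt (real m)"
      "\<And>u. \<bar>real m * (u \<bullet> scaled_scatter m x u) - u \<bullet> (A *v u)\<bar> \<le> e * (u \<bullet> (A *v u))"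
    and y: "\<And>i. i < n \<Longrightarrow> norm (centred n y i) \<le> e * sqrt (real n)"
      "\<And>u. \<bar>real n * (u \<bullet> scaled_scatter n y u) - u \<bullet> (B *v u)\<bar> \<le> e * (u \<bullet> (B *v u))"
    and v: "\<And>i j. i < CARD('d) \<Longrightarrow> j < CARD('d) \<Longrightarrow>
        v i \<bullet> (A *v v j) / real m + v i \<bullet> (B *v v j) / real n = of_bool (i = j)"
      "span (v ` {..<CARD('d)}) = UNIV"
    and e: "0 \<le> e" "e \<le> 1 / 2"
    and K: "(\<Sum>i<CARD('d). (v i \<bullet> (theta_hat m n x y - \<theta>\<^sub>0))\<^sup>2) \<le> K" and eK: "2 * e * sqrt (K / c) \<le> 1 / 4"
  defines "Z \<equiv> \<Sum>i<CARD('d). (v i \<bullet> (theta_hat m n x y - \<theta>\<^sub>0))\<^sup>2" and "\<eta> \<equiv> 2 * e * sqrt (K / c)"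
  shows "eel m n x y r \<theta>\<^sub>0 \<le> (1 + 4 * \<eta>) / (1 - e) * Z"
    and "(1 - 4 * \<eta>) / (1 + e) / (1 + 2 * K / real (m + n))\<^sup>2 * Z \<le> eel m n x y r \<theta>\<^sub>0"
proof -
  let ?S = "\<lambda>u. scaled_scatter m x u + scaled_scatter n y u"
  define V where "V = (\<lambda>u w. u \<bullet> (A *v w) / real m + u \<bullet> (B *v w) / real n)"
  have mn': "0 < real m" "0 < real n" using mn by simp_all
  have bil: "bilinear V"
    unfolding bilinear_def V_def
    by (intro conjI allI linearI)
      (simp_all add: matrix_vector_right_distrib inner_add_right inner_add_left matrix_vector_mult_scaleR add_divide_distrib distrib_left)
  have sym: "V u w = V w u" for u w using A(2)[of u w] B(2)[of u w] by (simp add: V_def)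
  have Vc: "c * (norm u)\<^sup>2 / real m \<le> V u u" "c * (norm u)\<^sup>2 / real n \<le> V u u" for u
  proof -
    have "0 \<le> c * (norm u)\<^sup>2" using c by simp
    then have "0 \<le> u \<bullet> (A *v u)" "0 \<le> u \<bullet> (B *v u)" using A(1)[of u] B(1)[of u] by linarith+
    moreover have "c * (norm u)\<^sup>2 / real m \<le> u \<bullet> (A *v u) / real m" "c * (norm u)\<^sup>2 / real n \<le> u \<bullet> (B *v u) / real n"
      using A(1) B(1) by (intro divide_right_mono; simp)+
    moreover from calculation(1,2) have "0 \<le> u \<bullet> (A *v u) / real m" "0 \<le> u \<bullet> (B *v u) / real n" by simp_all
    ultimately show "c * (norm u)\<^sup>2 / real m \<le> V u u" "c * (norm u)\<^sup>2 / real n \<le> V u u" unfolding V_def by linarith+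
  qed
  have V0: "0 \<le> V u u" for u using order_trans[OF _ Vc(1)[of u]] c by simp
  have linS: "linear ?S" by (intro linear_compose_add linear_scaled_scatter)
  have symS: "u \<bullet> ?S w = w \<bullet> ?S u" for u w by (simp add: inner_add_right inner_scaled_scatter_sym)
  have close: "\<bar>u \<bullet> ?S u - V u u\<bar> \<le> e * V u u" for u
  proof -
    have "\<bar>u \<bullet> scaled_scatter m x u - u \<bullet> (A *v u) / real m\<bar> \<le> e * (u \<bullet> (A *v u) / real m)"
    proof -
      have "u \<bullet> scaled_scatter m x u - u \<bullet> (A *v u) / real m = (real m * (u \<bullet> scaled_scatter m x u) - u \<bullet> (A *v u)) / real m"
        using mn' by (simp add: field_simps)
      then show ?thesis using divide_right_mono[OF x(2)[of u], of "real m"] mn' by (simp add: abs_divide)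
    qed
    moreover have "\<bar>u \<bullet> scaled_scatter n y u - u \<bullet> (B *v u) / real n\<bar> \<le> e * (u \<bullet> (B *v u) / real n)"
    proof -
      have "u \<bullet> scaled_scatter n y u - u \<bullet> (B *v u) / real n = (real n * (u \<bullet> scaled_scatter n y u) - u \<bullet> (B *v u)) / real n"
        using mn' by (simp add: field_simps)
      then show ?thesis using divide_right_mono[OF y(2)[of u], of "real n"] mn' by (simp add: abs_divide)
    qed
    ultimately show ?thesis unfolding V_def inner_add_right distrib_left by linarith
  qed
  have vV: "V (v i) (v j) = of_bool (i = j)" if "i < CARD('d)" "j < CARD('d)" for i j
    unfolding V_def using that by (rule v(1))
  have Spos: "u = 0" if "u \<bullet> ?S u \<le> 0" for u
  proof -
    have "(1 - e) * V u u \<le> 0" using close[of u] that by (simp add: abs_le_iff algebra_simps)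
    then have "V u u \<le> 0" using e by (simp add: mult_le_0_iff)
    with V0[of u] have "V u u = 0" by simp
    with Vc(1)[of u] have "c * (norm u)\<^sup>2 \<le> 0" using mn' by (simp add: field_simps)
    then show "u = 0" using c by (simp add: mult_le_0_iff)
  qed
  have op: "open (Theta m n x y)"
    unfolding open_Theta_iff[OF mn]
  proof (intro allI impI notI)
    fix a :: "real ^ 'd" assume a0: "a \<noteq> 0" and deg: "degenerate_along m x a \<and> degenerate_along n y a"
    have "a \<bullet> centred k z i = 0" if "degenerate_along k z a" "i < k" for k z i
    proof -
      have "a \<bullet> (\<Sum>i<k. z i) = real k * (a \<bullet> z 0)"
      proof -
        have "(\<Sum>i<k. a \<bullet> z i) = (\<Sum>i<k. a \<bullet> z 0)"
          using that(1) unfolding degenerate_along_def by (intro sum.cong refl) (metis lessThan_iff)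
        then show ?thesis by (simp add: inner_sum_right)
      qed
      moreover have "a \<bullet> z i = a \<bullet> z 0" using that unfolding degenerate_along_def by blast
      ultimately show ?thesis using that(2) by (simp add: centred_def inner_diff_right)
    qed
    with deg have "a \<bullet> ?S a = 0" by (simp add: inner_add_right inner_scaled_scatter)
    with Spos[of a] a0 show False by simp
  qed
  let ?T = "eel m n x y r \<theta>\<^sub>0"
  note T = eel_fixed_point[OF mn op, where r = r and \<theta>\<^sub>0 = \<theta>\<^sub>0]
  define \<gamma> where "\<gamma> = expansion_factor (m + n) ?T"
  have \<gamma>1: "1 \<le> \<gamma>" unfolding \<gamma>_def using T(1) by (rule expansion_factor_pos)
  define \<delta> where "\<delta> = (1 / \<gamma>) *\<^sub>R (\<theta>\<^sub>0 - theta_hat m n x y)"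
  have "inj ?S"
  proof (rule linear_injective_0[OF linS, THEN iffD2], intro allI impI)
    fix u assume "?S u = 0"
    then show "u = 0" by (intro Spos) (metis inner_zero_right order_refl)
  qed
  then have "surj ?S" by (rule linear_injective_imp_surjective[OF linS]) simp
  from surjD[OF this, of \<delta>] obtain \<nu> where "\<delta> = ?S \<nu>" by blast
  then have \<nu>: "?S \<nu> = \<delta>" by simp
  define Q where "Q = \<nu> \<bullet> \<delta>"
  have path: "theta_path m n x y \<theta>\<^sub>0 ?T = theta_hat m n x y + ?S \<nu>"
    by (simp add: theta_path_def \<nu> \<delta>_def \<gamma>_def)
  have Z: "(\<Sum>i<CARD('d). (v i \<bullet> ?S \<nu>)\<^sup>2) = Z / \<gamma>\<^sup>2"
  proof -
    have "(v i \<bullet> ?S \<nu>)\<^sup>2 = (v i \<bullet> (theta_hat m n x y - \<theta>\<^sub>0))\<^sup>2 / \<gamma>\<^sup>2" for i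
      unfolding \<nu> \<delta>_def by (simp add: power_divide inner_diff_right power2_commute[of "v i \<bullet> \<theta>\<^sub>0"])
    then show ?thesis by (simp add: Z_def sum_divide_distrib)
  qed
  note ic = inverse_form_close[where B = V and S = ?S and v = v and k = "CARD('d)" and \<eta> = e and \<nu> = \<nu>,
      OF bil sym vV v(2) linS symS V0 close]
  have ic1: "(1 - e) * Q \<le> Z / \<gamma>\<^sup>2" and ic2: "Z / \<gamma>\<^sup>2 \<le> (1 + e) * Q"
    using ic e unfolding Z unfolding \<nu> Q_def by simp_all
  have Z0: "0 \<le> Z" by (simp add: Z_def sum_nonneg)
  have ZK: "Z \<le> K" using K by (simp add: Z_def)
  have K0: "0 \<le> K" using Z0 ZK by simp
  have g2: "1 \<le> \<gamma>\<^sup>2" using \<gamma>1 by (simp add: one_le_power)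
  have Zg: "Z / \<gamma>\<^sup>2 \<le> Z" using divide_left_mono[OF g2 Z0] \<gamma>1 by simp
  have QZ: "Q \<le> Z / (1 - e)" using ic1 Zg e by (simp add: field_simps)
  have Q2K: "Q \<le> 2 * K"
  proof -
    have "(1 - e) * Q \<le> K" using ic1 Zg ZK by linarith
    moreover have "0 \<le> Q"
      using ic2 Z0 e \<gamma>1 by (smt (verit) divide_nonneg_nonneg zero_le_mult_iff zero_le_power2)
    then have "(1 / 2) * Q \<le> (1 - e) * Q" using e by (intro mult_right_mono) auto
    ultimately show ?thesis by simp
  qed
  have Vnu: "V \<nu> \<nu> \<le> 4 * K"
  proof -
    have "(1 - e) * V \<nu> \<nu> \<le> Q" using close[of \<nu>] unfolding \<nu> Q_def by (simp add: abs_le_iff algebra_simps)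
    moreover have "(1 / 2) * V \<nu> \<nu> \<le> (1 - e) * V \<nu> \<nu>" using e V0 by (intro mult_right_mono) auto
    ultimately show ?thesis using Q2K by simp
  qed
  \<comment> \<open>the square roots of the sample size cancel: one from the length of \<open>\<nu>\<close>, one from the observation\<close>
  have u_bound: "\<bar>\<nu> \<bullet> z / real k\<bar> \<le> \<eta>" if k: "0 < k" and V: "c * (norm \<nu>)\<^sup>2 / real k \<le> V \<nu> \<nu>"
    and z: "norm z \<le> e * sqrt (real k)" for k z
  proof -
    have "c * (norm \<nu>)\<^sup>2 / real k \<le> 4 * K" using V Vnu by linarith
    then have "(norm \<nu>)\<^sup>2 \<le> 4 * (K / c) * real k" using c k by (simp add: field_simps)
    then have "norm \<nu> \<le> sqrt (4 * (K / c) * real k)" by (rule real_le_rsqrt)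
    then have n: "norm \<nu> \<le> 2 * sqrt (K / c) * sqrt (real k)" by (simp only: real_sqrt_mult real_sqrt_four)
    have "\<bar>\<nu> \<bullet> z\<bar> \<le> norm \<nu> * norm z" by (rule Cauchy_Schwarz_ineq2)
    also have "\<dots> \<le> (2 * sqrt (K / c) * sqrt (real k)) * (e * sqrt (real k))"
      using n z K0 c by (intro mult_mono) auto
    also have "\<dots> = \<eta> * real k" by (simp add: \<eta>_def)
    finally show ?thesis using k by (simp add: abs_divide field_simps)
  qed
  have ux: "\<bar>\<nu> \<bullet> centred m x i / real m\<bar> \<le> \<eta>" if "i < m" for i by (rule u_bound[OF mn(1) Vc(1) x(1)[OF that]])
  have uy: "\<bar>\<nu> \<bullet> centred n y i / real n\<bar> \<le> \<eta>" if "i < n" for i by (rule u_bound[OF mn(2) Vc(2) y(1)[OF that]])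
  have \<eta>: "\<eta> \<le> 1 / 4" "0 \<le> \<eta>" using eK e K0 c by (simp_all add: \<eta>_def)
  then have \<eta>2: "\<eta> \<le> 1 / 2" by simp
  have T': "oel m n x y (theta_hat m n x y + ?S \<nu>) = ereal ?T" using T(2) unfolding path .
  have up: "?T \<le> (1 + 4 * \<eta>) * Q"
    using oel_upper[OF mn \<eta>2 ux uy] unfolding T' unfolding \<nu> Q_def by simp
  have low: "(1 - 4 * \<eta>) * Q \<le> ?T"
    using oel_lower[OF mn \<eta>2 ux uy, of ?T] unfolding T' unfolding \<nu> Q_def by simp
  have "?T \<le> (1 + 4 * \<eta>) * (Z / (1 - e))"
    using up mult_left_mono[OF QZ, of "1 + 4 * \<eta>"] \<eta> by linarith
  then show "?T \<le> (1 + 4 * \<eta>) / (1 - e) * Z" by (simp add: mult.commute)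
  have "?T \<le> 2 * (2 * K)"
  proof -
    have "?T \<le> (1 + 4 * \<eta>) * (2 * K)" using up mult_left_mono[OF Q2K, of "1 + 4 * \<eta>"] \<eta> by linarith
    also have "\<dots> \<le> 2 * (2 * K)" using \<eta> K0 by (intro mult_right_mono) auto
    finally show ?thesis .
  qed
  from divide_right_mono[OF this, of "2 * real (m + n)"]
  have "?T / (2 * real (m + n)) \<le> 2 * (2 * K) / (2 * real (m + n))" by simp
  also have "\<dots> = 2 * K / real (m + n)" by (rule mult_divide_mult_cancel_left) simp
  finally have \<gamma>K: "\<gamma> \<le> 1 + 2 * K / real (m + n)"
    unfolding \<gamma>_def expansion_factor_def by (rule add_left_mono)
  have "(1 - 4 * \<eta>) / (1 + e) / (1 + 2 * K / real (m + n))\<^sup>2 * Z \<le> (1 - 4 * \<eta>) / (1 + e) / \<gamma>\<^sup>2 * Z"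
    using \<gamma>K \<gamma>1 \<eta> e Z0 by (intro mult_right_mono divide_left_mono power_mono) auto
  also have "\<dots> = (1 - 4 * \<eta>) * (Z / \<gamma>\<^sup>2 / (1 + e))" by simp
  also have "\<dots> \<le> (1 - 4 * \<eta>) * Q"
  proof (rule mult_left_mono)
    have "Z / \<gamma>\<^sup>2 \<le> Q * (1 + e)" using ic2 by (simp only: mult.commute)
    moreover have "0 < 1 + e" using e by simp
    ultimately show "Z / \<gamma>\<^sup>2 / (1 + e) \<le> Q" by (subst pos_divide_le_eq)
    show "0 \<le> 1 - 4 * \<eta>" using \<eta> by simp
  qed
  also note low
  finally show "(1 - 4 * \<eta>) / (1 + e) / (1 + 2 * K / real (m + n))\<^sup>2 * Z \<le> ?T" .
qed

section \<open>The central limit theorem for two samples\<close>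

lemma norm_mult_diff_le:
  fixes a b a' b' :: "'x::real_normed_algebra"
  assumes "norm b \<le> 1" "norm a' \<le> 1"
  shows "norm (a * b - a' * b') \<le> norm (a - a') + norm (b - b')"
proof -
  have "a * b - a' * b' = (a - a') * b + a' * (b - b')" by (simp add: algebra_simps)
  then have "norm (a * b - a' * b') \<le> norm ((a - a') * b) + norm (a' * (b - b'))"
    by (simp only: norm_triangle_ineq)
  also have "\<dots> \<le> norm (a - a') * norm b + norm a' * norm (b - b')"
    by (intro add_mono norm_mult_ineq)
  also have "\<dots> \<le> norm (a - a') * 1 + 1 * norm (b - b')"
    using assms by (intro add_mono mult_left_mono mult_right_mono) auto
  finally show ?thesis by simp
qed

locale two_sample_array = X: iid_rows P X M Xs m + Y: iid_rows P Y M Ys n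
  for P :: "'b measure" and X Y :: "'b \<Rightarrow> real ^ 'd"
    and M :: "nat \<Rightarrow> 'a measure" and Xs Ys :: "nat \<Rightarrow> nat \<Rightarrow> 'a \<Rightarrow> real ^ 'd" and m n :: "nat \<Rightarrow> nat" +
  assumes joint: "\<And>k. prob_space.indep_vars (M k) (\<lambda>_. borel) (case_sum (Xs k) (Ys k)) ({..<m k} <+> {..<n k})"
begin

definition deviation :: "nat \<Rightarrow> 'a \<Rightarrow> real ^ 'd" where
  "deviation k w = theta_hat (m k) (n k) (\<lambda>i. Xs k i w) (\<lambda>j. Ys k j w) - (mean_vec P Y - mean_vec P X)"

text \<open>The covariance form of \<^const>\<open>deviation\<close>.\<close>

definition form :: "nat \<Rightarrow> real ^ 'd \<Rightarrow> real ^ 'd \<Rightarrow> real" where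
  "form k u w = u \<bullet> (cov_matrix P X *v w) / real (m k) + u \<bullet> (cov_matrix P Y *v w) / real (n k)"

lemma deviation_measurable [measurable]: "deviation k \<in> borel_measurable (M k)"
  unfolding deviation_def[abs_def] theta_hat_def
  by (intro borel_measurable_diff borel_measurable_scaleR borel_measurable_const borel_measurable_sum
      X.Xs_measurable Y.Xs_measurable) auto

text \<open>Independence of all \<open>m + n\<close> observations factorises the characteristic function; the first sample
  enters with the opposite sign.\<close>

lemma char_deviation:
  "(CLINT w|M k. iexp (u \<bullet> deviation k w)) =
    X.cchar ((1 / real (m k)) *\<^sub>R (- u)) ^ m k * Y.cchar ((1 / real (n k)) *\<^sub>R u) ^ n k"
proof -
  interpret Mk: prob_space "M k" by (rule X.prob_M)
  let ?I = "{..<m k} <+> {..<n k}"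
  define hx where "hx x = iexp (((1 / real (m k)) *\<^sub>R (- u)) \<bullet> (x - X.\<mu>))" for x :: "real ^ 'd"
  define hy where "hy x = iexp (((1 / real (n k)) *\<^sub>R u) \<bullet> (x - Y.\<mu>))" for x :: "real ^ 'd"
  have [measurable]: "hx \<in> borel_measurable borel" "hy \<in> borel_measurable borel"
    unfolding hx_def[abs_def] hy_def[abs_def] by measurable
  define h where "h a = (case a of Inl (_::nat) \<Rightarrow> hx | Inr (_::nat) \<Rightarrow> hy)" for a
  have hm: "h a \<in> borel_measurable borel" for a by (cases a) (simp_all add: h_def)
  let ?f = "\<lambda>a w. h a (case_sum (Xs k) (Ys k) a w)"
  have ind: "Mk.indep_vars (\<lambda>_. borel) ?f ?I"
    by (rule Mk.indep_vars_compose2[OF joint hm])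
  have norm_h: "norm (h a x) = 1" for a x by (cases a) (simp_all add: h_def hx_def hy_def)
  have m0: "0 < real (m k)" "0 < real (n k)" using X.size_pos Y.size_pos by simp_all
  have prod: "iexp (u \<bullet> deviation k w) = (\<Prod>a\<in>?I. ?f a w)" for w
  proof -
    have ux: "u \<bullet> ((1 / real (m k)) *\<^sub>R (\<Sum>i<m k. Xs k i w) - X.\<mu>) = - (\<Sum>i<m k. ((1 / real (m k)) *\<^sub>R (- u)) \<bullet> (Xs k i w - X.\<mu>))"
      using m0 by (simp add: inner_diff_right inner_sum_right sum_subtractf sum_negf sum_divide_distrib diff_divide_distrib)
    have uy: "u \<bullet> ((1 / real (n k)) *\<^sub>R (\<Sum>i<n k. Ys k i w) - Y.\<mu>) = (\<Sum>i<n k. ((1 / real (n k)) *\<^sub>R u) \<bullet> (Ys k i w - Y.\<mu>))"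
      using m0 by (simp add: inner_diff_right inner_sum_right sum_subtractf sum_divide_distrib diff_divide_distrib)
    have "u \<bullet> deviation k w = u \<bullet> ((1 / real (n k)) *\<^sub>R (\<Sum>i<n k. Ys k i w) - Y.\<mu>) - u \<bullet> ((1 / real (m k)) *\<^sub>R (\<Sum>i<m k. Xs k i w) - X.\<mu>)"
      by (simp add: deviation_def theta_hat_def inner_diff_right)
    also have "\<dots> = (\<Sum>i<m k. ((1 / real (m k)) *\<^sub>R (- u)) \<bullet> (Xs k i w - X.\<mu>)) + (\<Sum>i<n k. ((1 / real (n k)) *\<^sub>R u) \<bullet> (Ys k i w - Y.\<mu>))"
      unfolding ux uy by simp
    finally have eq: "u \<bullet> deviation k w = \<dots>" .
    have "iexp (u \<bullet> deviation k w) = (\<Prod>i<m k. hx (Xs k i w)) * (\<Prod>j<n k. hy (Ys k j w))"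
      unfolding eq hx_def hy_def by (simp only: of_real_add of_real_sum distrib_left sum_distrib_left exp_add exp_sum[OF finite_lessThan])
    also have "\<dots> = (\<Prod>a\<in>?I. ?f a w)" by (simp add: prod.Plus h_def comp_def)
    finally show ?thesis .
  qed
  have int: "integrable (M k) (?f a)" if "a \<in> ?I" for a
  proof (rule Mk.integrable_const_bound[where B = 1])
    show "?f a \<in> borel_measurable (M k)" using ind that by (auto simp: Mk.indep_vars_def2)
  qed (simp add: norm_h)
  have "(CLINT w|M k. iexp (u \<bullet> deviation k w)) = (\<Prod>a\<in>?I. CLINT w|M k. ?f a w)"
    unfolding prod by (rule Mk.indep_vars_lebesgue_integral[OF _ ind int]) auto
  also have "\<dots> = (\<Prod>i<m k. CLINT w|M k. hx (Xs k i w)) * (\<Prod>j<n k. CLINT w|M k. hy (Ys k j w))"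
    by (simp add: prod.Plus h_def comp_def)
  also have "(\<Prod>i<m k. CLINT w|M k. hx (Xs k i w)) = (\<Prod>i<m k. X.cchar ((1 / real (m k)) *\<^sub>R (- u)))"
  proof (intro prod.cong refl)
    fix i assume "i \<in> {..<m k}"
    then have "(CLINT w|M k. hx (Xs k i w)) = (CLINT w|P. hx (X w))" by (intro X.row_expectation) auto
    then show "(CLINT w|M k. hx (Xs k i w)) = X.cchar ((1 / real (m k)) *\<^sub>R (- u))"
      unfolding X.cchar_def hx_def .
  qed
  also have "(\<Prod>j<n k. CLINT w|M k. hy (Ys k j w)) = (\<Prod>j<n k. Y.cchar ((1 / real (n k)) *\<^sub>R u))"
  proof (intro prod.cong refl)
    fix i assume "i \<in> {..<n k}"
    then have "(CLINT w|M k. hy (Ys k i w)) = (CLINT w|P. hy (Y w))" by (intro Y.row_expectation) auto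
    then show "(CLINT w|M k. hy (Ys k i w)) = Y.cchar ((1 / real (n k)) *\<^sub>R u)"
      unfolding Y.cchar_def hy_def .
  qed
  finally show ?thesis by simp
qed

lemma bilinear_form: "bilinear (form k)"
  unfolding bilinear_def form_def
  by (intro conjI allI linearI)
    (simp_all add: matrix_vector_right_distrib inner_add_right inner_add_left matrix_vector_mult_scaleR add_divide_distrib distrib_left)

lemma form_sym: "form k u w = form k w u"
  by (simp add: form_def X.cov_matrix_sym[of u] Y.cov_matrix_sym[of u])

lemma form_pos: "u \<noteq> 0 \<Longrightarrow> 0 < form k u u"
  unfolding form_def using X.cov_matrix_pos[of u] Y.cov_matrix_pos[of u] X.size_pos Y.size_pos
  by (intro add_pos_pos) auto

text \<open>The basis depends on \<open>k\<close>, as the form does through the two sample sizes.\<close>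

lemma form_basis:
  obtains v :: "nat \<Rightarrow> nat \<Rightarrow> real ^ 'd" where
    "\<And>k i j. i < CARD('d) \<Longrightarrow> j < CARD('d) \<Longrightarrow> form k (v k i) (v k j) = of_bool (i = j)"
    "\<And>k. span (v k ` {..<CARD('d)}) = UNIV"
proof -
  have "\<exists>v::nat \<Rightarrow> real ^ 'd. (\<forall>i<CARD('d). \<forall>j<CARD('d). form k (v i) (v j) = of_bool (i = j)) \<and> span (v ` {..<CARD('d)}) = UNIV" for k
    using form_orthonormal_basis[OF bilinear_form form_sym form_pos, of k] by (metis DIM_cart DIM_real mult.right_neutral)
  then obtain v :: "nat \<Rightarrow> nat \<Rightarrow> real ^ 'd" where
    "\<And>k. (\<forall>i<CARD('d). \<forall>j<CARD('d). form k (v k i) (v k j) = of_bool (i = j)) \<and> span (v k ` {..<CARD('d)}) = UNIV"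
    by metis
  then show thesis by (intro that[of v]) blast+
qed

text \<open>The combination \<open>u\<close> of basis vectors satisfies \<open>form k u u = \<bar>g\<bar>\<^sup>2\<close>. Coercivity of the two covariance
  matrices bounds the length of \<open>u\<close> by the square root of either sample size, as
  \<open>cchar_power_limit\<close> demands, and the two Gaussian exponents add up to \<open>- \<bar>g\<bar>\<^sup>2 / 2\<close>.\<close>

lemma standardised_char_limit:
  assumes v: "\<And>k i j. i < CARD('d) \<Longrightarrow> j < CARD('d) \<Longrightarrow> form k (v k i) (v k j) = of_bool (i = j)"
  shows "(\<lambda>k. CLINT w|M k. iexp (\<Sum>i<CARD('d). g i * (v k i \<bullet> deviation k w))) \<longlonglongrightarrow>
    complex_of_real (exp (- (\<Sum>i<CARD('d). (g i)\<^sup>2) / 2))"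
proof -
  define U where "U k = (\<Sum>i<CARD('d). g i *\<^sub>R v k i)" for k
  define r where "r = (\<Sum>i<CARD('d). (g i)\<^sup>2)"
  let ?qx = "\<lambda>k. U k \<bullet> (cov_matrix P X *v U k)" and ?qy = "\<lambda>k. U k \<bullet> (cov_matrix P Y *v U k)"
  have U: "(\<Sum>i<CARD('d). g i * (v k i \<bullet> deviation k w)) = U k \<bullet> deviation k w" for k w
    by (simp add: U_def inner_sum_left)
  have r: "?qx k / real (m k) + ?qy k / real (n k) = r" for k
    using form_combination[OF bilinear_form v, of "CARD('d)" k g] by (simp add: U_def r_def form_def)
  have qx: "?qx k \<le> r * real (m k)" and qy: "?qy k \<le> r * real (n k)" for k
  proof -
    have "0 \<le> ?qx k / real (m k)" "0 \<le> ?qy k / real (n k)" using X.cov_matrix_nonneg Y.cov_matrix_nonneg by simp_all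
    with r[of k] have "?qx k / real (m k) \<le> r" "?qy k / real (n k) \<le> r" by linarith+
    then show "?qx k \<le> r * real (m k)" "?qy k \<le> r * real (n k)" using X.size_pos[of k] Y.size_pos[of k] by (simp_all add: field_simps)
  qed
  obtain cx where cx: "0 < cx" "\<And>u. cx * (norm u)\<^sup>2 \<le> u \<bullet> (cov_matrix P X *v u)" using X.cov_matrix_coercive by blast
  obtain cy where cy: "0 < cy" "\<And>u. cy * (norm u)\<^sup>2 \<le> u \<bullet> (cov_matrix P Y *v u)" using Y.cov_matrix_coercive by blast
  have nx: "(norm (- U k))\<^sup>2 \<le> r / cx * real (m k)" for k
    using order_trans[OF cx(2) qx] cx(1) by (simp add: field_simps)
  have ny: "(norm (U k))\<^sup>2 \<le> r / cy * real (n k)" for k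
    using order_trans[OF cy(2) qy] cy(1) by (simp add: field_simps)
  let ?a = "\<lambda>k. X.cchar ((1 / real (m k)) *\<^sub>R (- U k)) ^ m k" and ?b = "\<lambda>k. Y.cchar ((1 / real (n k)) *\<^sub>R U k) ^ n k"
  let ?a' = "\<lambda>k. complex_of_real (exp (- ?qx k / (2 * real (m k))))" and ?b' = "\<lambda>k. complex_of_real (exp (- ?qy k / (2 * real (n k))))"
  have nX: "- U k \<bullet> (cov_matrix P X *v (- U k)) = ?qx k" for k
    using matrix_vector_mult_scaleR[of "cov_matrix P X" "- 1" "U k"] by simp
  have la: "(\<lambda>k. ?a k - ?a' k) \<longlonglongrightarrow> 0"
    using X.cchar_power_limit[OF X.size_lim nx X.size_pos] unfolding nX .
  have lb: "(\<lambda>k. ?b k - ?b' k) \<longlonglongrightarrow> 0"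
    by (rule Y.cchar_power_limit[OF Y.size_lim ny Y.size_pos])
  have prod': "?a' k * ?b' k = complex_of_real (exp (- r / 2))" for k
  proof -
    have "- ?qx k / (2 * real (m k)) + - ?qy k / (2 * real (n k)) = - r / 2" using r[of k] by (simp add: field_simps)
    then show ?thesis by (simp only: of_real_mult[symmetric] exp_add[symmetric])
  qed
  have "(\<lambda>k. ?a k * ?b k - ?a' k * ?b' k) \<longlonglongrightarrow> 0"
  proof (rule Lim_null_comparison)
    show "(\<lambda>k. norm (?a k - ?a' k) + norm (?b k - ?b' k)) \<longlonglongrightarrow> 0"
      using tendsto_add[OF tendsto_norm_zero[OF la] tendsto_norm_zero[OF lb]] by simp
    show "\<forall>\<^sub>F k in sequentially. norm (?a k * ?b k - ?a' k * ?b' k) \<le> norm (?a k - ?a' k) + norm (?b k - ?b' k)"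
    proof (rule always_eventually, rule allI)
      fix k
      have b1: "norm (?b k) \<le> 1" using power_le_one[OF norm_ge_zero Y.norm_cchar_le_1] by (simp add: norm_power)
      have a1: "norm (?a' k) \<le> 1" using X.cov_matrix_nonneg[of "U k"] by simp
      show "norm (?a k * ?b k - ?a' k * ?b' k) \<le> norm (?a k - ?a' k) + norm (?b k - ?b' k)"
        using b1 a1 by (rule norm_mult_diff_le)
    qed
  qed
  then have "(\<lambda>k. ?a k * ?b k) \<longlonglongrightarrow> complex_of_real (exp (- r / 2))"
    unfolding prod' by (rule Lim_null[THEN iffD2])
  then show ?thesis unfolding U char_deviation r_def .
qed

end

section \<open>Convergence of the extended ratio\<close>

lemma cts_step_clamp:
  assumes "x < y"
  shows "cts_step x y t = max 0 (min 1 ((y - t) / (y - x)))"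
proof -
  consider "t \<le> x" | "x < t" "t < y" | "y \<le> t" by linarith
  then show ?thesis
  proof cases
    case 1
    then have "1 \<le> (y - t) / (y - x)" using assms by simp
    with 1 show ?thesis by (simp add: cts_step_def)
  next
    case 2
    then have "0 \<le> (y - t) / (y - x)" "(y - t) / (y - x) \<le> 1" using assms by simp_all
    with 2 show ?thesis by (simp add: cts_step_def)
  next
    case 3
    then have "(y - t) / (y - x) \<le> 0" using assms by (simp add: divide_nonpos_pos)
    with 3 assms show ?thesis by (simp add: cts_step_def)
  qed
qed

lemma cts_step_range: "0 \<le> cts_step x y t" "cts_step x y t \<le> 1" if "x < y"
  unfolding cts_step_clamp[OF that] by simp_all

lemma cts_step_lipschitz:
  assumes "x < y"
  shows "\<bar>cts_step x y a - cts_step x y b\<bar> \<le> \<bar>a - b\<bar> / (y - x)"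
proof -
  have clamp: "\<bar>max 0 (min 1 p) - max 0 (min 1 q)\<bar> \<le> \<bar>p - q\<bar>" for p q :: real
    by (simp add: max_def min_def)
  have "\<bar>cts_step x y a - cts_step x y b\<bar> \<le> \<bar>(y - a) / (y - x) - (y - b) / (y - x)\<bar>"
    unfolding cts_step_clamp[OF assms] by (rule clamp)
  also have "(y - a) / (y - x) - (y - b) / (y - x) = (b - a) / (y - x)"
    by (simp add: diff_divide_distrib[symmetric])
  also have "\<bar>(b - a) / (y - x)\<bar> = \<bar>a - b\<bar> / (y - x)"
    using assms by (simp add: abs_divide abs_minus_commute)
  finally show ?thesis .
qed

lemma cts_step_measurable: "x < y \<Longrightarrow> cts_step x y \<in> borel_measurable borel"
  by (intro borel_measurable_continuous_onI uniformly_continuous_imp_continuous cts_step_uniformly_continuous)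

text \<open>Closeness is only available where \<open>Z \<le> K\<close>. The probability of the complement is controlled by the
  step function between \<open>K - 1\<close> and \<open>K\<close>, whose expectation converges by assumption to a number close
  to one for large \<open>K\<close>.\<close>

lemma slutsky_truncated:
  fixes T Z :: "nat \<Rightarrow> 'a \<Rightarrow> real" and \<mu> :: "real measure"
  assumes M: "\<And>k. prob_space (M k)" and \<mu>: "real_distribution \<mu>"
    and T: "\<And>k. T k \<in> borel_measurable (M k)" and Z: "\<And>k. Z k \<in> borel_measurable (M k)"
    and limZ: "\<And>x y. x < y \<Longrightarrow> (\<lambda>k. LINT w|M k. cts_step x y (Z k w)) \<longlonglongrightarrow> (LINT t|\<mu>. cts_step x y t)"
    and close: "\<And>\<tau> K. 0 < \<tau> \<Longrightarrow> 0 < K \<Longrightarrow> \<exists>Bad. (\<forall>k. Bad k \<in> sets (M k)) \<and> (\<lambda>k. measure (M k) (Bad k)) \<longlonglongrightarrow> 0 \<and>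
      (\<forall>\<^sub>F k in sequentially. \<forall>w\<in>space (M k) - Bad k. Z k w \<le> K \<longrightarrow> \<bar>T k w - Z k w\<bar> \<le> \<tau>)"
  shows "weak_conv_m (\<lambda>k. distr (M k) borel (T k)) \<mu>"
proof (rule integral_cts_step_conv_imp_weak_conv)
  show "real_distribution (distr (M k) borel (T k))" for k
    using M T by (intro prob_space.real_distribution_distr) auto
  show "real_distribution \<mu>" by fact
  interpret mu: real_distribution \<mu> by fact
  fix x y :: real assume xy: "x < y"
  note [measurable] = T Z cts_step_measurable[OF xy]
  have "(\<lambda>k. (LINT w|M k. cts_step x y (T k w)) - (LINT w|M k. cts_step x y (Z k w))) \<longlonglongrightarrow> 0"
  proof (rule LIMSEQ_I)
    fix e :: real assume e: "0 < e"
    have "(cdf \<mu> \<longlongrightarrow> 1) at_top" by (rule mu.cdf_lim_at_top_prob)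
    then have "\<forall>\<^sub>F t in at_top. 1 - e / 4 < cdf \<mu> t" using e by (intro order_tendstoD) auto
    then obtain t0 where t0: "\<And>t. t0 \<le> t \<Longrightarrow> 1 - e / 4 < cdf \<mu> t" by (auto simp: eventually_at_top_linorder)
    \<comment> \<open>the limit law puts mass at most \<open>e / 4\<close> beyond \<open>K - 1\<close>\<close>
    define K where "K = max 1 (t0 + 1)"
    have K: "0 < K" "t0 \<le> K - 1" by (simp_all add: K_def)
    let ?c = "cts_step (K - 1) K"
    have K1: "K - 1 < K" by simp
    note [measurable] = cts_step_measurable[OF K1]
    have "1 - e / 4 < (LINT t|\<mu>. ?c t)" using t0[OF K(2)] mu.cdf_cts_step(1)[OF K1] by linarith
    with limZ[OF K1] have ev1: "\<forall>\<^sub>F k in sequentially. 1 - e / 4 < (LINT w|M k. ?c (Z k w))"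
      by (rule order_tendstoD)
    define \<tau> where "\<tau> = (y - x) * (e / 4)"
    have \<tau>: "0 < \<tau>" using xy e by (simp add: \<tau>_def)
    obtain Bad where Bad: "\<And>k. Bad k \<in> sets (M k)" "(\<lambda>k. measure (M k) (Bad k)) \<longlonglongrightarrow> 0"
      and cl: "\<forall>\<^sub>F k in sequentially. \<forall>w\<in>space (M k) - Bad k. Z k w \<le> K \<longrightarrow> \<bar>T k w - Z k w\<bar> \<le> \<tau>"
      using close[OF \<tau> K(1)] by blast
    have ev2: "\<forall>\<^sub>F k in sequentially. measure (M k) (Bad k) < e / 4"
      using Bad(2) e by (intro order_tendstoD) auto
    have "\<forall>\<^sub>F k in sequentially. norm ((LINT w|M k. cts_step x y (T k w)) - (LINT w|M k. cts_step x y (Z k w)) - 0) < e"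
      using ev1 ev2 cl
    proof eventually_elim
      case (elim k)
      interpret Mk: prob_space "M k" by (rule M)
      note [measurable] = Bad(1)[of k]
      have i1: "integrable (M k) (\<lambda>w. cts_step x y (T k w))" "integrable (M k) (\<lambda>w. cts_step x y (Z k w))" "integrable (M k) (\<lambda>w. ?c (Z k w))"
        using cts_step_range[OF xy] cts_step_range[OF K1] by (intro Mk.integrable_const_bound[where B = 1]; auto)+
      have i2: "integrable (M k) (\<lambda>w. indicator (Bad k) w :: real)" by (intro Mk.integrable_const_bound[where B = 1]) (auto simp: indicator_def)
      have "norm ((LINT w|M k. cts_step x y (T k w)) - (LINT w|M k. cts_step x y (Z k w)) - 0) = \<bar>LINT w|M k. cts_step x y (T k w) - cts_step x y (Z k w)\<bar>"
        using i1 by simp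
      also have "\<dots> \<le> (LINT w|M k. \<bar>cts_step x y (T k w) - cts_step x y (Z k w)\<bar>)" by (rule integral_abs_bound)
      also have "\<dots> \<le> (LINT w|M k. (e / 4 + indicator (Bad k) w) + (1 - ?c (Z k w)))"
      proof (rule integral_mono)
        show "integrable (M k) (\<lambda>w. \<bar>cts_step x y (T k w) - cts_step x y (Z k w)\<bar>)" using i1 by (intro integrable_abs Bochner_Integration.integrable_diff)
        show "integrable (M k) (\<lambda>w. (e / 4 + indicator (Bad k) w) + (1 - ?c (Z k w)))" using i1 i2 by auto
        fix w assume w: "w \<in> space (M k)"
        have le1: "\<bar>cts_step x y (T k w) - cts_step x y (Z k w)\<bar> \<le> 1"
          using cts_step_range[OF xy, of "T k w"] cts_step_range[OF xy, of "Z k w"] by linarith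
        have c1: "0 \<le> 1 - ?c (Z k w)" using cts_step_range[OF K1] by simp
        consider "w \<in> Bad k" | "K < Z k w" | "w \<notin> Bad k" "Z k w \<le> K" by linarith
        then show "\<bar>cts_step x y (T k w) - cts_step x y (Z k w)\<bar> \<le> (e / 4 + indicator (Bad k) w) + (1 - ?c (Z k w))"
        proof cases
          case 1 then show ?thesis using le1 c1 e by simp
        next
          case 2
          then have "?c (Z k w) = 0" by (simp add: cts_step_def)
          then show ?thesis using le1 e by (simp add: indicator_def)
        next
          case 3
          then have "\<bar>T k w - Z k w\<bar> \<le> \<tau>" using elim(3) w by blast
          then have "\<bar>T k w - Z k w\<bar> / (y - x) \<le> e / 4" using xy by (simp add: \<tau>_def field_simps)
          with cts_step_lipschitz[OF xy, of "T k w" "Z k w"]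
          have "\<bar>cts_step x y (T k w) - cts_step x y (Z k w)\<bar> \<le> e / 4" by linarith
          moreover have "indicator (Bad k) w = (0::real)" using 3 by simp
          ultimately show ?thesis using c1 by linarith
        qed
      qed
      also have "\<dots> = e / 4 + measure (M k) (Bad k) + (1 - (LINT w|M k. ?c (Z k w)))"
        using i1 i2 by (simp add: Mk.prob_space)
      also have "\<dots> < e" using elim e by linarith
      finally show ?case .
    qed
    then show "\<exists>no. \<forall>k\<ge>no. norm ((LINT w|M k. cts_step x y (T k w)) - (LINT w|M k. cts_step x y (Z k w)) - 0) < e"
      by (simp only: eventually_sequentially)
  qed
  from tendsto_add[OF this limZ[OF xy]]
  have "(\<lambda>k. LINT w|M k. cts_step x y (T k w)) \<longlonglongrightarrow> (LINT t|\<mu>. cts_step x y t)" by simp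
  moreover have "(LINT t|distr (M k) borel (T k). cts_step x y t) = (LINT w|M k. cts_step x y (T k w))" for k
    by (intro integral_distr) measurable
  ultimately show "(\<lambda>k. LINT t|distr (M k) borel (T k). cts_step x y t) \<longlonglongrightarrow> (LINT t|\<mu>. cts_step x y t)" by simp
qed

context two_sample_array
begin

abbreviation eel_statistic :: "(nat \<Rightarrow> 'a \<Rightarrow> real) \<Rightarrow> nat \<Rightarrow> 'a \<Rightarrow> real" where
  "eel_statistic R k w \<equiv> eel (m k) (n k) (\<lambda>i. Xs k i w) (\<lambda>j. Ys k j w) (R k w) (mean_vec P Y - mean_vec P X)"

text \<open>The factors in \<open>eel_quadratic_comparison\<close> tend to one as the relative error \<open>e\<close> of the good event tends
  to zero, and as the total sample size grows.\<close>

lemma eel_close_to_quadratic_form: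
  fixes R :: "nat \<Rightarrow> 'a \<Rightarrow> real" and v :: "nat \<Rightarrow> nat \<Rightarrow> real ^ 'd"
  assumes v: "\<And>k i j. i < CARD('d) \<Longrightarrow> j < CARD('d) \<Longrightarrow> form k (v k i) (v k j) = of_bool (i = j)"
      "\<And>k. span (v k ` {..<CARD('d)}) = UNIV"
    and \<tau>: "0 < \<tau>" and K: "0 < K"
  defines "Z \<equiv> \<lambda>k w. \<Sum>i<CARD('d). (v k i \<bullet> deviation k w)\<^sup>2"
    and "T \<equiv> eel_statistic R"
  shows "\<exists>Bad. (\<forall>k. Bad k \<in> sets (M k)) \<and> (\<lambda>k. measure (M k) (Bad k)) \<longlonglongrightarrow> 0 \<and>
      (\<forall>\<^sub>F k in sequentially. \<forall>w\<in>space (M k) - Bad k. Z k w \<le> K \<longrightarrow> \<bar>T k w - Z k w\<bar> \<le> \<tau>)"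
proof -
  obtain cx where cx: "0 < cx" "\<And>u. cx * (norm u)\<^sup>2 \<le> u \<bullet> (cov_matrix P X *v u)" using X.cov_matrix_coercive by blast
  obtain cy where cy: "0 < cy" "\<And>u. cy * (norm u)\<^sup>2 \<le> u \<bullet> (cov_matrix P Y *v u)" using Y.cov_matrix_coercive by blast
  define c where "c = min cx cy"
  have c: "0 < c" using cx cy by (simp add: c_def)
  have cX: "c * (norm u)\<^sup>2 \<le> u \<bullet> (cov_matrix P X *v u)" for u
    by (rule order_trans[OF _ cx(2)]) (simp add: c_def mult_right_mono)
  have cY: "c * (norm u)\<^sup>2 \<le> u \<bullet> (cov_matrix P Y *v u)" for u
    by (rule order_trans[OF _ cy(2)]) (simp add: c_def mult_right_mono)
  define s where "s = sqrt (K / c)"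
  \<comment> \<open>relative error that keeps the absolute error below \<open>\<tau>\<close> while \<open>Z \<le> K\<close>\<close>
  define \<rho> where "\<rho> = min 1 (\<tau> / K)"
  have \<rho>: "0 < \<rho>" "\<rho> \<le> 1" "\<rho> * K \<le> \<tau>" using \<tau> K by (auto simp: \<rho>_def min_def field_simps)
  have "((\<lambda>e::real. (1 + 4 * (2 * e * s)) / (1 - e)) \<longlongrightarrow> (1 + 4 * (2 * 0 * s)) / (1 - 0)) (at_right 0)"
    by (intro tendsto_intros) simp
  then have f1: "\<forall>\<^sub>F e in at_right (0::real). (1 + 4 * (2 * e * s)) / (1 - e) < 1 + \<rho>"
    using \<rho> by (intro order_tendstoD) auto
  have "((\<lambda>e::real. (1 - 4 * (2 * e * s)) / (1 + e)) \<longlongrightarrow> (1 - 4 * (2 * 0 * s)) / (1 + 0)) (at_right 0)"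
    by (intro tendsto_intros) simp
  then have f2: "\<forall>\<^sub>F e in at_right (0::real). 1 - \<rho> / 2 < (1 - 4 * (2 * e * s)) / (1 + e)"
    using \<rho> by (intro order_tendstoD) auto
  have "((\<lambda>e::real. 2 * e * s) \<longlongrightarrow> 2 * 0 * s) (at_right 0)" by (intro tendsto_intros)
  then have f3: "\<forall>\<^sub>F e in at_right (0::real). 2 * e * s < 1 / 4" by (intro order_tendstoD) auto
  have f4: "\<forall>\<^sub>F e in at_right (0::real). e \<in> {0<..<1 / 2}" by (rule eventually_at_right_real) simp
  from f1 f2 f3 f4 have "\<forall>\<^sub>F e in at_right (0::real). (1 + 4 * (2 * e * s)) / (1 - e) < 1 + \<rho> \<and>
      1 - \<rho> / 2 < (1 - 4 * (2 * e * s)) / (1 + e) \<and> 2 * e * s < 1 / 4 \<and> 0 < e \<and> e < 1 / 2"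
    by eventually_elim auto
  then obtain e where e: "(1 + 4 * (2 * e * s)) / (1 - e) < 1 + \<rho>"
      "1 - \<rho> / 2 < (1 - 4 * (2 * e * s)) / (1 + e)" "2 * e * s < 1 / 4" "0 < e" "e < 1 / 2"
    using eventually_happens'[of "at_right (0::real)"] by auto
  obtain BX where BX: "\<And>k. BX k \<in> sets (M k)" "(\<lambda>k. measure (M k) (BX k)) \<longlonglongrightarrow> 0"
    "\<And>k w i. w \<in> space (M k) - BX k \<Longrightarrow> i < m k \<Longrightarrow> norm (centred (m k) (\<lambda>i. Xs k i w) i) \<le> e * sqrt (real (m k))"
    "\<And>k w u. w \<in> space (M k) - BX k \<Longrightarrow>
      \<bar>real (m k) * (u \<bullet> scaled_scatter (m k) (\<lambda>i. Xs k i w) u) - u \<bullet> (cov_matrix P X *v u)\<bar> \<le> e * (u \<bullet> (cov_matrix P X *v u))"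
    using X.good_event[OF e(4)] by blast
  obtain BY where BY: "\<And>k. BY k \<in> sets (M k)" "(\<lambda>k. measure (M k) (BY k)) \<longlonglongrightarrow> 0"
    "\<And>k w i. w \<in> space (M k) - BY k \<Longrightarrow> i < n k \<Longrightarrow> norm (centred (n k) (\<lambda>i. Ys k i w) i) \<le> e * sqrt (real (n k))"
    "\<And>k w u. w \<in> space (M k) - BY k \<Longrightarrow>
      \<bar>real (n k) * (u \<bullet> scaled_scatter (n k) (\<lambda>i. Ys k i w) u) - u \<bullet> (cov_matrix P Y *v u)\<bar> \<le> e * (u \<bullet> (cov_matrix P Y *v u))"
    using Y.good_event[OF e(4)] by blast
  have Nlim: "filterlim (\<lambda>k. real (m k + n k)) at_top sequentially"
    by (rule filterlim_at_top_mono[OF X.real_size_lim]) simp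
  have "(\<lambda>k. 1 / (1 + 2 * K / real (m k + n k))\<^sup>2) \<longlonglongrightarrow> 1 / (1 + 0)\<^sup>2"
    by (intro tendsto_intros real_tendsto_divide_at_top[OF tendsto_const Nlim]) simp
  then have big: "\<forall>\<^sub>F k in sequentially. 1 - \<rho> / 2 < 1 / (1 + 2 * K / real (m k + n k))\<^sup>2"
    using \<rho> by (intro order_tendstoD) auto
  show ?thesis
  proof (intro exI[of _ "\<lambda>k. BX k \<union> BY k"] conjI allI)
    show "BX k \<union> BY k \<in> sets (M k)" for k using BX(1) BY(1) by (rule sets.Un)
    have bd: "(\<lambda>k. measure (M k) (BX k) + measure (M k) (BY k)) \<longlonglongrightarrow> 0" using tendsto_add[OF BX(2) BY(2)] by simp
    show "(\<lambda>k. measure (M k) (BX k \<union> BY k)) \<longlonglongrightarrow> 0"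
      by (rule tendsto_sandwich[OF _ _ tendsto_const bd]) (auto intro!: always_eventually measure_Un_le BX(1) BY(1))
    show "\<forall>\<^sub>F k in sequentially. \<forall>w\<in>space (M k) - (BX k \<union> BY k). Z k w \<le> K \<longrightarrow> \<bar>T k w - Z k w\<bar> \<le> \<tau>"
      using big
    proof (eventually_elim, intro ballI impI)
      fix k w assume big: "1 - \<rho> / 2 < 1 / (1 + 2 * K / real (m k + n k))\<^sup>2"
        and w: "w \<in> space (M k) - (BX k \<union> BY k)" and ZK: "Z k w \<le> K"
      let ?D = "\<lambda>i. v k i \<bullet> (theta_hat (m k) (n k) (\<lambda>i. Xs k i w) (\<lambda>j. Ys k j w) - (mean_vec P Y - mean_vec P X))"
      have Zk: "Z k w = (\<Sum>i<CARD('d). (?D i)\<^sup>2)" by (simp add: Z_def deviation_def)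
      have Z0: "0 \<le> Z k w" unfolding Zk by (intro sum_nonneg) simp
      have wX: "w \<in> space (M k) - BX k" and wY: "w \<in> space (M k) - BY k" using w by auto
      have orth: "v k i \<bullet> (cov_matrix P X *v v k j) / real (m k) + v k i \<bullet> (cov_matrix P Y *v v k j) / real (n k) = of_bool (i = j)"
        if "i < CARD('d)" "j < CARD('d)" for i j using v(1)[OF that, of k] by (simp only: form_def)
      have e0: "0 \<le> e" "e \<le> 1 / 2" using e by simp_all
      have es: "2 * e * sqrt (K / c) \<le> 1 / 4" using e by (simp add: s_def)
      note cmp = eel_quadratic_comparison[OF X.size_pos Y.size_pos cX X.cov_matrix_sym cY Y.cov_matrix_sym c
          BX(3)[OF wX] BX(4)[OF wX] BY(3)[OF wY] BY(4)[OF wY] orth v(2) e0 ZK[unfolded Zk] es,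
          where r = "R k w", folded s_def, folded Zk]
      have T: "T k w = eel (m k) (n k) (\<lambda>i. Xs k i w) (\<lambda>j. Ys k j w) (R k w) (mean_vec P Y - mean_vec P X)" by (simp add: T_def)
      have up: "T k w \<le> (1 + 4 * (2 * e * s)) / (1 - e) * Z k w"
        unfolding T using cmp(1) .
      have low: "(1 - 4 * (2 * e * s)) / (1 + e) / (1 + 2 * K / real (m k + n k))\<^sup>2 * Z k w \<le> T k w"
        unfolding T using cmp(2) .
      have "T k w \<le> (1 + \<rho>) * Z k w" using up mult_right_mono[OF less_imp_le[OF e(1)] Z0] by linarith
      moreover have "(1 - \<rho>) * Z k w \<le> T k w"
      proof -
        have "(1 - \<rho>) \<le> (1 - \<rho> / 2) * (1 - \<rho> / 2)" by (simp add: algebra_simps)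
        also have "\<dots> \<le> ((1 - 4 * (2 * e * s)) / (1 + e)) * (1 / (1 + 2 * K / real (m k + n k))\<^sup>2)"
          using e(2) big \<rho> by (intro mult_mono less_imp_le[OF e(2)] less_imp_le[OF big]) auto
        also have "\<dots> = (1 - 4 * (2 * e * s)) / (1 + e) / (1 + 2 * K / real (m k + n k))\<^sup>2" by simp
        finally show ?thesis using low mult_right_mono[OF _ Z0] by (meson order_trans)
      qed
      ultimately have "\<bar>T k w - Z k w\<bar> \<le> \<rho> * Z k w" by (simp add: abs_le_iff algebra_simps)
      also have "\<dots> \<le> \<rho> * K" using ZK \<rho> by (intro mult_left_mono) auto
      also have "\<dots> \<le> \<tau>" by (rule \<rho>(3))
      finally show "\<bar>T k w - Z k w\<bar> \<le> \<tau>" .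
    qed
  qed
qed

lemma eel_measurable:
  assumes "R \<in> borel_measurable (M k)"
  shows "(\<lambda>w. eel (m k) (n k) (\<lambda>i. Xs k i w) (\<lambda>j. Ys k j w) (R w) \<theta>) \<in> borel_measurable (M k)"
  by (rule measurable_eel[OF X.size_pos Y.size_pos X.Xs_measurable Y.Xs_measurable assms])

theorem eel_converges_to_chi_square:
  assumes R: "\<And>k. R k \<in> borel_measurable (M k)"
  shows "weak_conv_m (\<lambda>k. distr (M k) borel (eel_statistic R k))
    (chi_square CARD('d))"
proof -
  obtain v where v: "\<And>k i j. i < CARD('d) \<Longrightarrow> j < CARD('d) \<Longrightarrow> form k (v k i) (v k j) = of_bool (i = j)"
    "\<And>k. span (v k ` {..<CARD('d)}) = UNIV" using form_basis by blast
  let ?Z = "\<lambda>k w. \<Sum>i<CARD('d). (v k i \<bullet> deviation k w)\<^sup>2"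
  have zm: "(\<lambda>w. v k i \<bullet> deviation k w) \<in> borel_measurable (M k)" for k i by measurable
  show ?thesis
  proof (rule slutsky_truncated[where Z = ?Z])
    show "?Z k \<in> borel_measurable (M k)" for k by measurable
    show "(\<lambda>k. LINT w|M k. cts_step x y (?Z k w)) \<longlonglongrightarrow> (LINT t|chi_square CARD('d). cts_step x y t)" if "x < y" for x y
      by (rule cts_step_chi_square_limit[OF X.prob_M zm standardised_char_limit[OF v(1)] that])
    show "\<exists>Bad. (\<forall>k. Bad k \<in> sets (M k)) \<and> (\<lambda>k. measure (M k) (Bad k)) \<longlonglongrightarrow> 0 \<and>
      (\<forall>\<^sub>F k in sequentially. \<forall>w\<in>space (M k) - Bad k. ?Z k w \<le> K \<longrightarrow>
        \<bar>eel_statistic R k w - ?Z k w\<bar> \<le> \<tau>)"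
      if "0 < \<tau>" "0 < K" for \<tau> K
      using v that by (rule eel_close_to_quadratic_form)
  qed (use X.prob_M real_distribution_chi_square eel_measurable R in auto)
qed

end

theorem theorem2:
  fixes P :: "'b measure" and X Y :: "'b \<Rightarrow> real ^ 'd"
    and M :: "nat \<Rightarrow> 'a measure" and Xs Ys :: "nat \<Rightarrow> nat \<Rightarrow> 'a \<Rightarrow> real ^ 'd"
    and m :: "nat \<Rightarrow> nat" and R :: "nat \<Rightarrow> 'a \<Rightarrow> real" and T :: "nat \<Rightarrow> 'a \<Rightarrow> real"
  assumes "prob_space P" and "X \<in> borel_measurable P" and "Y \<in> borel_measurable P"
    and "finite_cov P X" and "rank (cov_matrix P X) = CARD('d)"
    and "finite_cov P Y" and "rank (cov_matrix P Y) = CARD('d)"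
    and "\<And>n. CARD('d) < n \<Longrightarrow> n \<le> m n"
    and "(\<lambda>n. real (m n) / real n) \<in> O(\<lambda>_. 1)"
    and "\<And>n. CARD('d) < n \<Longrightarrow> prob_space (M n)"
    and "\<And>n. CARD('d) < n \<Longrightarrow> prob_space.indep_vars (M n) (\<lambda>_. borel)
           (case_sum (Xs n) (Ys n)) ({..<m n} <+> {..<n})"
    and "\<And>n i. CARD('d) < n \<Longrightarrow> i < m n \<Longrightarrow> distr (M n) borel (Xs n i) = distr P borel X"
    and "\<And>n j. CARD('d) < n \<Longrightarrow> j < n \<Longrightarrow> distr (M n) borel (Ys n j) = distr P borel Y"
    and "\<And>n. CARD('d) < n \<Longrightarrow> R n \<in> borel_measurable (M n)"
    and "\<And>n w. T n w = eel (m n) n (\<lambda>i. Xs n i w) (\<lambda>j. Ys n j w) (R n w)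
           (mean_vec P Y - mean_vec P X)"
  shows "(\<forall>n > CARD('d). T n \<in> borel_measurable (M n)) \<and>
    weak_conv_m (\<lambda>n. distr (M n) borel (T n)) (chi_square CARD('d))"
proof -
  \<comment> \<open>nothing is assumed for sample sizes up to the dimension, so the array starts beyond it\<close>
  define D where "D = Suc CARD('d)"
  have D: "CARD('d) < k + D" for k by (simp add: D_def)
  have rowX: "prob_space.indep_vars (M n) (\<lambda>_. borel) (Xs n) {..<m n}"
    and rowY: "prob_space.indep_vars (M n) (\<lambda>_. borel) (Ys n) {..<n}" if "CARD('d) < n" for n
  proof -
    interpret Mn: prob_space "M n" using assms(10) that .
    note J = assms(11)[OF that]
    have "Mn.indep_vars (\<lambda>_. borel) (\<lambda>i. case_sum (Xs n) (Ys n) (Inl i)) {..<m n}"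
      by (rule Mn.indep_vars_inj_reindex) (auto intro!: Mn.indep_vars_subset[OF J])
    then show "Mn.indep_vars (\<lambda>_. borel) (Xs n) {..<m n}" by simp
    have "Mn.indep_vars (\<lambda>_. borel) (\<lambda>i. case_sum (Xs n) (Ys n) (Inr i)) {..<n}"
      by (rule Mn.indep_vars_inj_reindex) (auto intro!: Mn.indep_vars_subset[OF J])
    then show "Mn.indep_vars (\<lambda>_. borel) (Ys n) {..<n}" by simp
  qed
  have nlim: "filterlim (\<lambda>k. k + D) at_top sequentially" by (rule filterlim_add_const_nat_at_top)
  have mlim: "filterlim (\<lambda>k. m (k + D)) at_top sequentially"
    by (rule filterlim_at_top_mono[OF nlim]) (use assms(8)[OF D] in auto)
  have mpos: "0 < m (k + D)" for k using assms(8)[OF D, of k] D[of k] by linarith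
  interpret A: two_sample_array P X Y "\<lambda>k. M (k + D)" "\<lambda>k. Xs (k + D)" "\<lambda>k. Ys (k + D)" "\<lambda>k. m (k + D)" "\<lambda>k. k + D"
  proof -
    have PX: "full_rank_vector P X" and PY: "full_rank_vector P Y"
      using assms(1-7) by (auto simp: full_rank_vector_def full_rank_vector_axioms_def finite_cov_vector_def finite_cov_vector_axioms_def)
    show "two_sample_array P X Y (\<lambda>k. M (k + D)) (\<lambda>k. Xs (k + D)) (\<lambda>k. Ys (k + D)) (\<lambda>k. m (k + D)) (\<lambda>k. k + D)"
      unfolding two_sample_array_def two_sample_array_axioms_def iid_rows_def iid_rows_axioms_def
      using PX PY assms(10-13) D rowX rowY mlim nlim mpos by (auto simp: D_def)
  qed
  have T: "T n = (\<lambda>w. eel (m n) n (\<lambda>i. Xs n i w) (\<lambda>j. Ys n j w) (R n w) (mean_vec P Y - mean_vec P X))" for n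
    using assms(15) by blast
  have meas: "T n \<in> borel_measurable (M n)" if n: "CARD('d) < n" for n
  proof -
    obtain k where k: "n = k + D" using n by (metis D_def add.commute less_natE add_Suc_right add_Suc)
    show ?thesis unfolding k T by (rule A.eel_measurable) (rule assms(14)[OF D])
  qed
  have "weak_conv_m (\<lambda>k. distr (M (k + D)) borel (T (k + D))) (chi_square CARD('d))"
    unfolding T by (rule A.eel_converges_to_chi_square) (rule assms(14)[OF D])
  then have shifted: "(\<lambda>k. cdf (distr (M (k + D)) borel (T (k + D))) x) \<longlonglongrightarrow> cdf (chi_square CARD('d)) x"
    if "isCont (cdf (chi_square CARD('d))) x" for x
    using that unfolding weak_conv_m_def weak_conv_def by blast
  have "weak_conv_m (\<lambda>n. distr (M n) borel (T n)) (chi_square CARD('d))"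
    unfolding weak_conv_m_def weak_conv_def
  proof (intro allI impI)
    fix x assume "isCont (cdf (chi_square CARD('d))) x"
    from shifted[OF this] show "(\<lambda>n. cdf (distr (M n) borel (T n)) x) \<longlonglongrightarrow> cdf (chi_square CARD('d)) x"
      by (rule LIMSEQ_offset[where k = D])
  qed
  with meas show ?thesis by blast
qed

end
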